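(* Let $X$ be a $7$-systolic simplicial complex. Then its $1$-skeleton $X^{(1)}$, equipped with the standard path metric in which every edge has length $1$, is Gromov hyperbolic.
   Context: Simplicial complexes are not assumed finite dimensional or locally finite, and are equipped with the CW topology. A simplicial complex is flag if every finite set of vertices pairwise connected by edges spans a simplex. A cycle is a subcomplex homeomorphic to $S^1$; its length is its number of edges. A diagonal of a cycle is an edge (of the ambient complex) connecting two nonconsecutive vertices of the cycle. The link $X_v$ of a vertex $v$ is the subcomplex of all simplices that do not contain $v$ but together with $v$ span a simplex of $X$. For $k\ge 4$, a simplicial complex is $k$-large if it is flag and every cycle of length $m$ with $4\le m<k$ has a diagonal; it is locally $k$-large if the links of all its vertices are $k$-large. A simplicial complex is $k$-systolic if it is locally $k$-large, connected and simply connected. The standard metric on $X^{(1)}$: each edge is isometric to the Euclidean unit interval, and the distance between two points of $X^{(1)}$ is the length of a shortest path between them; this is a geodesic metric space. A geodesic metric space is Gromov hyperbolic if there is $\delta>0$ such that for every geodesic triangle each side is contained in the union of the $\delta$-neighbourhoods of the two other sides. *)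

theory Defs
  imports "HOL-Analysis.Analysis"
begin

section \<open>Abstract simplicial complexes and their geometric realisation\<close>

text \<open>
  A simplicial complex is given by its set of simplices, each a nonempty finite set of vertices.
  There is no bound on the dimension and no local finiteness assumption.
\<close>

definition abstract_simplicial_complex :: "'a set set \<Rightarrow> bool" where
  "abstract_simplicial_complex X \<longleftrightarrow>
     (\<forall>\<sigma>\<in>X. finite \<sigma> \<and> \<sigma> \<noteq> {}) \<and> (\<forall>\<sigma>\<in>X. \<forall>\<tau>. \<tau> \<subseteq> \<sigma> \<and> \<tau> \<noteq> {} \<longrightarrow> \<tau> \<in> X)"

definition vertices :: "'a set set \<Rightarrow> 'a set" where
  "vertices X = {v. {v} \<in> X}"

definition edges :: "'a set set \<Rightarrow> 'a set set" where
  "edges X = {e \<in> X. card e = 2}"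

definition subcomplex :: "'a set set \<Rightarrow> 'a set set \<Rightarrow> bool" where
  "subcomplex Y X \<longleftrightarrow> abstract_simplicial_complex Y \<and> Y \<subseteq> X"

definition skeleton :: "nat \<Rightarrow> 'a set set \<Rightarrow> 'a set set" where
  "skeleton n X = {\<sigma> \<in> X. card \<sigma> \<le> n + 1}"

text \<open>Points are represented by their barycentric coordinates, extended by zero.\<close>

definition closed_simplex :: "'a set \<Rightarrow> ('a \<Rightarrow> real) set" where
  "closed_simplex \<sigma> = {x. (\<forall>v. 0 \<le> x v) \<and> (\<forall>v. v \<notin> \<sigma> \<longrightarrow> x v = 0) \<and> (\<Sum>v\<in>\<sigma>. x v) = 1}"

definition polyhedron_points :: "'a set set \<Rightarrow> ('a \<Rightarrow> real) set" where
  "polyhedron_points X = (\<Union>\<sigma>\<in>X. closed_simplex \<sigma>)"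

text \<open>
  The CW (weak) topology: a set is open iff its trace on every closed simplex is open. The product
  topology on functions induces the Euclidean topology on each closed simplex of a complex.
\<close>

definition CW_open :: "'a set set \<Rightarrow> ('a \<Rightarrow> real) set \<Rightarrow> bool" where
  "CW_open X U \<longleftrightarrow> U \<subseteq> polyhedron_points X \<and>
     (\<forall>\<sigma>\<in>X. openin (top_of_set (closed_simplex \<sigma>)) (U \<inter> closed_simplex \<sigma>))"

definition polyhedron :: "'a set set \<Rightarrow> ('a \<Rightarrow> real) topology" where
  "polyhedron X = topology (CW_open X)"

lemma istopology_CW_open: "istopology (CW_open X)"
  unfolding istopology_def
proof (intro conjI allI impI)
  fix S T
  assume S: "CW_open X S" and T: "CW_open X T"
  have "S \<inter> T \<inter> closed_simplex \<sigma> = (S \<inter> closed_simplex \<sigma>) \<inter> (T \<inter> closed_simplex \<sigma>)" for \<sigma>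
    by blast
  with S T show "CW_open X (S \<inter> T)"
    unfolding CW_open_def by (metis openin_Int le_infI1)
next
  fix \<U>
  assume \<U>: "\<forall>U\<in>\<U>. CW_open X U"
  have "openin (top_of_set (closed_simplex \<sigma>)) (\<Union>\<U> \<inter> closed_simplex \<sigma>)" if "\<sigma> \<in> X" for \<sigma>
  proof -
    have "\<Union>\<U> \<inter> closed_simplex \<sigma> = (\<Union>U\<in>\<U>. U \<inter> closed_simplex \<sigma>)"
      by blast
    moreover have "openin (top_of_set (closed_simplex \<sigma>)) (\<Union>U\<in>\<U>. U \<inter> closed_simplex \<sigma>)"
      using \<U> that by (intro openin_Union) (auto simp: CW_open_def)
    ultimately show ?thesis
      by simp
  qed
  with \<U> show "CW_open X (\<Union>\<U>)"
    by (auto simp: CW_open_def)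
qed

lemma openin_polyhedron: "openin (polyhedron X) U \<longleftrightarrow> CW_open X U"
  by (simp add: polyhedron_def istopology_CW_open topology_inverse')

lemma topspace_polyhedron: "topspace (polyhedron X) = polyhedron_points X"
proof -
  have "CW_open X (polyhedron_points X)"
    by (auto simp: CW_open_def polyhedron_points_def Int_absorb1 UN_upper)
  then show ?thesis
    unfolding topspace_def openin_polyhedron by (auto simp: CW_open_def)
qed


section \<open>Systolic complexes\<close>

definition flag_complex :: "'a set set \<Rightarrow> bool" where
  "flag_complex X \<longleftrightarrow>
     (\<forall>S. finite S \<and> S \<noteq> {} \<and> S \<subseteq> vertices X \<and>
        (\<forall>u\<in>S. \<forall>v\<in>S. u \<noteq> v \<longrightarrow> {u, v} \<in> X) \<longrightarrow> S \<in> X)"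

definition link :: "'a set set \<Rightarrow> 'a \<Rightarrow> 'a set set" where
  "link X v = {\<sigma> \<in> X. v \<notin> \<sigma> \<and> insert v \<sigma> \<in> X}"

definition cycle :: "'a set set \<Rightarrow> 'a set set \<Rightarrow> bool" where
  "cycle X C \<longleftrightarrow> subcomplex C X \<and>
     polyhedron C homeomorphic_space top_of_set (sphere (0::complex) 1)"

text \<open>
  A cycle has finitely many edges because its polyhedron is compact. Two distinct vertices of a
  cycle are consecutive iff they span an edge of the cycle.
\<close>

definition cycle_length :: "'a set set \<Rightarrow> nat" where
  "cycle_length C = card (edges C)"

definition has_diagonal :: "'a set set \<Rightarrow> 'a set set \<Rightarrow> bool" where
  "has_diagonal X C \<longleftrightarrow>
     (\<exists>u\<in>vertices C. \<exists>v\<in>vertices C. u \<noteq> v \<and> {u, v} \<notin> C \<and> {u, v} \<in> X)"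

definition large :: "nat \<Rightarrow> 'a set set \<Rightarrow> bool" where
  "large k X \<longleftrightarrow> flag_complex X \<and>
     (\<forall>C. cycle X C \<and> 4 \<le> cycle_length C \<and> cycle_length C < k \<longrightarrow> has_diagonal X C)"

definition locally_large :: "nat \<Rightarrow> 'a set set \<Rightarrow> bool" where
  "locally_large k X \<longleftrightarrow> (\<forall>v\<in>vertices X. large k (link X v))"

text \<open>
  The library notion \<open>simply_connected\<close> is restricted to subsets of a normed space; this is the
  version for abstract topologies: every loop is null-homotopic relative to its base point.
\<close>

definition simply_connected_space :: "'b topology \<Rightarrow> bool" where
  "simply_connected_space T \<longleftrightarrow> path_connected_space T \<and>
     (\<forall>p. pathin T p \<and> p 0 = p 1 \<longrightarrow>
        homotopic_with (\<lambda>h. h 0 = p 0 \<and> h 1 = p 0) (top_of_set {0..1}) T p (\<lambda>_. p 0))"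

definition systolic :: "nat \<Rightarrow> 'a set set \<Rightarrow> bool" where
  "systolic k X \<longleftrightarrow> locally_large k X \<and>
     connected_space (polyhedron X) \<and> simply_connected_space (polyhedron X)"


section \<open>The path metric on the 1-skeleton\<close>

text \<open>
  \<open>pl_path_length X x y L\<close>: there is a piecewise linear path of length \<open>L\<close> from \<open>x\<close> to \<open>y\<close> in the
  1-skeleton, that is, a concatenation of segments each contained in one closed edge. Along the edge
  \<open>{u, v}\<close> the \<open>v\<close>-coordinate is an isometry onto the unit interval. The case \<open>u = v\<close> only
  contributes constant segments of length 0.
\<close>

inductive pl_path_length :: "'a set set \<Rightarrow> ('a \<Rightarrow> real) \<Rightarrow> ('a \<Rightarrow> real) \<Rightarrow> real \<Rightarrow> bool"
  for X where
  const: "x \<in> polyhedron_points (skeleton 1 X) \<Longrightarrow> pl_path_length X x x 0"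
| segment: "\<lbrakk>{u, v} \<in> X; x \<in> closed_simplex {u, v}; y \<in> closed_simplex {u, v};
      pl_path_length X y z L\<rbrakk> \<Longrightarrow> pl_path_length X x z (\<bar>x v - y v\<bar> + L)"

text \<open>
  The value 0 for points not joined by a path is a dummy: it does not occur on the 1-skeleton of a
  connected complex, but \<open>Metric_space\<close> asks for nonnegativity off the carrier too.
\<close>

definition path_dist :: "'a set set \<Rightarrow> ('a \<Rightarrow> real) \<Rightarrow> ('a \<Rightarrow> real) \<Rightarrow> real" where
  "path_dist X x y =
     (if \<exists>L. pl_path_length X x y L then Inf {L. pl_path_length X x y L} else 0)"


section \<open>Gromov hyperbolic spaces\<close>

definition geodesic_segment :: "'b set \<Rightarrow> ('b \<Rightarrow> 'b \<Rightarrow> real) \<Rightarrow> 'b \<Rightarrow> 'b \<Rightarrow> 'b set \<Rightarrow> bool" where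
  "geodesic_segment M d x y S \<longleftrightarrow>
     (\<exists>l\<ge>0. \<exists>c. c ` {0..l} \<subseteq> M \<and> (\<forall>s\<in>{0..l}. \<forall>t\<in>{0..l}. d (c s) (c t) = \<bar>s - t\<bar>) \<and>
        c 0 = x \<and> c l = y \<and> S = c ` {0..l})"

definition geodesic_metric_space :: "'b set \<Rightarrow> ('b \<Rightarrow> 'b \<Rightarrow> real) \<Rightarrow> bool" where
  "geodesic_metric_space M d \<longleftrightarrow>
     Metric_space M d \<and> (\<forall>x\<in>M. \<forall>y\<in>M. \<exists>S. geodesic_segment M d x y S)"

definition metric_nbhd :: "'b set \<Rightarrow> ('b \<Rightarrow> 'b \<Rightarrow> real) \<Rightarrow> real \<Rightarrow> 'b set \<Rightarrow> 'b set" where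
  "metric_nbhd M d \<delta> S = {p \<in> M. \<exists>q\<in>S. d p q < \<delta>}"

definition Gromov_hyperbolic :: "'b set \<Rightarrow> ('b \<Rightarrow> 'b \<Rightarrow> real) \<Rightarrow> bool" where
  "Gromov_hyperbolic M d \<longleftrightarrow> geodesic_metric_space M d \<and>
     (\<exists>\<delta>>0. \<forall>x\<in>M. \<forall>y\<in>M. \<forall>z\<in>M. \<forall>S1 S2 S3.
        geodesic_segment M d x y S1 \<and> geodesic_segment M d y z S2 \<and> geodesic_segment M d z x S3 \<longrightarrow>
          S1 \<subseteq> metric_nbhd M d \<delta> S2 \<union> metric_nbhd M d \<delta> S3 \<and>
          S2 \<subseteq> metric_nbhd M d \<delta> S3 \<union> metric_nbhd M d \<delta> S1 \<and>
          S3 \<subseteq> metric_nbhd M d \<delta> S1 \<union> metric_nbhd M d \<delta> S2)"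

end

theory Submission
  imports Defs
begin

text \<open>
  Everything happens in the 2-skeleton. First, the universal cover is built as an increasing union of
  balls around a base point; the condition on 4- and 5-cycles in links makes the construction
  consistent and yields two facts about the spheres of the cover: adjacent vertices of a sphere have a
  common neighbour one level below, and the lower neighbours of a vertex form a clique. A
  homotopy of loops, approximated on a fine grid, lifts to the cover, so simple connectivity makes the
  cover trivial and both facts hold in \<open>X\<close> for every base point.

  Given these facts, the condition on 5- and 6-cycles in links shows that the slices of every interval
  have diameter at most 1 and that metric triangles have sides at most 2. Hence for vertices \<open>w, x, y\<close> the
  Gromov product \<open>(x|y)\<^sub>w\<close> exceeds by at most 1 the distance from \<open>w\<close> to some vertex lying between
  \<open>w\<close> and \<open>x\<close> and between \<open>w\<close> and \<open>y\<close>, and thinness of the interval between \<open>w\<close> and \<open>y\<close> turns this into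
  the four-point condition.
\<close>

section \<open>The universal cover as a union of balls\<close>

text \<open>Links constrain only what happens near one vertex, so nothing local in \<open>X\<close>
  shows that an edge of a sphere has a common lower neighbour. In a complex developed outwards from
  the base point this holds by construction; topology is needed only to identify the development
  with \<open>X\<close>. Its use is isolated in connectedness and in one statement,
  \<open>monodromy\<close>: lifts of closed edge paths are closed.

  Constants: the 3 in the four-point condition is 2 + 1, a side of a metric triangle plus the width
  of a slice of an interval. Replacing points of the 1-skeleton by vertices adds 8; slimness doubles
  the result and adds 1 to make the inequality strict.

  The number 7 enters through \<open>C6\<close>. In the plane tiled by equilateral triangles every
  link is a 6-cycle: the sphere facts survive there, but intervals are parallelograms of unbounded
  width.\<close>

text \<open>
  \<open>E\<close> and \<open>T\<close> are adjacency and spanning a 2-simplex; \<open>K4\<close>, \<open>C4\<close>, \<open>C5\<close> and \<open>C6\<close> are conditions on the link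
  of \<open>v\<close>.
\<close>

locale triangle_complex =
  fixes V :: "'a set" and E :: "'a \<Rightarrow> 'a \<Rightarrow> bool" and T :: "'a \<Rightarrow> 'a \<Rightarrow> 'a \<Rightarrow> bool"
  assumes E_V: "E x y \<Longrightarrow> x \<in> V"
    and E_sym: "E x y \<Longrightarrow> E y x"
    and E_irrefl: "\<not> E x x"
    and T_swap: "T x y z \<Longrightarrow> T y x z"
    and T_rot: "T x y z \<Longrightarrow> T y z x"
    and T_E: "T x y z \<Longrightarrow> E x y"
    and K4: "\<lbrakk>T v a b; T v b c; T v a c\<rbrakk> \<Longrightarrow> T a b c"
    and C4: "\<lbrakk>T v a b; T v b c; T v c d; T v d a; a \<noteq> c; b \<noteq> d\<rbrakk> \<Longrightarrow> T v a c \<or> T v b d"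
    and C5: "\<lbrakk>T v a b; T v b c; T v c d; T v d e; T v e a; distinct [a, b, c, d, e]\<rbrakk> \<Longrightarrow>
      T v a c \<or> T v a d \<or> T v b d \<or> T v b e \<or> T v c e"
    and C6: "\<lbrakk>T v a b; T v b c; T v c d; T v d e; T v e g; T v g a; distinct [a, b, c, d, e, g]\<rbrakk> \<Longrightarrow>
      T v a c \<or> T v a d \<or> T v a e \<or> T v b d \<or> T v b e \<or> T v b g \<or> T v c e \<or> T v c g \<or> T v d g"
begin

lemma T_perms:
  assumes "T x y z"
  shows "T x z y" "T y x z" "T y z x" "T z x y" "T z y x"
  using assms T_swap T_rot by blast+

lemma T_edges:
  assumes "T x y z"
  shows "E x y" "E y x" "E x z" "E z x" "E y z" "E z y"
  using T_perms[OF assms] assms by (auto dest: T_E)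

lemma T_neq:
  assumes "T x y z"
  shows "x \<noteq> y" "x \<noteq> z" "y \<noteq> z"
  using T_edges[OF assms] E_irrefl by blast+

end

text \<open>A covering of 2-complexes in terms of edges: unique lifting of edges and, in the last
  clause, closing up of lifted triangles. This suffices for lifting homotopies.\<close>

definition covering :: "('a \<Rightarrow> 'a \<Rightarrow> bool) \<Rightarrow> ('a \<Rightarrow> 'a \<Rightarrow> 'a \<Rightarrow> bool) \<Rightarrow>
    'b set \<Rightarrow> ('b \<Rightarrow> 'b \<Rightarrow> bool) \<Rightarrow> ('b \<Rightarrow> 'a) \<Rightarrow> bool" where
  "covering E T Y R f \<longleftrightarrow>
     (\<forall>y y'. R y y' \<longrightarrow> y \<in> Y \<and> R y' y \<and> E (f y) (f y')) \<and>
     (\<forall>y\<in>Y. \<forall>z. E (f y) z \<longrightarrow> (\<exists>!y'. R y y' \<and> f y' = z)) \<and>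
     (\<forall>y a b. R y a \<and> R y b \<and> T (f y) (f a) (f b) \<longrightarrow> R a b)"

text \<open>
  A vertex of the cover is coded by a list whose head is its image and whose tail is one chosen
  parent, so that its length determines the distance to the root. \<open>L\<close> is a sphere of the
  cover, \<open>A\<close> adjacency within it, and \<open>P w p\<close> says that \<open>p\<close> is a neighbour of \<open>w\<close> in the previous
  sphere. The assumption \<open>closed\<close> says that all neighbours of a parent have already been constructed.
\<close>

locale level = triangle_complex V E T
  for V :: "'a set" and E T +
  fixes n :: nat and L :: "'a list set" and A P :: "'a list \<Rightarrow> 'a list \<Rightarrow> bool"
  assumes L_length: "w \<in> L \<Longrightarrow> length w = n"
    and P_length: "P w p \<Longrightarrow> Suc (length p) = n"
    and P_L: "P w p \<Longrightarrow> w \<in> L"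
    and A_L: "A w w' \<Longrightarrow> w \<in> L"
    and A_sym: "A w w' \<Longrightarrow> A w' w"
    and A_E: "A w w' \<Longrightarrow> E (hd w) (hd w')"
    and P_E: "P w p \<Longrightarrow> E (hd w) (hd p)"
    and PP: "\<lbrakk>P w p; P w p'; p \<noteq> p'\<rbrakk> \<Longrightarrow> T (hd w) (hd p) (hd p')"
    and AP_ex: "A w w' \<Longrightarrow> \<exists>p. P w p \<and> P w' p"
    and AP_T: "\<lbrakk>A w w'; P w p; P w' p\<rbrakk> \<Longrightarrow> T (hd w) (hd w') (hd p)"
    and N_inj: "\<lbrakk>P w u \<or> A w u; P w u' \<or> A w u'; hd u = hd u'\<rbrakk> \<Longrightarrow> u = u'"
    and AA: "\<lbrakk>A w a; A w b\<rbrakk> \<Longrightarrow> A a b \<longleftrightarrow> T (hd w) (hd a) (hd b)"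
    and PA: "\<lbrakk>P w p; A w a; T (hd w) (hd p) (hd a)\<rbrakk> \<Longrightarrow> P a p"
    and closed: "\<lbrakk>P w p; T (hd w) (hd p) z\<rbrakk> \<Longrightarrow> \<exists>u. (P w u \<or> A w u) \<and> hd u = z"
begin

text \<open>
  \<open>up w\<close> are the neighbours of \<open>hd w\<close> that still lack a lift adjacent to \<open>w\<close>; \<open>glue z w w'\<close> says that \<open>w\<close>
  and \<open>w'\<close> get the same new neighbour above \<open>z\<close>.
\<close>

definition up :: "'a list \<Rightarrow> 'a set" where
  "up w = {z. E (hd w) z \<and> (\<forall>u. P w u \<or> A w u \<longrightarrow> hd u \<noteq> z)}"

definition glue :: "'a \<Rightarrow> 'a list \<Rightarrow> 'a list \<Rightarrow> bool" where
  "glue z w w' \<longleftrightarrow> w \<in> L \<and> w' \<in> L \<and> z \<in> up w \<and> z \<in> up w' \<and>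
     (w = w' \<or> A w w' \<and> T z (hd w) (hd w'))"

text \<open>For fixed \<open>z\<close>, \<open>glue z\<close> is an equivalence relation, and glued
  vertices must get the same child. Equivalent arguments give equal predicates
  \<open>glue z w\<close>, hence equal choices by \<open>SOME\<close>: the tail of the list is the
  representative of its class.\<close>

definition child :: "'a \<Rightarrow> 'a list \<Rightarrow> 'a list" where
  "child z w = z # (SOME w'. glue z w w')"

definition L' :: "'a list set" where
  "L' = {child z w |z w. w \<in> L \<and> z \<in> up w}"

definition P' :: "'a list \<Rightarrow> 'a list \<Rightarrow> bool" where
  "P' y w \<longleftrightarrow> w \<in> L \<and> hd y \<in> up w \<and> y = child (hd y) w"

text \<open>Joining new vertices only over a common parent builds the sphere property of lateral
  edges into the cover. That no further edges are needed is the content of \<open>AA\<close> and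
  \<open>closed\<close> for the next level.\<close>

definition A' :: "'a list \<Rightarrow> 'a list \<Rightarrow> bool" where
  "A' y y' \<longleftrightarrow> (\<exists>w. P' y w \<and> P' y' w \<and> T (hd w) (hd y) (hd y'))"

lemma up_neq: "z \<in> up w \<Longrightarrow> P w u \<or> A w u \<Longrightarrow> hd u \<noteq> z"
  unfolding up_def by blast

lemma up_P:
  assumes "z \<in> up w" "P w p"
  shows "\<not> T (hd w) (hd p) z"
  using assms closed unfolding up_def by blast

text \<open>A lift of \<open>z\<close> already adjacent to \<open>w'\<close> would complete a
  triangle with \<open>w\<close>, so \<open>PA\<close> or \<open>AA\<close> would attach it to
  \<open>w\<close> as well.\<close>

lemma up_A:
  assumes z: "z \<in> up w" and A: "A w w'" and T: "T (hd w) (hd w') z"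
  shows "z \<in> up w'"
proof -
  have "E (hd w') z" using T T_edges by blast
  moreover have "hd u \<noteq> z" if u: "P w' u \<or> A w' u" for u
  proof
    assume hu: "hd u = z"
    have "P w u \<or> A w u"
      using u
    proof
      assume "P w' u"
      then show ?thesis using PA[of w' u w] A_sym[OF A] T hu T_perms by blast
    next
      assume "A w' u"
      then show ?thesis using AA[of w' w u] A_sym[OF A] T hu T_perms by blast
    qed
    with z hu show False using up_neq by blast
  qed
  ultimately show ?thesis unfolding up_def by blast
qed

lemma glue_intro:
  assumes "z \<in> up w" "A w w'" "T (hd w) (hd w') z"
  shows "glue z w w'"
  using assms up_A A_L A_sym T_perms unfolding glue_def by blast

lemma glue_sym: "glue z w w' \<Longrightarrow> glue z w' w"
  unfolding glue_def using A_sym T_perms by blast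

text \<open>The link of \<open>hd w'\<close> contains the closed path \<open>z\<close>,
  \<open>hd w\<close>, \<open>hd p\<close>, \<open>hd p'\<close>, \<open>hd w''\<close>, where
  \<open>p\<close> and \<open>p'\<close> are parents shared with \<open>w'\<close>. As
  \<open>z\<close> is not yet lifted at \<open>w'\<close>, it has no diagonal to a parent, and the
  cycle conditions leave only the edge from \<open>hd w\<close> to \<open>hd w''\<close>.\<close>

lemma glue_trans:
  assumes "glue z w w'" "glue z w' w''"
  shows "glue z w w''"
proof (cases "w = w' \<or> w' = w'' \<or> w = w''")
  case True
  then show ?thesis using assms unfolding glue_def by blast
next
  case False
  have A1: "A w' w" and A2: "A w' w''" and T1: "T (hd w') z (hd w)" and T2: "T (hd w') z (hd w'')"
    and z: "z \<in> up w" "z \<in> up w'" "z \<in> up w''"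
    using assms False A_sym T_perms unfolding glue_def by blast+
  obtain p where p: "P w p" "P w' p" using AP_ex A1 by blast
  obtain p' where p': "P w' p'" "P w'' p'" using AP_ex A2 by blast
  have Tp: "T (hd w') (hd w) (hd p)" "T (hd w') (hd w'') (hd p')"
    using AP_T A1 A2 p p' by blast+
  have wL: "w \<in> L" "w'' \<in> L" using A1 A2 A_L A_sym by blast+
  have pL: "p \<notin> L" "p' \<notin> L" using P_length L_length p p' by fastforce+
  have ne: "hd w \<noteq> hd w''" "hd w \<noteq> hd p'" "hd w'' \<noteq> hd p" "hd w \<noteq> hd p" "hd w'' \<noteq> hd p'"
    using N_inj[of w' w w''] N_inj[of w' w p'] N_inj[of w' w'' p] N_inj[of w' w p] N_inj[of w' w'' p']
     A1 A2 p p' wL pL False by metis+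
  have nz: "hd w \<noteq> z" "hd w'' \<noteq> z" "hd p \<noteq> z" "hd p' \<noteq> z"
    using z A1 A2 p p' unfolding up_def by blast+
  have np: "\<not> T (hd w') z (hd p)" "\<not> T (hd w') z (hd p')"
    using up_P z p p' T_perms by blast+
  \<comment> \<open>If one parent \<open>r\<close> is joined to both \<open>hd w\<close> and
    \<open>hd w''\<close> in the link, the pentagon shortens to a square; otherwise all its
    diagonals but the desired one are excluded.\<close>
  have "T (hd w') (hd w) (hd w'')"
  proof (cases "T (hd w') (hd w) (hd p') \<or> T (hd w') (hd w'') (hd p) \<or> p = p'")
    case True
    then obtain r where r: "T (hd w') (hd w) (hd r)" "T (hd w') (hd w'') (hd r)"
      "\<not> T (hd w') z (hd r)" "hd r \<noteq> z"
      using Tp np nz by blast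
    show ?thesis
      using C4[of "hd w'" z "hd w" "hd r" "hd w''"] r T1 T2 ne T_perms by blast
  next
    case False
    then have "T (hd w') (hd p) (hd p')" "hd p \<noteq> hd p'"
      using PP p p' T_neq by blast+
    moreover have "distinct [z, hd w, hd p, hd p', hd w'']"
      using ne nz \<open>hd p \<noteq> hd p'\<close> by auto
    ultimately show ?thesis
      using C5[of "hd w'" z "hd w" "hd p" "hd p'" "hd w''"] False Tp T1 T2 np T_perms by blast
  qed
  moreover from this have "A w w''" using AA A1 A2 by blast
  moreover have "T z (hd w) (hd w'')"
    using K4[of "hd w'" z "hd w" "hd w''"] T1 T2 calculation(1) by blast
  ultimately show ?thesis
    using z wL unfolding glue_def by blast
qed

lemma glue_refl: "w \<in> L \<Longrightarrow> z \<in> up w \<Longrightarrow> glue z w w"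
  unfolding glue_def by blast

lemma hd_child [simp]: "hd (child z w) = z"
  unfolding child_def by simp

lemma child_eq_iff:
  assumes "w \<in> L" "z \<in> up w" "w' \<in> L" "z' \<in> up w'"
  shows "child z w = child z' w' \<longleftrightarrow> z = z' \<and> glue z w w'"
proof
  assume eq: "child z w = child z' w'"
  have "glue z w (SOME u. glue z w u)" "glue z' w' (SOME u. glue z' w' u)"
    using someI[of "glue z w"] someI[of "glue z' w'"] glue_refl assms by blast+
  then show "z = z' \<and> glue z w w'"
    using eq glue_sym glue_trans unfolding child_def by (metis list.inject)
next
  assume "z = z' \<and> glue z w w'"
  then have "glue z w = glue z' w'"
    using glue_sym glue_trans by blast
  then show "child z w = child z' w'"
    using \<open>z = z' \<and> _\<close> unfolding child_def by simp
qed

lemma P'_child: "w \<in> L \<Longrightarrow> z \<in> up w \<Longrightarrow> P' (child z w) w"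
  unfolding P'_def by simp

lemma P'_glue: "P' y w \<Longrightarrow> P' y w' \<longleftrightarrow> glue (hd y) w w'"
  unfolding P'_def using child_eq_iff glue_def by metis

lemma P'_unique: "P' y w \<Longrightarrow> P' y' w \<Longrightarrow> hd y = hd y' \<Longrightarrow> y = y'"
  unfolding P'_def by metis

lemma P'_up: "P' y w \<Longrightarrow> P w u \<or> A w u \<Longrightarrow> hd y \<noteq> hd u"
  unfolding P'_def using up_neq by metis

lemma P'_E: "P' y w \<Longrightarrow> E (hd y) (hd w)"
  unfolding P'_def up_def using E_sym by blast

lemma P'_P': "P' y w \<Longrightarrow> P' y w' \<Longrightarrow> w \<noteq> w' \<Longrightarrow> A w w' \<and> T (hd y) (hd w) (hd w')"
  using P'_glue unfolding glue_def by blast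

lemma P'_intro: "P' y w \<Longrightarrow> A w w' \<Longrightarrow> T (hd w) (hd w') (hd y) \<Longrightarrow> P' y w'"
  using P'_glue glue_intro P'_def by blast

lemma L'_P': "y \<in> L' \<longleftrightarrow> (\<exists>w. P' y w)"
  unfolding L'_def P'_def by fastforce

lemma A'_sym: "A' y y' \<Longrightarrow> A' y' y"
  unfolding A'_def using T_perms by blast

text \<open>\<open>A'\<close> supplies one common parent \<open>v\<close>. Distinct parents of a
  vertex are adjacent, and \<open>K4\<close> at \<open>hd v\<close> carries the triangle over to any
  other common parent.\<close>

lemma A'_P'_T: assumes "A' y y'" "P' y w" "P' y' w" shows "T (hd y) (hd y') (hd w)"
proof -
  obtain v where v: "P' y v" "P' y' v" "T (hd v) (hd y) (hd y')"
    using assms A'_def by blast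
  show ?thesis
  proof (cases "v = w")
    case True
    then show ?thesis using v T_perms by blast
  next
    case False
    then have "T (hd v) (hd y') (hd w)" "T (hd v) (hd y) (hd w)"
      using P'_P' v assms T_perms by metis+
    then show ?thesis using v K4[of "hd v" "hd y" "hd y'" "hd w"] by blast
  qed
qed

lemma P'_A'_P': assumes "P' y w" "A' y y'" "T (hd y) (hd w) (hd y')" shows "P' y' w"
proof -
  obtain v where v: "P' y v" "P' y' v" "T (hd v) (hd y) (hd y')"
    using assms A'_def by blast
  show ?thesis
  proof (cases "v = w")
    case False
    then have vw: "A v w" "T (hd y) (hd v) (hd w)" using P'_P' v assms by blast+
    then have "T (hd v) (hd w) (hd y')"
      using K4[of "hd y" "hd v" "hd w" "hd y'"] assms v T_perms by blast
    then show ?thesis using P'_intro v vw by blast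
  qed (use v in simp)
qed

text \<open>Each pair has a parent: \<open>u\<close>, \<open>v\<close>, \<open>w\<close>. If these
  are distinct they form a triangle of the lower sphere, and \<open>a\<close>, \<open>y\<close>,
  \<open>v\<close>, \<open>w\<close> is a 4-cycle in the link of \<open>u\<close>; either diagonal
  makes one of them a parent of all three vertices.\<close>

lemma A'_A'_common:
  assumes "A' y a" "A' y b" "A' a b"
  shows "\<exists>w. P' y w \<and> P' a w \<and> P' b w"
proof -
  obtain u where u: "P' y u" "P' a u" "T (hd u) (hd y) (hd a)" using assms A'_def by blast
  obtain v where v: "P' y v" "P' b v" "T (hd v) (hd y) (hd b)" using assms A'_def by blast
  obtain w where w: "P' a w" "P' b w" "T (hd w) (hd a) (hd b)" using assms A'_def by blast
  show ?thesis
  proof (cases "u = v \<or> v = w \<or> u = w")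
    case True
    then show ?thesis using u v w by blast
  next
    case False
    have A: "A u v" "A v w" "A u w"
      and T: "T (hd y) (hd u) (hd v)" "T (hd b) (hd v) (hd w)" "T (hd a) (hd u) (hd w)"
      using P'_P' u v w False by metis+
    have uvw: "T (hd u) (hd v) (hd w)" using AA A by blast
    have "hd u \<noteq> hd w" "hd v \<noteq> hd w" using uvw T_neq by blast+
    have "hd y \<noteq> hd w"
      using u(1) A(3) P'_up by blast
    moreover have "hd a \<noteq> hd v"
      using u(2) A(1) P'_up by blast
    ultimately have "T (hd u) (hd a) (hd v) \<or> T (hd u) (hd y) (hd w)"
      using C4[of "hd u" "hd a" "hd y" "hd v" "hd w"] u T uvw T_perms by blast
    then show ?thesis
    proof
      assume "T (hd u) (hd a) (hd v)"
      then have "P' a v" using P'_intro u A T_perms by blast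
      then show ?thesis using v by blast
    next
      assume "T (hd u) (hd y) (hd w)"
      then have "P' y w" using P'_intro u A T_perms by blast
      then show ?thesis using w by blast
    qed
  qed
qed

lemma next_level: "level V E T (Suc n) L' A' P'"
proof unfold_locales
  fix w assume "w \<in> L'"
  then obtain z u where u: "w = child z u" "u \<in> L" "z \<in> up u" unfolding L'_def by blast
  then have "glue z u (SOME u'. glue z u u')" using someI[of "glue z u"] glue_refl by blast
  then show "length w = Suc n" using u L_length unfolding child_def glue_def by simp
next
  fix w p assume "P' w p"
  then show "Suc (length p) = Suc n" using L_length unfolding P'_def by blast
next
  fix w p assume "P' w p"
  then show "w \<in> L'" "E (hd w) (hd p)" using L'_P' P'_E by blast+
next
  fix w w' assume "A' w w'"
  then show "w \<in> L'" "A' w' w" "E (hd w) (hd w')" "\<exists>p. P' w p \<and> P' w' p"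
    using A'_sym L'_P' T_edges unfolding A'_def by blast+
next
  fix w p p' assume "P' w p" "P' w p'" "p \<noteq> p'"
  then show "T (hd w) (hd p) (hd p')" using P'_P' by blast
next
  fix w w' p assume "A' w w'" "P' w p" "P' w' p"
  then show "T (hd w) (hd w') (hd p)" using A'_P'_T by blast
next
  fix y u u' assume u: "P' y u \<or> A' y u" and u': "P' y u' \<or> A' y u'" and eq: "hd u = hd u'"
  \<comment> \<open>The lateral neighbour \<open>u'\<close> is a child of some \<open>v\<close>
    adjacent to the parent \<open>u\<close>, but a child of \<open>v\<close> never has the head of a
    neighbour already present at \<open>v\<close>.\<close>
  have pa: False if h: "P' y u" "A' y u'" "hd u = hd u'" for u u'
  proof -
    obtain v where v: "P' y v" "P' u' v" "T (hd v) (hd y) (hd u')"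
      using h(2) unfolding A'_def by blast
    then have "u \<noteq> v" using h T_neq by metis
    then have "A v u" using P'_P' h v by blast
    then show False using v(2) h(3) P'_up by metis
  qed
  consider "P' y u" "P' y u'" | "A' y u" "A' y u'" using u u' pa eq by metis
  then show "u = u'"
  proof cases
    case 1
    then show ?thesis using P'_P' eq T_neq by metis
  next
    case 2
    obtain v where v: "P' y v" "P' u v" "T (hd v) (hd y) (hd u)"
      using 2 A'_def by blast
    obtain v' where v': "P' y v'" "P' u' v'" "T (hd v') (hd y) (hd u')"
      using 2 A'_def by blast
    \<comment> \<open>Distinct parents \<open>v\<close>, \<open>v'\<close> of \<open>y\<close> are
      adjacent, and \<open>K4\<close> at \<open>hd y\<close> makes \<open>v'\<close> a parent of
      \<open>u\<close> too; then \<open>u\<close> and \<open>u'\<close> are children of one vertex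
      with the same head.\<close>
    have "P' u v'"
    proof (cases "v = v'")
      case False
      then have "A v v'" "T (hd y) (hd v) (hd v')" using P'_P' v v' by blast+
      moreover have "T (hd v) (hd v') (hd u)"
        using K4[of "hd y" "hd v" "hd v'" "hd u"] v v' calculation eq T_perms by metis
      ultimately show ?thesis using P'_intro v by blast
    qed (use v in simp)
    then show ?thesis using P'_unique v' eq by blast
  qed
next
  fix y a b assume A: "A' y a" "A' y b"
  show "A' a b \<longleftrightarrow> T (hd y) (hd a) (hd b)"
  proof
    assume ab: "A' a b"
    obtain w where w: "P' y w" "P' a w" "P' b w" using A'_A'_common A ab by blast
    then have "T (hd w) (hd y) (hd a)" "T (hd w) (hd y) (hd b)" "T (hd w) (hd a) (hd b)"
      using A'_P'_T A ab T_perms by metis+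
    then show "T (hd y) (hd a) (hd b)" using K4 by blast
  next
    assume T: "T (hd y) (hd a) (hd b)"
    have *: "A' a b" if "P' y w" "P' a w" "P' b w" for w
    proof -
      have "T (hd y) (hd w) (hd a)" "T (hd y) (hd w) (hd b)" using that A'_P'_T A T_perms by metis+
      then have "T (hd w) (hd a) (hd b)" using K4 T by blast
      then show ?thesis using that A'_def by blast
    qed
    obtain u where u: "P' y u" "P' a u" "T (hd u) (hd y) (hd a)" using A A'_def by blast
    obtain v where v: "P' y v" "P' b v" "T (hd v) (hd y) (hd b)" using A A'_def by blast
    show "A' a b"
    proof (cases "u = v")
      case True
      then show ?thesis using * u v by blast
    next
      case False
      then have uv: "T (hd y) (hd u) (hd v)" using P'_P' u v by blast
      show ?thesis
      proof (cases "hd a = hd v \<or> hd b = hd u")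
        case True
        then have False using u v False P'_P'[of y u v] A_sym P'_up by metis
        then show ?thesis ..
      next
        case ne: False
        \<comment> \<open>The link of \<open>hd y\<close> contains the 4-cycle \<open>a\<close>,
          \<open>b\<close>, \<open>v\<close>, \<open>u\<close>; either diagonal yields a parent
          common to \<open>y\<close>, \<open>a\<close> and \<open>b\<close>.\<close>
        have "T (hd y) (hd a) (hd v) \<or> T (hd y) (hd b) (hd u)"
          using C4[of "hd y" "hd a" "hd b" "hd v" "hd u"] T u v uv ne T_perms by blast
        then show ?thesis using * P'_A'_P' u v A T_perms by metis
      qed
    qed
  qed
next
  fix y p a assume "P' y p" "A' y a" "T (hd y) (hd p) (hd a)"
  then show "P' a p" using P'_A'_P' by blast
next
  fix y w z assume w: "P' y w" and T: "T (hd y) (hd w) z"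
  \<comment> \<open>If \<open>z\<close> is new at the parent \<open>w\<close>, its child there is a
    lateral neighbour of \<open>y\<close>. If not, \<open>up_P\<close> forces the existing lift to
    be lateral to \<open>w\<close>, and it is then a second parent of \<open>y\<close>.\<close>
  show "\<exists>u. (P' y u \<or> A' y u) \<and> hd u = z"
  proof (cases "z \<in> up w")
    case True
    then have "P' (child z w) w" using w P'_child unfolding P'_def by blast
    moreover have "T (hd w) (hd y) (hd (child z w))" using T_swap[OF T] by simp
    ultimately have "A' y (child z w)" using w unfolding A'_def by blast
    then show ?thesis by force
  next
    case False
    then obtain u where u: "P w u \<or> A w u" "hd u = z"
      using T_edges[OF T] unfolding up_def by blast
    have "hd y \<in> up w" using w unfolding P'_def by blast
    then have "A w u" using up_P u T T_perms by blast
    then show ?thesis using P'_intro[of y w u] w T u T_perms by metis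
  qed
qed

end

section \<open>Iterating the step: the cover and its covering map\<close>

context triangle_complex
begin

fun next_lv where
  "next_lv (L, A, P) = (level.L' E T L A P, level.A' E T L A P, level.P' E T L A P)"

primrec lv :: "'a \<Rightarrow> nat \<Rightarrow> 'a list set \<times> ('a list \<Rightarrow> 'a list \<Rightarrow> bool) \<times> ('a list \<Rightarrow> 'a list \<Rightarrow> bool)" where
  "lv x 0 = ({[x]}, \<lambda>_ _. False, \<lambda>_ _. False)"
| "lv x (Suc n) = next_lv (lv x n)"

definition verts :: "'a \<Rightarrow> nat \<Rightarrow> 'a list set" where
  "verts x n = fst (lv x n)"

definition lateral :: "'a \<Rightarrow> nat \<Rightarrow> 'a list \<Rightarrow> 'a list \<Rightarrow> bool" where
  "lateral x n = fst (snd (lv x n))"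

definition parent :: "'a \<Rightarrow> nat \<Rightarrow> 'a list \<Rightarrow> 'a list \<Rightarrow> bool" where
  "parent x n = snd (snd (lv x n))"

lemma verts_0 [simp]: "verts x 0 = {[x]}"
  and lateral_0 [simp]: "lateral x 0 = (\<lambda>_ _. False)"
  and parent_0 [simp]: "parent x 0 = (\<lambda>_ _. False)"
  by (simp_all add: verts_def lateral_def parent_def)

lemma verts_Suc: "verts x (Suc n) = level.L' E T (verts x n) (lateral x n) (parent x n)"
  and lateral_Suc: "lateral x (Suc n) = level.A' E T (verts x n) (lateral x n) (parent x n)"
  and parent_Suc: "parent x (Suc n) = level.P' E T (verts x n) (lateral x n) (parent x n)"
  by (cases "lv x n"; simp add: verts_def lateral_def parent_def)+

lemma level_verts: "level V E T (Suc n) (verts x n) (lateral x n) (parent x n)"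
proof (induction n)
  case 0
  show ?case by (unfold_locales; simp)
next
  case (Suc n)
  then show ?case
    unfolding verts_Suc lateral_Suc parent_Suc by (rule level.next_level)
qed

definition cover :: "'a \<Rightarrow> 'a list set" where
  "cover x = (\<Union>n. verts x n)"

definition cover_adj :: "'a \<Rightarrow> 'a list \<Rightarrow> 'a list \<Rightarrow> bool" where
  "cover_adj x y y' \<longleftrightarrow> (\<exists>n. lateral x n y y' \<or> parent x n y y' \<or> parent x n y' y)"

lemma parent_verts:
  assumes "parent x n y p"
  shows "\<exists>m. n = Suc m \<and> y \<in> verts x n \<and> p \<in> verts x m"
proof -
  interpret l: level V E T "Suc n" "verts x n" "lateral x n" "parent x n" by (rule level_verts)
  obtain m where m: "n = Suc m" using assms by (cases n; auto)
  interpret k: level V E T "Suc m" "verts x m" "lateral x m" "parent x m" by (rule level_verts)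
  show ?thesis using assms l.P_L m unfolding m parent_Suc k.P'_def by blast
qed

lemma verts_length: "y \<in> verts x n \<Longrightarrow> length y = Suc n"
  using level.L_length[OF level_verts] by blast

lemma cover_adj_iff:
  assumes "y \<in> verts x n"
  shows "cover_adj x y a \<longleftrightarrow> lateral x n y a \<or> parent x n y a \<or> parent x (Suc n) a y"
proof
  assume "cover_adj x y a"
  then obtain m where m: "lateral x m y a \<or> parent x m y a \<or> parent x m a y"
    unfolding cover_adj_def by blast
  interpret l: level V E T "Suc m" "verts x m" "lateral x m" "parent x m" by (rule level_verts)
  have "length y = Suc n" using assms verts_length by blast
  then show "lateral x n y a \<or> parent x n y a \<or> parent x (Suc n) a y"
    using m l.A_L l.P_L l.P_length verts_length by (metis Suc_inject)
qed (auto simp: cover_adj_def)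

text \<open>A neighbour of \<open>y\<close> is a parent, a lateral neighbour or a child.
  \<open>N_inj\<close> makes lifts of the first two kinds unique, and \<open>up\<close> collects
  exactly the neighbours of \<open>hd y\<close> that these miss. The last clause is a check of all
  pairs of kinds; a parent and a child never lie over a common triangle.\<close>

lemma covering_cover: "covering E T (cover x) (cover_adj x) hd"
  unfolding covering_def
proof (intro conjI allI impI ballI)
  fix y y' assume "cover_adj x y y'"
  then obtain n where n: "lateral x n y y' \<or> parent x n y y' \<or> parent x n y' y"
    unfolding cover_adj_def by blast
  interpret l: level V E T "Suc n" "verts x n" "lateral x n" "parent x n" by (rule level_verts)
  have "\<exists>m. y \<in> verts x m" using n l.A_L parent_verts by blast
  then show "y \<in> cover x" unfolding cover_def by blast
  show "cover_adj x y' y" using n l.A_sym unfolding cover_adj_def by blast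
  show "E (hd y) (hd y')" using n l.A_E l.P_E E_sym by blast
next
  fix y z assume "y \<in> cover x" and z: "E (hd y) z"
  then obtain n where y: "y \<in> verts x n" unfolding cover_def by blast
  interpret l: level V E T "Suc n" "verts x n" "lateral x n" "parent x n" by (rule level_verts)
  show "\<exists>!y'. cover_adj x y y' \<and> hd y' = z"
  proof (cases "z \<in> l.up y")
    case True
    then have "parent x (Suc n) (l.child z y) y"
      unfolding parent_Suc using l.P'_child y by blast
    moreover have "y' = l.child z y" if "parent x (Suc n) y' y" "hd y' = z" for y'
      using that unfolding parent_Suc l.P'_def by metis
    moreover have "\<not> lateral x n y y'" "\<not> parent x n y y'" if "hd y' = z" for y'
      using that True l.up_neq by metis+
    ultimately show ?thesis
      unfolding cover_adj_iff[OF y] using l.hd_child by metis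
  next
    case False
    then obtain u where u: "parent x n y u \<or> lateral x n y u" "hd u = z"
      using z unfolding l.up_def by blast
    moreover have "y' = u" if "parent x n y y' \<or> lateral x n y y'" "hd y' = z" for y'
      using that u l.N_inj by metis
    moreover have "\<not> parent x (Suc n) y' y" if "hd y' = z" for y'
      using that False unfolding parent_Suc l.P'_def by metis
    ultimately show ?thesis
      unfolding cover_adj_iff[OF y] by metis
  qed
next
  fix y a b assume "cover_adj x y a \<and> cover_adj x y b \<and> T (hd y) (hd a) (hd b)"
  then have ya: "cover_adj x y a" and yb: "cover_adj x y b" and T: "T (hd y) (hd a) (hd b)" by blast+
  then obtain n0 where "lateral x n0 y a \<or> parent x n0 y a \<or> parent x n0 a y"
    unfolding cover_adj_def by blast
  then have "\<exists>n. y \<in> verts x n"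
    using level.A_L[OF level_verts] parent_verts by blast
  then obtain n where y: "y \<in> verts x n" by blast
  interpret l: level V E T "Suc n" "verts x n" "lateral x n" "parent x n" by (rule level_verts)
  have PU: "\<not> T (hd y) (hd p) (hd u)" if "parent x n y p" "parent x (Suc n) u y" for p u
    using that l.up_P unfolding parent_Suc l.P'_def by blast
  have AU: "cover_adj x u v" if "lateral x n y u" "parent x (Suc n) v y" "T (hd y) (hd u) (hd v)" for u v
    using that l.P'_intro unfolding parent_Suc cover_adj_def by (metis parent_Suc)
  \<comment> \<open>Two parents are joined in the sphere below, which the data of level
    \<open>n\<close> do not record; hence the level before is unfolded.\<close>
  have PP: "cover_adj x u v" if h: "parent x n y u" "parent x n y v" "u \<noteq> v" for u v
  proof -
    obtain m where m: "n = Suc m" using h parent_verts by blast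
    interpret k: level V E T "Suc m" "verts x m" "lateral x m" "parent x m" by (rule level_verts)
    have "lateral x m u v" using h k.P'_P' unfolding m parent_Suc by blast
    then show ?thesis unfolding cover_adj_def by blast
  qed
  have UU: "cover_adj x u v" if "parent x (Suc n) u y" "parent x (Suc n) v y" "T (hd y) (hd u) (hd v)" for u v
  proof -
    have "lateral x (Suc n) u v" using that unfolding parent_Suc lateral_Suc l.A'_def by blast
    then show ?thesis unfolding cover_adj_def by blast
  qed
  have PA: "cover_adj x u v" if "parent x n y u" "lateral x n y v" "T (hd y) (hd u) (hd v)" for u v
    using l.PA that unfolding cover_adj_def by blast
  have AA: "cover_adj x u v" if "lateral x n y u" "lateral x n y v" "T (hd y) (hd u) (hd v)" for u v
    using l.AA that unfolding cover_adj_def by blast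
  have sym: "cover_adj x u v \<Longrightarrow> cover_adj x v u" for u v
    using level.A_sym[OF level_verts] unfolding cover_adj_def by blast
  have "a \<noteq> b" using T T_neq by blast
  have T': "T (hd y) (hd b) (hd a)" using T T_perms by blast
  show "cover_adj x a b"
    using ya yb T T' PU AU PP UU PA AA sym \<open>a \<noteq> b\<close> unfolding cover_adj_iff[OF y] by metis
qed

lemma cover_adjD:
  assumes "cover_adj x y y'"
  shows "y \<in> cover x" "y' \<in> cover x" "cover_adj x y' y" "E (hd y) (hd y')"
  using assms covering_cover[of x] unfolding covering_def by metis+

lemma parent_length: "parent x n y p \<Longrightarrow> length y = Suc n \<and> length p = n"
  using parent_verts verts_length by blast

lemma cover_reachable: "y \<in> verts x n \<Longrightarrow> (cover_adj x)\<^sup>*\<^sup>* [x] y"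
proof (induction n arbitrary: y)
  case 0
  then show ?case by simp
next
  case (Suc n)
  interpret l: level V E T "Suc n" "verts x n" "lateral x n" "parent x n" by (rule level_verts)
  obtain w where w: "parent x (Suc n) y w" "w \<in> verts x n"
    using Suc.prems l.L'_P' unfolding verts_Suc parent_Suc l.P'_def by blast
  then have "cover_adj x w y" unfolding cover_adj_def by blast
  with Suc.IH[OF w(2)] show ?case by simp
qed

definition graph_dist :: "'a \<Rightarrow> 'a \<Rightarrow> nat" where
  "graph_dist x y = (LEAST n. (E ^^ n) x y)"

end

text \<open>The only access to topology from here on. The points of \<open>Y\<close> are lists
  because the cover to which \<open>monodromy\<close> is applied consists of lists and a locale
  assumption has a fixed type.\<close>

locale simply_connected_triangle_complex = triangle_complex V E T
  for V :: "'a set" and E T +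
  assumes connected: "x \<in> V \<Longrightarrow> y \<in> V \<Longrightarrow> E\<^sup>*\<^sup>* x y"
    and monodromy: "\<lbrakk>covering E T Y R f; (R :: 'a list \<Rightarrow> 'a list \<Rightarrow> bool)\<^sup>*\<^sup>* s t; s \<in> Y; f s = f t; f s \<in> V\<rbrakk> \<Longrightarrow> s = t"
begin

text \<open>Both points are joined to the root, so \<open>monodromy\<close> applies to the path
  between them through \<open>[x]\<close>.\<close>

lemma cover_inj:
  assumes "x \<in> V" "y \<in> cover x" "y' \<in> cover x" "hd y = hd y'"
  shows "y = y'"
proof -
  have sym: "symp (cover_adj x)" using covering_cover[of x] unfolding covering_def symp_def by blast
  have r: "(cover_adj x)\<^sup>*\<^sup>* [x] y" "(cover_adj x)\<^sup>*\<^sup>* [x] y'"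
    using assms cover_reachable unfolding cover_def by blast+
  then have yy: "(cover_adj x)\<^sup>*\<^sup>* y y'"
    using sym by (meson rtranclp_trans symp_rtranclp sympD)
  have "hd y \<in> V"
  proof (cases "y = [x]")
    case True
    then show ?thesis using assms by simp
  next
    case False
    then obtain w where "cover_adj x w y" using r by (metis rtranclp.cases)
    then show ?thesis using covering_cover[of x] E_sym E_V unfolding covering_def by metis
  qed
  then show ?thesis using monodromy[OF covering_cover yy] assms by blast
qed

lemma cover_surj:
  assumes "x \<in> V" "(E ^^ m) x v"
  shows "\<exists>k\<le>m. \<exists>y\<in>verts x k. hd y = v"
  using assms(2)
proof (induction m arbitrary: v)
  case 0
  then show ?case by simp
next
  case (Suc m)
  then obtain u where u: "(E ^^ m) x u" "E u v" by auto
  then obtain k y where k: "k \<le> m" "y \<in> verts x k" "hd y = u" using Suc.IH by blast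
  then have "y \<in> cover x" unfolding cover_def by blast
  then obtain y' where y': "cover_adj x y y'" "hd y' = v"
    using covering_cover[of x] u(2) k(3) unfolding covering_def by blast
  then have "y' \<in> verts x k \<or> y' \<in> verts x (Suc k) \<or> (\<exists>j. k = Suc j \<and> y' \<in> verts x j)"
    using cover_adj_iff[OF k(2)] level.A_L[OF level_verts] level.A_sym[OF level_verts] parent_verts by blast
  then show ?case using k(1) y'(2) by (metis Suc_le_mono le_Suc_eq le_trans less_imp_le_nat lessI)
qed

lemma verts_path: "y \<in> verts x n \<Longrightarrow> (E ^^ n) x (hd y)"
proof (induction n arbitrary: y)
  case 0
  then show ?case by simp
next
  case (Suc n)
  interpret l: level V E T "Suc n" "verts x n" "lateral x n" "parent x n" by (rule level_verts)
  obtain w where w: "parent x (Suc n) y w" "w \<in> verts x n"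
    using Suc.prems l.L'_P' unfolding verts_Suc parent_Suc l.P'_def by blast
  then have "E (hd w) (hd y)" using level.P_E[OF level_verts] E_sym by blast
  with Suc.IH[OF w(2)] show ?case by auto
qed

lemma graph_dist_path: "x \<in> V \<Longrightarrow> y \<in> V \<Longrightarrow> (E ^^ graph_dist x y) x y"
  unfolding graph_dist_def using connected[of x y] by (metis LeastI_ex rtranclp_power)

lemma graph_dist_le: "(E ^^ n) x y \<Longrightarrow> graph_dist x y \<le> n"
  unfolding graph_dist_def by (simp add: Least_le)

text \<open>A geodesic lifts from the root to a vertex whose level is at most its length, and by
  \<open>cover_inj\<close> that vertex is \<open>y\<close>.\<close>

lemma graph_dist_verts:
  assumes "x \<in> V" "y \<in> verts x n"
  shows "graph_dist x (hd y) = n"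
proof (rule antisym)
  have p: "(E ^^ n) x (hd y)" using assms verts_path by blast
  then show "graph_dist x (hd y) \<le> n" by (rule graph_dist_le)
  have "(E ^^ graph_dist x (hd y)) x (hd y)" unfolding graph_dist_def using p by (rule LeastI)
  then obtain k y' where k: "k \<le> graph_dist x (hd y)" "y' \<in> verts x k" "hd y' = hd y"
    using cover_surj assms by blast
  then have "y' = y" using cover_inj assms unfolding cover_def by blast
  then have "k = n" using k assms verts_length by (metis Suc_inject)
  then show "n \<le> graph_dist x (hd y)" using k by simp
qed

lemma verts_graph_dist:
  assumes "x \<in> V" "v \<in> V"
  shows "\<exists>y\<in>verts x (graph_dist x v). hd y = v"
  using cover_surj[OF assms(1) graph_dist_path[OF assms]] graph_dist_verts[OF assms(1)] by metis

lemma lower_vertex: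
  assumes "x \<in> V" "w \<in> V" "graph_dist x w = Suc n"
  shows "\<exists>p. E w p \<and> graph_dist x p = n"
proof -
  obtain y where y: "y \<in> verts x (Suc n)" "hd y = w" using verts_graph_dist assms by metis
  interpret l: level V E T "Suc n" "verts x n" "lateral x n" "parent x n" by (rule level_verts)
  obtain p where p: "parent x (Suc n) y p" "p \<in> verts x n"
    using y(1) l.L'_P' unfolding verts_Suc parent_Suc l.P'_def by blast
  then show ?thesis using level.P_E[OF level_verts] graph_dist_verts assms y by blast
qed

lemma lift_edge:
  assumes "x \<in> V" "u \<in> V" "E u v"
  shows "\<exists>y y'. y \<in> verts x (graph_dist x u) \<and> y' \<in> verts x (graph_dist x v) \<and> hd y = u \<and> hd y' = v \<and> cover_adj x y y'"
proof -
  obtain y where y: "y \<in> verts x (graph_dist x u)" "hd y = u" using verts_graph_dist assms by metis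
  then obtain y' where y': "cover_adj x y y'" "hd y' = v"
    using covering_cover[of x] assms unfolding covering_def cover_def by blast
  have "y' \<in> cover x" using y' cover_adjD by blast
  then have "y' \<in> verts x (graph_dist x v)" using graph_dist_verts assms y' unfolding cover_def by auto
  then show ?thesis using y y' by blast
qed

lemma triangle_condition:
  assumes "x \<in> V" "E u v" "graph_dist x u = Suc n" "graph_dist x v = Suc n"
  shows "\<exists>p. graph_dist x p = n \<and> T u v p"
proof -
  obtain y y' where y: "y \<in> verts x (Suc n)" "y' \<in> verts x (Suc n)" "hd y = u" "hd y' = v" "cover_adj x y y'"
    using lift_edge assms E_V by metis
  have "\<not> parent x (Suc n) y y'" "\<not> parent x (Suc (Suc n)) y' y"
    using y(1,2) parent_length verts_length by (metis Suc_n_not_n)+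
  then have A: "lateral x (Suc n) y y'" using y cover_adj_iff by blast
  then obtain p where p: "parent x (Suc n) y p" "parent x (Suc n) y' p"
    using level.AP_ex[OF level_verts] by blast
  then have "p \<in> verts x n" using parent_verts by blast
  then have "graph_dist x (hd p) = n" using graph_dist_verts assms by blast
  moreover have "T u v (hd p)" using level.AP_T[OF level_verts A p] y by simp
  ultimately show ?thesis by blast
qed

text \<open>Both edges lift to the cover, where \<open>cover_inj\<close> identifies their upper
  ends; so \<open>p\<close> and \<open>q\<close> come from two parents of one vertex.\<close>

lemma lower_clique:
  assumes "x \<in> V" "E w p" "E w q" "graph_dist x w = Suc n" "graph_dist x p = n" "graph_dist x q = n" "p \<noteq> q"
  shows "T w p q"
proof -
  have *: "\<exists>y y'. y \<in> verts x (Suc n) \<and> hd y = w \<and> hd y' = p \<and> parent x (Suc n) y y'" if h: "E w p" "graph_dist x p = n" for p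
  proof -
    obtain y y' where y: "y \<in> verts x (Suc n)" "y' \<in> verts x n" "hd y = w" "hd y' = p" "cover_adj x y y'"
      using lift_edge[OF assms(1) E_V h(1)] h assms(4) by metis
    have "\<not> lateral x (Suc n) y y'" 
      using y level.A_L[OF level_verts] level.A_sym[OF level_verts] verts_length by (metis Suc_n_not_n)
    moreover have "\<not> parent x (Suc (Suc n)) y' y"
      using parent_length[of x "Suc (Suc n)" y' y] verts_length[OF y(2)] by auto
    ultimately show ?thesis using y cover_adj_iff by blast
  qed
  obtain y y' where y: "y \<in> verts x (Suc n)" "hd y = w" "hd y' = p" "parent x (Suc n) y y'"
    using * assms by blast
  obtain z z' where z: "z \<in> verts x (Suc n)" "hd z = w" "hd z' = q" "parent x (Suc n) z z'"
    using * assms by blast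
  have "y = z" using cover_inj y z assms unfolding cover_def by blast
  then show ?thesis using level.PP[OF level_verts] y z assms by metis
qed

end

section \<open>Thin intervals and small metric triangles\<close>

context triangle_complex
begin

text \<open>
  In both applications the \<open>a\<^sub>i\<close>, \<open>b\<^sub>i\<close>, \<open>r\<^sub>i\<close> lie on three consecutive spheres, \<open>z\<close> on the middle one.
\<close>

lemma no_hexagon:
  assumes T: "T z a1 a2" "T z a2 b2" "T z b2 r2" "r1 = r2 \<or> T z r2 r1" "T z r1 b1" "T z b1 a1"
    and ar: "\<not> E a1 r1" "\<not> E a1 r2" "\<not> E a2 r1" "\<not> E a2 r2"
    and ne: "a1 \<noteq> r1" "a1 \<noteq> r2" "a2 \<noteq> r1" "a2 \<noteq> r2" "b1 \<noteq> b2" "a1 \<noteq> b2" "a2 \<noteq> b1"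
    and ab: "\<not> E a1 b2" "\<not> E a2 b1" "\<not> E b1 b2"
  shows False
proof -
  \<comment> \<open>Every diagonal of the pentagon \<open>a1\<close>, \<open>a2\<close>,
    \<open>b2\<close>, \<open>c\<close>, \<open>b1\<close> in the link of \<open>z\<close> is among
    the excluded edges.\<close>
  have pent: False if "T z b2 c" "T z c b1" "c = r1 \<or> c = r2" for c
  proof -
    have "distinct [a1, a2, b2, c, b1]"
      using T_neq[OF T(1)] T_neq[OF T(2)] T_neq[OF T(6)] T_neq[OF that(1)] T_neq[OF that(2)] that(3) ne by auto
    then show False
      using C5[OF T(1,2) that(1,2) T(6)] that(3) ar ab T_edges by blast
  qed
  show False
  proof (cases "r1 = r2")
    case True
    then show False using pent T by blast
  next
    case False
    then have r: "T z r2 r1" using T by blast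
    have "r1 \<noteq> b2" "r2 \<noteq> b1" using T(3,5) ab T_edges by blast+
    then have "distinct [a1, a2, b2, r2, r1, b1]"
      using T_neq[OF T(1)] T_neq[OF T(2)] T_neq[OF T(3)] T_neq[OF T(5)] T_neq[OF T(6)] T_neq[OF r] ne by auto
    \<comment> \<open>The hexagon has just two diagonals that are not excluded, and each of them
      cuts off a pentagon of the kind refuted above.\<close>
    then have "T z b2 r1 \<or> T z r2 b1"
      using C6[OF T(1,2,3) r T(5,6)] ar ab T_edges by blast
    then show False using pent T by blast
  qed
qed

end

context simply_connected_triangle_complex
begin

section \<open>Distances and geodesics in the graph of the complex\<close>

lemma relpowp_E_sym: "(E ^^ n) x y \<Longrightarrow> (E ^^ n) y x"
proof (induction n arbitrary: x)
  case (Suc n)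
  then obtain u where "E x u" "(E ^^ n) u y" by (metis relpowp_Suc_D2)
  then show ?case using Suc.IH E_sym by auto
qed simp

lemma graph_dist_refl [simp]: "graph_dist x x = 0"
  using graph_dist_le[of 0 x x] by simp

lemma graph_dist_sym: "x \<in> V \<Longrightarrow> y \<in> V \<Longrightarrow> graph_dist x y = graph_dist y x"
  using graph_dist_path graph_dist_le relpowp_E_sym by (metis antisym)

lemma graph_dist_triangle:
  assumes "x \<in> V" "y \<in> V" "z \<in> V"
  shows "graph_dist x z \<le> graph_dist x y + graph_dist y z"
  using assms graph_dist_path graph_dist_le relpowp_trans by metis

lemma graph_dist_eq_0: "x \<in> V \<Longrightarrow> y \<in> V \<Longrightarrow> graph_dist x y = 0 \<longleftrightarrow> x = y"
  using graph_dist_path[of x y] graph_dist_refl by auto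

lemma graph_dist_edge: "E u v \<Longrightarrow> graph_dist u v = 1"
  using graph_dist_le[of 1 u v] graph_dist_eq_0[of u v] E_V E_sym E_irrefl
  by (metis One_nat_def le_Suc_eq le_zero_eq relpowp_1)

lemma graph_dist_step:
  assumes "x \<in> V" "E u v"
  shows "graph_dist x v \<le> Suc (graph_dist x u)"
  using graph_dist_triangle[of x u v] graph_dist_edge[OF assms(2)] assms E_V E_sym by fastforce

lemma graph_dist_between:
  assumes "x \<in> V" "y \<in> V" "i \<le> graph_dist x y"
  shows "\<exists>p\<in>V. graph_dist x p = i \<and> i + graph_dist p y = graph_dist x y"
  using assms(3)
proof (induction "graph_dist x y - i" arbitrary: i)
  case 0
  then show ?case using assms by (intro bexI[of _ y]) auto
next
  case (Suc k)
  then have "k = graph_dist x y - Suc i" "Suc i \<le> graph_dist x y" by auto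
  then obtain p where p: "p \<in> V" "graph_dist x p = Suc i" "Suc i + graph_dist p y = graph_dist x y" using Suc by blast
  then obtain q where q: "E p q" "graph_dist x q = i" using lower_vertex assms by blast
  then have "graph_dist q y \<le> Suc (graph_dist p y)"
    using graph_dist_step[OF assms(2) q(1)] graph_dist_sym p E_V E_sym assms by metis
  moreover have "graph_dist x y \<le> i + graph_dist q y"
    using graph_dist_triangle[of x q y] q E_V E_sym assms by metis
  ultimately have "i + graph_dist q y = graph_dist x y" using p by simp
  then show ?case using q E_V E_sym by blast
qed

lemma geodesic_path:
  assumes "x \<in> V" "y \<in> V"
  shows "\<exists>c. c 0 = x \<and> c (graph_dist x y) = y \<and> (\<forall>i<graph_dist x y. E (c i) (c (Suc i)))"
  using graph_dist_path[OF assms] unfolding relpowp_fun_conv by blast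

lemma path_V:
  fixes c :: "nat \<Rightarrow> 'a"
  assumes "\<forall>i<m. E (c i) (c (Suc i))" "c 0 \<in> V" "i \<le> m"
  shows "c i \<in> V"
  using assms E_V E_sym by (cases i) (auto, metis Suc_le_lessD)

lemma path_graph_dist_le:
  fixes c :: "nat \<Rightarrow> 'a"
  assumes "\<forall>i<m. E (c i) (c (Suc i))" "c 0 \<in> V" "i \<le> j" "j \<le> m"
  shows "graph_dist (c i) (c j) \<le> j - i"
  using assms(3,4)
proof (induction j)
  case (Suc j)
  show ?case
  proof (cases "i = Suc j")
    case False
    then have "graph_dist (c i) (c (Suc j)) \<le> Suc (graph_dist (c i) (c j))"
      using graph_dist_step[OF path_V[OF assms(1,2)]] Suc.prems assms(1) by force
    with False Suc show ?thesis by force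
  qed simp
qed simp

lemma geodesic_graph_dist:
  fixes c :: "nat \<Rightarrow> 'a"
  assumes "\<forall>i<m. E (c i) (c (Suc i))" "c 0 \<in> V" "graph_dist (c 0) (c m) = m" "i \<le> j" "j \<le> m"
  shows "graph_dist (c i) (c j) = j - i"
proof -
  note V = path_V[OF assms(1,2)] and le = path_graph_dist_le[OF assms(1,2)]
  have "graph_dist (c 0) (c m) \<le> graph_dist (c 0) (c i) + graph_dist (c i) (c m)"
    "graph_dist (c i) (c m) \<le> graph_dist (c i) (c j) + graph_dist (c j) (c m)"
    using graph_dist_triangle[of "c 0" "c i" "c m"] graph_dist_triangle[of "c i" "c j" "c m"] V assms by auto
  moreover have "graph_dist (c 0) (c i) \<le> i" "graph_dist (c i) (c j) \<le> j - i" "graph_dist (c j) (c m) \<le> m - j"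
    using le[of 0 i] le[of i j] le[of j m] assms by auto
  ultimately show ?thesis using assms by linarith
qed

lemma lower_graph_dist_le_1:
  assumes "x \<in> V" "E w p" "E w q" "graph_dist x w = Suc n" "graph_dist x p = n" "graph_dist x q = n"
  shows "p = q \<or> E p q"
  using lower_clique[OF assms] T_edges by blast

lemma far_not_E: "x \<in> V \<Longrightarrow> Suc (graph_dist x v) < graph_dist x u \<Longrightarrow> \<not> E u v"
  using graph_dist_step E_sym by (metis not_less)

text \<open>By induction on the distance to \<open>v\<close>, upper neighbours \<open>x'\<close>,
  \<open>y'\<close> of \<open>x\<close>, \<open>y\<close> inside the interval are equal or adjacent.
  In the adjacent case they have a common lower neighbour \<open>z\<close>. Were \<open>x\<close>
  and \<open>y\<close> distinct and not adjacent, the lower neighbours \<open>a\<close> of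
  \<open>x\<close>, \<open>z\<close> and \<open>b\<close> of \<open>y\<close>, \<open>z\<close>
  would complete a hexagon around \<open>z\<close> to which \<open>no_hexagon\<close>
  applies.\<close>

lemma interval_thin:
  assumes "u \<in> V" "v \<in> V" "x \<in> V" "y \<in> V"
    and "graph_dist u x = i" "graph_dist u y = i" "graph_dist x v = k" "graph_dist y v = k" "graph_dist u v = i + k"
  shows "x = y \<or> E x y"
  using assms(3-)
proof (induction k arbitrary: x y i)
  case 0
  then show ?case using graph_dist_eq_0 assms(2) by blast
next
  case (Suc k)
  have up: "\<exists>x'. E x x' \<and> x' \<in> V \<and> graph_dist u x' = Suc i \<and> graph_dist x' v = k"
    if h: "x \<in> V" "graph_dist u x = i" "graph_dist x v = Suc k" for x
  proof -
    obtain x' where x': "E x x'" "graph_dist v x' = k"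
      using lower_vertex[of v x k] graph_dist_sym h assms by metis
    then have "x' \<in> V" using E_V E_sym by blast
    then show ?thesis
      using x' graph_dist_step[OF assms(1) x'(1)] graph_dist_triangle[of u x' v] graph_dist_sym[of x' v] assms h Suc.prems(7)
      by (intro exI[of _ x']) auto
  qed
  obtain x' where x': "E x x'" "x' \<in> V" "graph_dist u x' = Suc i" "graph_dist x' v = k" using up Suc.prems by blast
  obtain y' where y': "E y y'" "y' \<in> V" "graph_dist u y' = Suc i" "graph_dist y' v = k" using up Suc.prems by blast
  have low: "p = q \<or> T w p q" if "E w p" "E w q" "graph_dist u w = Suc i" "graph_dist u p = i" "graph_dist u q = i" for w p q
    using lower_clique[OF assms(1) that] by blast
  have "x' = y' \<or> E x' y'"
    using Suc.IH[OF x'(2) y'(2) x'(3) y'(3) x'(4) y'(4)] Suc.prems by simp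
  then show ?case
  proof
    assume "x' = y'"
    then show ?thesis using low[of x' x y] x' y' E_sym Suc.prems T_edges by blast
  next
    assume E: "E x' y'"
    obtain z where z: "graph_dist u z = i" "T x' y' z"
      using triangle_condition[OF assms(1) E x'(3) y'(3)] by blast
    have xz: "x = z \<or> T x' x z" using low[of x' x z] x' z E_sym T_edges Suc.prems by blast
    have yz: "y = z \<or> T y' y z" using low[of y' y z] y' z E_sym T_edges Suc.prems by blast
    show ?thesis
    proof (rule ccontr)
      assume n: "\<not> (x = y \<or> E x y)"
      then have xz: "T x' x z" and yz: "T y' y z" using xz yz T_edges by blast+
      have nx: "\<not> E x' y" using n low[of x' x y] x' Suc.prems E_sym T_edges by blast
      have ny: "\<not> E y' x" using n low[of y' x y] y' Suc.prems E_sym T_edges by blast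
      obtain j where j: "i = Suc j"
        using n Suc.prems graph_dist_eq_0 assms(1) by (cases i) auto
      obtain a where a: "graph_dist u a = j" "T x z a"
        using triangle_condition[OF assms(1) T_edges(5)[OF xz], of j] z(1) Suc.prems(3) j by auto
      obtain b where b: "graph_dist u b = j" "T y z b"
        using triangle_condition[OF assms(1) T_edges(5)[OF yz], of j] z(1) Suc.prems(4) j by auto
      have ab: "a = b \<or> T z b a"
        using lower_clique[of u z b a j] a b z j assms(1) T_edges by blast
      show False
      proof (rule no_hexagon[of z x' y' y b a x])
        show "T z x' y'" "T z y' y" "T z y b" "a = b \<or> T z b a" "T z a x" "T z x x'"
          using z yz b ab a xz T_perms by blast+
        show "\<not> E x' a" "\<not> E x' b" "\<not> E y' a" "\<not> E y' b"
          using far_not_E[OF assms(1)] a b x' y' j by auto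
        show "x' \<noteq> a" "x' \<noteq> b" "y' \<noteq> a" "y' \<noteq> b" "x \<noteq> y" "x' \<noteq> y" "y' \<noteq> x"
          using a b x' y' j n Suc.prems by auto
        show "\<not> E x' y" "\<not> E y' x" "\<not> E x y" using nx ny n by auto
      qed
    qed
  qed
qed

text \<open>
  A plateau of maximal distance on a geodesic could be pushed one level down, which shortens the
  geodesic.
\<close>

lemma ball_convex:
  assumes x: "x \<in> V" and c: "\<forall>i<m. E (c i) (c (Suc i))" "c 0 \<in> V" "graph_dist (c 0) (c m) = m"
    and ends: "graph_dist x (c 0) \<le> k" "graph_dist x (c m) \<le> k" and i: "i \<le> m"
  shows "graph_dist x (c i) \<le> k"
proof (rule ccontr)
  assume "\<not> graph_dist x (c i) \<le> k"
  define M where "M = Max ((\<lambda>i. graph_dist x (c i)) ` {..m})"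
  have le_M: "graph_dist x (c i) \<le> M" if "i \<le> m" for i
    unfolding M_def using that by (intro Max_ge) auto
  have "M \<in> (\<lambda>i. graph_dist x (c i)) ` {..m}" unfolding M_def by (rule Max_in) auto
  then obtain i0 where i0: "i0 \<le> m" "graph_dist x (c i0) = M" by auto
  have "k < M" using le_M[OF i] \<open>\<not> graph_dist x (c i) \<le> k\<close> by simp
  define a where "a = (LEAST i. graph_dist x (c i) = M)"
  have a: "graph_dist x (c a) = M" "a \<le> i0" unfolding a_def using i0 by (auto intro: LeastI Least_le)
  have "a \<noteq> 0" using a(1) ends \<open>k < M\<close> by (metis not_less)
  then obtain a' where a': "a = Suc a'" by (cases a) auto
  obtain n where n: "M = Suc n" using \<open>k < M\<close> by (cases M) auto
  have lt: "a' < m" using a a' i0 by simp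
  have E: "E (c a') (c a)" using c lt a' by blast
  have "graph_dist x (c a') \<noteq> M" using not_less_Least[of a' "\<lambda>i. graph_dist x (c i) = M"] a' unfolding a_def by simp
  then have a'n: "graph_dist x (c a') = n"
    using le_M[of a'] lt graph_dist_step[OF x E] a n by simp
  note V = path_V[OF c(1,2)] and gdc = geodesic_graph_dist[OF c]
  \<comment> \<open>The plateau starts at its leftmost point \<open>c a\<close>. The invariant is a
    lower neighbour \<open>u\<close> of \<open>c j\<close> that is nearer to \<open>c a'\<close>
    than \<open>c j\<close>, whose distance is \<open>j - a + 1\<close>. A descent to
    \<open>c (Suc j)\<close> would end at or next to \<open>u\<close>, contradicting geodesicity; so
    the plateau never ends.\<close>
  have "graph_dist x (c j) = M \<and> (\<exists>u. E (c j) u \<and> graph_dist x u = n \<and> graph_dist (c a') u \<le> j - a)" if "a \<le> j" "j \<le> m" for j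
    using that
  proof (induction j rule: dec_induct)
    case base
    show ?case using a a'n E_sym[OF E] by (intro conjI exI[of _ "c a'"]) auto
  next
    case (step j)
    then obtain u where u: "graph_dist x (c j) = M" "E (c j) u" "graph_dist x u = n" "graph_dist (c a') u \<le> j - a" by auto
    have uV: "u \<in> V" using u E_V E_sym by blast
    have Ej: "E (c j) (c (Suc j))" using c step by simp
    have jV: "c a' \<in> V" "c (Suc j) \<in> V" using V step lt by auto
    have "graph_dist x (c (Suc j)) = M"
    proof (rule ccontr)
      assume "graph_dist x (c (Suc j)) \<noteq> M"
      then have "graph_dist x (c (Suc j)) = n"
        using le_M[of "Suc j"] step graph_dist_step[OF x E_sym[OF Ej]] u n by simp
      then have "u = c (Suc j) \<or> E u (c (Suc j))"
        using lower_graph_dist_le_1[OF x u(2) Ej] u n by blast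
      then have "graph_dist u (c (Suc j)) \<le> 1" using graph_dist_edge by auto
      then have "graph_dist (c a') (c (Suc j)) \<le> j - a + 1"
        using graph_dist_triangle[OF jV(1) uV jV(2)] u by simp
      moreover have "graph_dist (c a') (c (Suc j)) = Suc j - a'" using gdc step a' by simp
      ultimately show False using a' step by simp
    qed
    moreover obtain q where q: "graph_dist x q = n" "T (c j) (c (Suc j)) q"
      using triangle_condition[OF x Ej, of n] u(1) n calculation by metis
    then have "u = q \<or> E u q"
      using lower_graph_dist_le_1[OF x u(2), of q] u n T_edges by blast
    then have "graph_dist u q \<le> 1" using graph_dist_edge by auto
    then have "graph_dist (c a') q \<le> Suc j - a"
      using graph_dist_triangle[OF jV(1) uV, of q] u T_edges(4)[OF q(2)] E_V step by fastforce
    ultimately show ?case using q T_edges by blast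
  qed
  then have "graph_dist x (c m) = M" using lt a' by simp
  then show False using ends \<open>k < M\<close> by simp
qed

text \<open>
  Convexity and triviality of the corner at \<open>y\<close> force all of the geodesic \<open>c\<close> from \<open>y\<close> to \<open>z\<close> onto one
  sphere around \<open>x\<close>; if it had length at least 3, the common lower neighbours \<open>q\<^sub>j\<close> of \<open>c\<^sub>j\<close> and \<open>c\<^bsub>j+1\<^esub>\<close>
  would give a forbidden hexagon around \<open>q\<^sub>1\<close>.
\<close>

lemma metric_triangle_side:
  assumes V: "x \<in> V" "y \<in> V" "z \<in> V"
    and y: "\<And>p. \<lbrakk>p \<in> V; graph_dist y p + graph_dist p x = graph_dist y x; graph_dist y p + graph_dist p z = graph_dist y z\<rbrakk> \<Longrightarrow> p = y"
    and le: "graph_dist x z \<le> graph_dist x y"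
  shows "graph_dist x z = graph_dist x y \<and> graph_dist y z \<le> 2"
proof (cases "y = z")
  case False
  define m where "m = graph_dist y z"
  have "x \<noteq> y" using le False graph_dist_eq_0[of x z] V by auto
  then obtain k where k: "graph_dist x y = Suc k" using graph_dist_eq_0[of x y] V by (cases "graph_dist x y") auto
  have "m \<noteq> 0" using False graph_dist_eq_0[of y z] V unfolding m_def by simp
  then obtain m' where m': "m = Suc m'" using not0_implies_Suc by blast
  obtain c where c: "c 0 = y" "c m = z" "\<forall>i<m. E (c i) (c (Suc i))"
    using geodesic_path[OF V(2,3)] unfolding m_def by blast
  have c0: "c 0 \<in> V" and cm: "graph_dist (c 0) (c m) = m" using c V m_def by auto
  note cV = path_V[OF c(3) c0]
  have cz: "graph_dist (c j) z = m - j" if "j \<le> m" for j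
    using geodesic_graph_dist[OF c(3) c0 cm, of j m] that c by simp
  have lek: "graph_dist x (c j) \<le> Suc k" if "j \<le> m" for j
    using ball_convex[OF V(1) c(3) c0 cm _ _ that] c k le by simp
  \<comment> \<open>Such a \<open>p\<close> would lie between \<open>y\<close> and both other
    corners, which the assumption on the corner \<open>y\<close> forbids.\<close>
  have lowy: False if h: "E y p" "graph_dist x p = k" "graph_dist p z = m'" for p
  proof -
    have "p \<in> V" using h E_V E_sym by blast
    moreover have "graph_dist y p = 1" using graph_dist_edge h by blast
    ultimately have "p = y" using y[of p] h k m' graph_dist_sym[of x] V m_def by simp
    then show False using h E_irrefl by blast
  qed
  have qz: "graph_dist q z \<le> m - j" if "j < m" "T (c j) (c (Suc j)) q" for j q
    using graph_dist_step[OF V(3) T_edges(5)[OF that(2)]] cz[of "Suc j"] graph_dist_sym[of z] V that cV[of "Suc j"] E_V T_edges(4)[OF that(2)] by auto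
  have main: "graph_dist x (c j) = Suc k \<and> graph_dist x (c (Suc j)) = Suc k \<and>
      (\<exists>q. graph_dist x q = k \<and> T (c j) (c (Suc j)) q \<and> graph_dist q z = m - j)" if "j < m" for j
    using that
  proof (induction j)
    case 0
    have E: "E (c 0) (c 1)" using c 0 by (metis One_nat_def)
    have "graph_dist x (c 1) \<noteq> k" using lowy[of "c 1"] E c cz[of 1] m' by auto
    then have 1: "graph_dist x (c 1) = Suc k"
      using lek[of 1] m' graph_dist_step[OF V(1) E_sym[OF E]] k c by simp
    obtain q where q: "graph_dist x q = k" "T (c 0) (c 1) q"
      using triangle_condition[OF V(1) E] 1 k c by auto
    have "q \<in> V" using q T_edges E_V by blast
    then have "graph_dist q z \<noteq> m'" "Suc (graph_dist q z) \<ge> m"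
      using lowy[of q] q T_edges(3)[OF q(2)] c(1) graph_dist_triangle[of y q z] graph_dist_edge[of y q] V m_def by auto
    moreover have "graph_dist q z \<le> m" using qz[of 0 q] q m' by simp
    ultimately show ?case using 1 q k c m' by (intro conjI exI[of _ q]) auto
  next
    case (Suc j)
    then obtain q where q: "graph_dist x (c (Suc j)) = Suc k" "graph_dist x q = k" "T (c j) (c (Suc j)) q" "graph_dist q z = m - j"
      by auto
    have E: "E (c (Suc j)) (c (Suc (Suc j)))" using c Suc by simp
    have qV: "q \<in> V" using q T_edges E_V by blast
    \<comment> \<open>All lower neighbours of \<open>c (Suc j)\<close> are equal or adjacent to
      \<open>q\<close>, so none comes two steps nearer to \<open>z\<close> than \<open>q\<close>.
      This keeps the geodesic from descending and fixes the distance from \<open>q'\<close> to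
      \<open>z\<close>.\<close>
    have far: "m - j \<le> Suc (graph_dist p z)" if h: "E (c (Suc j)) p" "graph_dist x p = k" for p
    proof -
      have "q = p \<or> E q p" using lower_graph_dist_le_1[OF V(1) _ h(1) q(1)] h q T_edges by blast
      then have "graph_dist q p \<le> 1" using graph_dist_edge by auto
      moreover have "p \<in> V" using h E_V E_sym by blast
      ultimately show ?thesis using graph_dist_triangle[of q p z] qV V q by simp
    qed
    have "graph_dist x (c (Suc (Suc j))) \<noteq> k"
      using far[OF E] cz[of "Suc (Suc j)"] Suc.prems by auto
    then have 1: "graph_dist x (c (Suc (Suc j))) = Suc k"
      using lek[of "Suc (Suc j)"] Suc.prems graph_dist_step[OF V(1) E_sym[OF E]] q by simp
    obtain q' where q': "graph_dist x q' = k" "T (c (Suc j)) (c (Suc (Suc j))) q'"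
      using triangle_condition[OF V(1) E] 1 q by auto
    have "graph_dist q' z = m - Suc j"
      using far[OF T_edges(3)[OF q'(2)] q'(1)] qz[OF Suc.prems q'(2)] by simp
    then show ?case using q q' 1 by blast
  qed
  have "m \<le> 2"
  proof (rule ccontr)
    assume "\<not> m \<le> 2"
    then have m: "0 < m" "1 < m" "2 < m" by auto
    obtain q0 where q0: "graph_dist x q0 = k" "T (c 0) (c 1) q0" "graph_dist q0 z = m" using main[OF m(1)] by auto
    obtain q1 where q1: "graph_dist x q1 = k" "T (c 1) (c 2) q1" "graph_dist q1 z = m - 1"
      using main[OF m(2)] by (auto simp: numeral_2_eq_2)
    obtain q2 where q2: "graph_dist x q2 = k" "T (c 2) (c 3) q2" "graph_dist q2 z = m - 2"
      using main[OF m(3)] by (auto simp: numeral_2_eq_2 numeral_3_eq_3)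
    have c12: "graph_dist x (c 1) = Suc k" "graph_dist x (c 2) = Suc k"
      using main[OF m(2)] by (auto simp: numeral_2_eq_2)
    have qV: "q0 \<in> V" "q1 \<in> V" "q2 \<in> V" using q0 q1 q2 T_edges E_V by blast+
    \<comment> \<open>The distances \<open>m\<close>, \<open>m - 1\<close>, \<open>m - 2\<close> to
      \<open>z\<close> separate the three vertices; further below they also show that
      \<open>q0\<close> and \<open>q2\<close> are not adjacent.\<close>
    have z: "q0 \<noteq> q1" "q1 \<noteq> q2" using q0 q1 q2 m by auto
    have T01: "T (c 1) q0 q1" using lower_clique[OF V(1) T_edges(5)[OF q0(2)] T_edges(3)[OF q1(2)] c12(1) q0(1) q1(1) z(1)] .
    have T12: "T (c 2) q1 q2" using lower_clique[OF V(1) T_edges(5)[OF q1(2)] T_edges(3)[OF q2(2)] c12(2) q1(1) q2(1) z(2)] .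
    have "k \<noteq> 0" using q0 q1 z graph_dist_eq_0 qV V by metis
    then obtain l where l: "k = Suc l" by (cases k) auto
    obtain r0 where r0: "graph_dist x r0 = l" "T q0 q1 r0"
      using triangle_condition[OF V(1) T_edges(5)[OF T01], of l] q0(1) q1(1) l by auto
    obtain r1 where r1: "graph_dist x r1 = l" "T q1 q2 r1"
      using triangle_condition[OF V(1) T_edges(5)[OF T12], of l] q1(1) q2(1) l by auto
    have r: "r0 = r1 \<or> T q1 r1 r0"
      using lower_clique[OF V(1), of q1 r1 r0 l] r0 r1 q1 l T_edges by blast
    have far: "graph_dist p z \<le> Suc (graph_dist q z)" if "E p q" for p q
      using graph_dist_step[OF V(3) E_sym[OF that]] graph_dist_sym[of z] V that E_V E_sym by metis
    have n1: "\<not> E q0 q2" "q0 \<noteq> q2" using far[of q0 q2] q0 q2 m by auto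
    have n2: "\<not> E (c 1) q2"
      using lower_clique[OF V(1) _ _ c12(1), of q0 q2] q0 q2 n1 T_edges by blast
    have "graph_dist (c 2) z = m - 2" using cz[of 2] m by simp
    then have n3: "\<not> E (c 2) q0" using far[of q0 "c 2"] q0 m E_sym by auto
    show False
    proof (rule no_hexagon[of q1 "c 1" "c 2" q2 r1 r0 q0])
      show "T q1 (c 1) (c 2)" "T q1 (c 2) q2" "T q1 q2 r1" "r0 = r1 \<or> T q1 r1 r0" "T q1 r0 q0" "T q1 q0 (c 1)"
        using q1 T12 r1 r r0 T01 T_perms by blast+
      show "\<not> E (c 1) r0" "\<not> E (c 1) r1" "\<not> E (c 2) r0" "\<not> E (c 2) r1"
        using far_not_E[OF V(1)] r0 r1 c12 l by auto
      show "c 1 \<noteq> r0" "c 1 \<noteq> r1" "c 2 \<noteq> r0" "c 2 \<noteq> r1" "q0 \<noteq> q2" "c 1 \<noteq> q2" "c 2 \<noteq> q0"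
        using r0 r1 c12 l q0 q2 n1 by auto
      show "\<not> E (c 1) q2" "\<not> E (c 2) q0" "\<not> E q0 q2" using n1 n2 n3 by auto
    qed
  qed
  moreover have "graph_dist x z = graph_dist x y" using main[of m'] m' c k by simp
  ultimately show ?thesis unfolding m_def by simp
qed simp

section \<open>Medians and the four-point condition\<close>

definition between :: "'a \<Rightarrow> 'a \<Rightarrow> 'a \<Rightarrow> bool" where
  "between x p y \<longleftrightarrow> graph_dist x p + graph_dist p y = graph_dist x y"

lemma between_sym: "x \<in> V \<Longrightarrow> p \<in> V \<Longrightarrow> y \<in> V \<Longrightarrow> between x p y \<longleftrightarrow> between y p x"
  unfolding between_def using graph_dist_sym by (metis add.commute)

lemma between_trans:
  assumes "x \<in> V" "p \<in> V" "q \<in> V" "y \<in> V" "between x q y" "between x p q"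
  shows "between x p y" "between p q y"
  using assms graph_dist_triangle[of x p y] graph_dist_triangle[of p q y] unfolding between_def by linarith+

lemma between_trans':
  assumes "x \<in> V" "p \<in> V" "q \<in> V" "y \<in> V" "between x p y" "between p q y"
  shows "between x q y" "between x p q"
  using assms graph_dist_triangle[of x p q] graph_dist_triangle[of x q y] unfolding between_def by linarith+

text \<open>Take \<open>m\<close> farthest from \<open>w\<close> among the vertices between
  \<open>w\<close> and both others; a further vertex between \<open>m\<close> and both would be
  farther still. This produces one corner of a metric triangle.\<close>

lemma farthest_common:
  assumes "w \<in> V" "x \<in> V" "y \<in> V"
  shows "\<exists>m\<in>V. between w m x \<and> between w m y \<and>
    (\<forall>p\<in>V. between m p x \<longrightarrow> between m p y \<longrightarrow> p = m)"
proof -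
  define S where "S = {p\<in>V. between w p x \<and> between w p y}"
  have "w \<in> S" using assms unfolding S_def between_def by simp
  moreover have "graph_dist w p < Suc (graph_dist w x)" if "p \<in> S" for p
    using that unfolding S_def between_def by simp
  ultimately obtain m where m: "m \<in> S" "\<And>p. p \<in> S \<Longrightarrow> graph_dist w p \<le> graph_dist w m"
    using ex_has_greatest_nat[of "\<lambda>p. p \<in> S" w "graph_dist w" "Suc (graph_dist w x)"] by (metis less_imp_le)
  have "p = m" if "p \<in> V" "between m p x" "between m p y" for p
  proof -
    have "p \<in> S" "between w m p" using m(1) between_trans'[of w m p] that assms unfolding S_def by auto
    then have "graph_dist m p = 0" using m(2)[of p] unfolding between_def by simp
    then show ?thesis using graph_dist_eq_0 m(1) that unfolding S_def by auto
  qed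
  then show ?thesis using m(1) unfolding S_def by blast
qed

text \<open>Three applications of \<open>farthest_common\<close> give a metric triangle
  \<open>w'\<close>, \<open>x'\<close>, \<open>y'\<close>, equilateral of side at most 2, and
  \<open>m\<close> is its corner \<open>w'\<close>. Going from \<open>x\<close> to \<open>y\<close>
  through \<open>w'\<close> replaces the side from \<open>x'\<close> to \<open>y'\<close> by the
  other two, so the excess is one side. The facts \<open>hw\<close> and \<open>hx\<close> check that
  corners chosen early stay trivial relative to the later ones.\<close>

lemma median:
  assumes V: "w \<in> V" "x \<in> V" "y \<in> V"
  shows "\<exists>m\<in>V. between w m x \<and> between w m y \<and> graph_dist x m + graph_dist m y \<le> graph_dist x y + 2"
proof -
  obtain w' where w': "w' \<in> V" "between w w' x" "between w w' y"
    "\<And>p. p \<in> V \<Longrightarrow> between w' p x \<Longrightarrow> between w' p y \<Longrightarrow> p = w'"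
    using farthest_common[OF V] by blast
  obtain x' where x': "x' \<in> V" "between x x' w'" "between x x' y"
    "\<And>p. p \<in> V \<Longrightarrow> between x' p w' \<Longrightarrow> between x' p y \<Longrightarrow> p = x'"
    using farthest_common[OF V(2) w'(1) V(3)] by blast
  obtain y' where y': "y' \<in> V" "between y y' w'" "between y y' x'"
    "\<And>p. p \<in> V \<Longrightarrow> between y' p w' \<Longrightarrow> between y' p x' \<Longrightarrow> p = y'"
    using farthest_common[OF V(3) w'(1) x'(1)] by blast
  have b: "between w' x' x" "between w' y' y" "between x' y' y"
    using between_sym[of x x' w'] between_sym[of y y' w'] between_sym[of y y' x'] V w' x' y' by blast+
  have hw: "p = w'" if "p \<in> V" "between w' p x'" "between w' p y'" for p
  proof -
    have "between w' p x"
      using between_trans(1)[of w' p x' x] that x'(1) w'(1) V b by blast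
    moreover have "between w' p y"
      using between_trans(1)[of w' p y' y] that y'(1) w'(1) V b by blast
    ultimately show ?thesis using w' that by blast
  qed
  have hx: "p = x'" if "p \<in> V" "between x' p w'" "between x' p y'" for p
  proof -
    have "between x' p y"
      using between_trans(1)[of x' p y' y] that y'(1) x'(1) V b by blast
    then show ?thesis using x' that by blast
  qed
  note side = metric_triangle_side[folded between_def]
  note V' = w'(1) x'(1) y'(1)
  have sym: "graph_dist x' w' = graph_dist w' x'" "graph_dist y' w' = graph_dist w' y'" "graph_dist y' x' = graph_dist x' y'"
    using graph_dist_sym V' by auto
  \<comment> \<open>\<open>metric_triangle_side\<close> starts at the corner at least as far from
    the apex, hence the case distinction.\<close>
  have w: "graph_dist w' x' = graph_dist w' y' \<and> graph_dist x' y' \<le> 2"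
  proof (cases "graph_dist w' y' \<le> graph_dist w' x'")
    case True
    then show ?thesis using side[OF V'(1,2,3)] hx by auto
  next
    case False
    then show ?thesis using side[OF V'(1,3,2)] y'(4) sym by force
  qed
  have x: "graph_dist w' x' = graph_dist x' y'"
  proof (cases "graph_dist x' y' \<le> graph_dist x' w'")
    case True
    then show ?thesis using side[OF V'(2,1,3)] hw sym by force
  next
    case False
    then show ?thesis using side[OF V'(2,3,1)] y'(4) sym by force
  qed
  have "graph_dist x w' + graph_dist w' y \<le> graph_dist x y + 2"
    using x'(2,3) y'(2,3) w x sym graph_dist_sym[of y] V V' unfolding between_def by simp
  then show ?thesis using w' by blast
qed

text \<open>The vertex \<open>q\<close> on the way from \<open>w\<close> to \<open>n\<close>, at the
  same distance from \<open>w\<close> as \<open>m\<close>, lies with \<open>m\<close> in one slice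
  of the interval between \<open>w\<close> and \<open>y\<close>, so a detour from \<open>m\<close>
  to \<open>q\<close> costs at most 1. With the excess 2 of \<open>m\<close> this gives 3.\<close>

lemma four_point_aux:
  assumes V: "w \<in> V" "x \<in> V" "y \<in> V" "z \<in> V" "m \<in> V" "n \<in> V"
    and m: "between w m x" "between w m y" "graph_dist x m + graph_dist m y \<le> graph_dist x y + 2"
    and n: "between w n y" "between w n z" and le: "graph_dist w m \<le> graph_dist w n"
  shows "graph_dist x z + graph_dist y w \<le> graph_dist x y + graph_dist w z + 3"
proof -
  obtain q where q: "q \<in> V" "graph_dist w q = graph_dist w m" "between w q n"
    using graph_dist_between[OF V(1,6) le] unfolding between_def by auto
  have qy: "between w q y" "between w q z"
    using between_trans(1)[of w q n] q n V by blast+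
  have "m = q \<or> E m q"
    using interval_thin[of w y m q "graph_dist w m" "graph_dist m y"] q qy m V unfolding between_def by simp
  then have "graph_dist m q \<le> 1" using graph_dist_edge by auto
  then have "graph_dist x z \<le> graph_dist x m + 1 + graph_dist q z"
    using graph_dist_triangle[of x m z] graph_dist_triangle[of m q z] V q by simp
  then show ?thesis
    using m qy q graph_dist_sym[of w] graph_dist_sym[of x m] V unfolding between_def by simp
qed

lemma four_point:
  assumes V: "w \<in> V" "x \<in> V" "y \<in> V" "z \<in> V"
  shows "graph_dist x z + graph_dist y w \<le> max (graph_dist x y + graph_dist z w) (graph_dist y z + graph_dist x w) + 3"
proof -
  obtain m where m: "m \<in> V" "between w m x" "between w m y" "graph_dist x m + graph_dist m y \<le> graph_dist x y + 2"
    using median[OF V(1-3)] by blast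
  obtain n where n: "n \<in> V" "between w n y" "between w n z" "graph_dist y n + graph_dist n z \<le> graph_dist y z + 2"
    using median[OF V(1,3,4)] by blast
  show ?thesis
  proof (cases "graph_dist w m \<le> graph_dist w n")
    case True
    then show ?thesis
      using four_point_aux[OF V m(1) n(1) m(2-4) n(2,3)] graph_dist_sym[of z w] V by simp
  next
    \<comment> \<open>Now \<open>n\<close> is nearer to \<open>w\<close>, and \<open>x\<close> and
      \<open>z\<close> exchange roles; the two cases produce the two terms of the maximum.\<close>
    case False
    have "graph_dist z n + graph_dist n y \<le> graph_dist z y + 2" using n graph_dist_sym V by (metis add.commute)
    then have "graph_dist z x + graph_dist y w \<le> graph_dist z y + graph_dist w x + 3"
      using four_point_aux[OF V(1,4,3,2) n(1) m(1) n(3,2) _ m(3,2)] False by simp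
    then show ?thesis using graph_dist_sym[of z] graph_dist_sym[of w x] V by simp
  qed
qed

end

section \<open>The four-point condition implies slim triangles\<close>

definition four_point_hyperbolic :: "'b set \<Rightarrow> ('b \<Rightarrow> 'b \<Rightarrow> real) \<Rightarrow> real \<Rightarrow> bool" where
  "four_point_hyperbolic M d k \<longleftrightarrow> (\<forall>w\<in>M. \<forall>x\<in>M. \<forall>y\<in>M. \<forall>z\<in>M.
     d x z + d y w \<le> max (d x y + d z w) (d y z + d x w) + k)"

context Metric_space
begin

lemma geodesic_segment_endpoints:
  assumes "geodesic_segment M d x y S"
  shows "x \<in> M" "y \<in> M" "S \<subseteq> M" "x \<in> S" "y \<in> S"
  using assms unfolding geodesic_segment_def by force+

lemma geodesic_segment_point:
  assumes "geodesic_segment M d x y S" "0 \<le> t" "t \<le> d x y"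
  shows "\<exists>q\<in>S. d x q = t \<and> d q y = d x y - t"
proof -
  obtain l c where c: "l \<ge> 0" "\<forall>s\<in>{0..l}. \<forall>t\<in>{0..l}. d (c s) (c t) = \<bar>s - t\<bar>" "c 0 = x" "c l = y" "S = c ` {0..l}"
    using assms unfolding geodesic_segment_def by blast
  have "d x y = l" using c(1) c(2)[rule_format, of 0 l] c(3,4) by simp
  then show ?thesis
    using c(2)[rule_format, of 0 t] c(2)[rule_format, of t l] c assms by (intro bexI[of _ "c t"]) auto
qed

lemma geodesic_segment_between:
  assumes "geodesic_segment M d x y S" "p \<in> S"
  shows "d x p + d p y = d x y"
proof -
  obtain l c where c: "l \<ge> 0" "\<forall>s\<in>{0..l}. \<forall>t\<in>{0..l}. d (c s) (c t) = \<bar>s - t\<bar>" "c 0 = x" "c l = y" "S = c ` {0..l}"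
    using assms unfolding geodesic_segment_def by blast
  then obtain t where t: "t \<in> {0..l}" "p = c t" using assms by blast
  then show ?thesis
    using c(2)[rule_format, of 0 t] c(2)[rule_format, of t l] c(2)[rule_format, of 0 l] c by auto
qed

text \<open>The bounds for the three pieces cut off by \<open>s\<close> and \<open>t\<close> add up
  to \<open>l\<close>, the distance of the ends, so each of them is an equality.\<close>

lemma geodesic_segmentI:
  assumes "0 \<le> l" "\<And>t. t \<in> {0..l} \<Longrightarrow> c t \<in> M" "d (c 0) (c l) = l"
    and le: "\<And>s t. 0 \<le> s \<Longrightarrow> s \<le> t \<Longrightarrow> t \<le> l \<Longrightarrow> d (c s) (c t) \<le> t - s"
  shows "geodesic_segment M d (c 0) (c l) (c ` {0..l})"
proof -
  have eq: "d (c s) (c t) = t - s" if "0 \<le> s" "s \<le> t" "t \<le> l" for s t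
  proof -
    have "l \<le> d (c 0) (c s) + d (c s) (c t) + d (c t) (c l)"
      using triangle[of "c 0" "c s" "c l"] triangle[of "c s" "c t" "c l"] assms(2)[of 0] assms(2)[of s]
        assms(2)[of t] assms(2)[of l] assms(3) that by force
    then show ?thesis
      using le[of 0 s] le[of s t] le[of t l] that by linarith
  qed
  have "d (c s) (c t) = \<bar>s - t\<bar>" if "s \<in> {0..l}" "t \<in> {0..l}" for s t
    using eq[of s t] eq[of t s] commute[of "c s" "c t"] that by (cases "s \<le> t") auto
  then show ?thesis
    unfolding geodesic_segment_def using assms by blast
qed

lemma geodesic_segment_Un:
  assumes "geodesic_segment M d x y S" "geodesic_segment M d y z T" "d x y + d y z = d x z"
  shows "\<exists>U. geodesic_segment M d x z U"
proof -
  obtain l c where c: "l \<ge> 0" "c ` {0..l} \<subseteq> M" "\<forall>s\<in>{0..l}. \<forall>t\<in>{0..l}. d (c s) (c t) = \<bar>s - t\<bar>" "c 0 = x" "c l = y"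
    using assms unfolding geodesic_segment_def by blast
  obtain m e where e: "m \<ge> 0" "e ` {0..m} \<subseteq> M" "\<forall>s\<in>{0..m}. \<forall>t\<in>{0..m}. d (e s) (e t) = \<bar>s - t\<bar>" "e 0 = y" "e m = z"
    using assms unfolding geodesic_segment_def by blast
  define g where "g t = (if t \<le> l then c t else e (t - l))" for t
  have len: "d x y = l" "d y z = m"
    using c(1) c(3)[rule_format, of 0 l] c(4,5) e(1) e(3)[rule_format, of 0 m] e(4,5) by auto
  have g: "g 0 = x" "g (l + m) = z"
    unfolding g_def using c e by (simp, cases "m = 0", auto)
  have gM: "g t \<in> M" if "t \<in> {0..l + m}" for t
    unfolding g_def using that c(2) e(2) by auto
  have "geodesic_segment M d (g 0) (g (l + m)) (g ` {0..l + m})"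
  proof (rule geodesic_segmentI)
    show "0 \<le> l + m" using c e by simp
    show "d (g 0) (g (l + m)) = l + m" using g len assms by simp
    fix s t assume st: "0 \<le> s" "s \<le> t" "t \<le> l + m"
    consider "t \<le> l" | "l < s" | "s \<le> l" "l < t" by linarith
    then show "d (g s) (g t) \<le> t - s"
    proof cases
      case 1
      then show ?thesis unfolding g_def using st c(3)[rule_format, of s t] by simp
    next
      case 2
      then show ?thesis unfolding g_def using st e(3)[rule_format, of "s - l" "t - l"] by simp
    next
      case 3
      then have "d (c s) y = l - s" "d y (e (t - l)) = t - l"
        using c(3)[rule_format, of s l] e(3)[rule_format, of 0 "t - l"] c e st by auto
      moreover have "c s \<in> M" "y \<in> M" "e (t - l) \<in> M"
        using 3 st c e by auto
      ultimately show ?thesis using triangle[of "c s" y "e (t - l)"] 3 unfolding g_def by simp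
    qed
  qed (use gM in blast)
  then show ?thesis using g by auto
qed

text \<open>Compare \<open>p\<close> with the point \<open>q\<close> of the segment at the same
  distance from \<open>a\<close>: the four-point condition for \<open>p\<close>, \<open>q\<close>,
  \<open>a\<close>, \<open>b\<close> bounds their distance. If \<open>p\<close> is farther from
  \<open>a\<close> than \<open>b\<close> is, then \<open>b\<close> itself is near.\<close>

lemma four_point_near_segment:
  assumes fp: "four_point_hyperbolic M d k" and S: "geodesic_segment M d a b S"
    and p: "p \<in> M" "d p a + d p b \<le> d a b + k"
  shows "\<exists>q\<in>S. d p q \<le> 2 * k"
proof -
  note ends = geodesic_segment_endpoints[OF S]
  have k: "0 \<le> k" using triangle[of a p b] commute[of a p] p ends by simp
  show ?thesis
  proof (cases "d a p \<le> d a b")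
    case True
    obtain q where q: "q \<in> S" "d a q = d a p" "d q b = d a b - d a p"
      using geodesic_segment_point[OF S _ True] by auto
    have "d p q + d a b \<le> max (d p a + d q b) (d a q + d p b) + k"
      using fp p q ends unfolding four_point_hyperbolic_def by blast
    then have "d p q \<le> 2 * k" using q p k commute[of a p] by (auto simp: max_def split: if_splits)
    then show ?thesis using q by blast
  next
    case False
    have "b \<in> S" using geodesic_segment_endpoints[OF S] by blast
    moreover have "d p b \<le> k" "0 \<le> d p b" using False p commute[of a p] by auto
    ultimately show ?thesis using k by (intro bexI[of _ b]) auto
  qed
qed

text \<open>In the condition for \<open>p\<close> and the three corners,
  \<open>d x p + d p y = d x y\<close> cancels; whichever term is the maximum names a side over
  which \<open>p\<close> has excess at most \<open>k\<close>.\<close>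

lemma four_point_slim_side:
  assumes fp: "four_point_hyperbolic M d k"
    and S: "geodesic_segment M d x y S1" "geodesic_segment M d y z S2" "geodesic_segment M d z x S3"
    and p: "p \<in> S1"
  shows "\<exists>q\<in>S2 \<union> S3. d p q \<le> 2 * k"
proof -
  note ends = geodesic_segment_endpoints[OF S(1)] geodesic_segment_endpoints[OF S(2)]
  have pM: "p \<in> M" using p ends by blast
  have b: "d x p + d p y = d x y" using geodesic_segment_between S(1) p by blast
  have "d x y + d p z \<le> max (d x p + d y z) (d p y + d x z) + k"
    using fp pM ends unfolding four_point_hyperbolic_def by blast
  then consider "d p y + d p z \<le> d y z + k" | "d p z + d p x \<le> d z x + k"
    using b commute[of x p] commute[of x z] by (auto simp: max_def split: if_splits)
  then show ?thesis
    using four_point_near_segment[OF fp S(2) pM] four_point_near_segment[OF fp S(3) pM] by cases blast+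
qed

lemma four_point_imp_Gromov_hyperbolic:
  assumes "geodesic_metric_space M d" and fp: "four_point_hyperbolic M d k" and "0 \<le> k"
  shows "Gromov_hyperbolic M d"
proof -
  have nb: "S1 \<subseteq> metric_nbhd M d (2 * k + 1) S2 \<union> metric_nbhd M d (2 * k + 1) S3"
    if S: "geodesic_segment M d x y S1" "geodesic_segment M d y z S2" "geodesic_segment M d z x S3" for x y z S1 S2 S3
  proof
    fix p assume p: "p \<in> S1"
    then obtain q where "q \<in> S2 \<union> S3" "d p q < 2 * k + 1"
      using four_point_slim_side[OF fp S p] by force
    then show "p \<in> metric_nbhd M d (2 * k + 1) S2 \<union> metric_nbhd M d (2 * k + 1) S3"
      using p geodesic_segment_endpoints(3)[OF S(1)] unfolding metric_nbhd_def by blast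
  qed
  have "\<exists>\<delta>>0. \<forall>x\<in>M. \<forall>y\<in>M. \<forall>z\<in>M. \<forall>S1 S2 S3.
      geodesic_segment M d x y S1 \<and> geodesic_segment M d y z S2 \<and> geodesic_segment M d z x S3 \<longrightarrow>
        S1 \<subseteq> metric_nbhd M d \<delta> S2 \<union> metric_nbhd M d \<delta> S3 \<and>
        S2 \<subseteq> metric_nbhd M d \<delta> S3 \<union> metric_nbhd M d \<delta> S1 \<and>
        S3 \<subseteq> metric_nbhd M d \<delta> S1 \<union> metric_nbhd M d \<delta> S2"
  proof (intro exI[of _ "2 * k + 1"] conjI ballI allI impI; (elim conjE)?)
    show "0 < 2 * k + 1" using \<open>0 \<le> k\<close> by simp
  qed (rule nb; assumption)+
  then show ?thesis
    unfolding Gromov_hyperbolic_def using assms by blast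
qed

end

section \<open>The 1-skeleton as a metric graph\<close>

definition vertex_point :: "'a \<Rightarrow> 'a \<Rightarrow> real" where
  "vertex_point a v = (if v = a then 1 else 0)"

lemma closed_simplex_pair:
  "x \<in> closed_simplex {u, v} \<longleftrightarrow>
     0 \<le> x u \<and> 0 \<le> x v \<and> (\<forall>w. w \<noteq> u \<longrightarrow> w \<noteq> v \<longrightarrow> x w = 0) \<and> (if u = v then x u = 1 else x u + x v = 1)"
proof -
  have s: "sum x {u, v} = (if u = v then x u else x u + x v)" by simp
  show ?thesis unfolding closed_simplex_def mem_Collect_eq s by (cases "u = v"; simp; metis order_refl)
qed

lemma vertex_point_closed_simplex: "finite \<sigma> \<Longrightarrow> a \<in> \<sigma> \<Longrightarrow> vertex_point a \<in> closed_simplex \<sigma>"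
  unfolding closed_simplex_def vertex_point_def by auto

text \<open>An integral metric on the vertices realised by edge paths: \<open>D_Suc\<close> steps
  along an edge towards \<open>v\<close>, so in particular the graph is connected.\<close>

locale metric_graph =
  fixes X :: "'a set set" and D :: "'a \<Rightarrow> 'a \<Rightarrow> nat"
  assumes X: "abstract_simplicial_complex X"
    and D_refl: "D u u = 0"
    and D_sym: "u \<in> vertices X \<Longrightarrow> v \<in> vertices X \<Longrightarrow> D u v = D v u"
    and D_triangle: "u \<in> vertices X \<Longrightarrow> v \<in> vertices X \<Longrightarrow> w \<in> vertices X \<Longrightarrow> D u w \<le> D u v + D v w"
    and D_edge: "{u, v} \<in> X \<Longrightarrow> D u v \<le> 1"
    and D_0: "u \<in> vertices X \<Longrightarrow> v \<in> vertices X \<Longrightarrow> D u v = 0 \<Longrightarrow> u = v"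
    and D_Suc: "u \<in> vertices X \<Longrightarrow> v \<in> vertices X \<Longrightarrow> D u v = Suc n \<Longrightarrow> \<exists>w. {u, w} \<in> X \<and> u \<noteq> w \<and> D w v = n"
begin

abbreviation "M \<equiv> polyhedron_points (skeleton 1 X)"

lemma edge_vertices:
  assumes "{u, v} \<in> X"
  shows "u \<in> vertices X" "v \<in> vertices X"
proof -
  have "\<tau> \<in> X" if "\<tau> \<subseteq> {u, v}" "\<tau> \<noteq> {}" for \<tau>
    using assms X that unfolding abstract_simplicial_complex_def by blast
  from this[of "{u}"] this[of "{v}"] show "u \<in> vertices X" "v \<in> vertices X"
    unfolding vertices_def by auto
qed

lemma in_M: "x \<in> M \<longleftrightarrow> (\<exists>u v. {u, v} \<in> X \<and> x \<in> closed_simplex {u, v})"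
proof
  assume "x \<in> M"
  then obtain \<sigma> where s: "\<sigma> \<in> X" "card \<sigma> \<le> 2" "x \<in> closed_simplex \<sigma>"
    unfolding polyhedron_points_def skeleton_def by auto
  have "finite \<sigma>" "\<sigma> \<noteq> {}" using s X unfolding abstract_simplicial_complex_def by auto
  then have "card \<sigma> = 1 \<or> card \<sigma> = 2" using s(2) by (cases "card \<sigma>") auto
  then have "\<exists>u v. \<sigma> = {u, v}" by (metis card_1_singletonE card_2_iff insert_absorb2)
  then show "\<exists>u v. {u, v} \<in> X \<and> x \<in> closed_simplex {u, v}" using s by blast
next
  assume "\<exists>u v. {u, v} \<in> X \<and> x \<in> closed_simplex {u, v}"
  then show "x \<in> M"
    unfolding polyhedron_points_def skeleton_def using card_insert_le_m1[of 2 "{_}"] by (fastforce simp: card_insert_if)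
qed

lemma vertex_point_M: "a \<in> vertices X \<Longrightarrow> vertex_point a \<in> M"
  unfolding in_M vertices_def by (metis insertI1 insert_absorb2 finite.emptyI finite_insert mem_Collect_eq vertex_point_closed_simplex)

lemma M_edge:
  assumes "x \<in> M" "x a > 0"
  shows "\<exists>u. {u, a} \<in> X \<and> x \<in> closed_simplex {u, a}"
proof -
  obtain u v where uv: "{u, v} \<in> X" "x \<in> closed_simplex {u, v}" using assms in_M by blast
  then have "a = u \<or> a = v" using assms unfolding closed_simplex_pair by force
  then show ?thesis using uv by (metis insert_commute)
qed

lemma M_positive: "x \<in> M \<Longrightarrow> \<exists>a. x a > 0"
  unfolding in_M closed_simplex_pair by (smt (verit))

section \<open>Lengths of piecewise linear paths\<close>

lemma pl_M:
  assumes "pl_path_length X x y L"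
  shows "x \<in> M" "y \<in> M" "0 \<le> L"
proof -
  have "x \<in> M \<and> y \<in> M \<and> 0 \<le> L"
    using assms
  proof (induction rule: pl_path_length.induct)
    case (segment u v x y z L)
    then have "x \<in> M" unfolding in_M by blast
    with segment show ?case by simp
  qed simp
  then show "x \<in> M" "y \<in> M" "0 \<le> L" by auto
qed

lemma pl_append: "pl_path_length X x y L \<Longrightarrow> pl_path_length X y z L' \<Longrightarrow> pl_path_length X x z (L + L')"
proof (induction rule: pl_path_length.induct)
  case (segment u v x y w L)
  then have "pl_path_length X x z (\<bar>x v - y v\<bar> + (L + L'))" by (intro pl_path_length.segment) auto
  then show ?case by (simp add: add.assoc)
qed simp

lemma pl_single:
  assumes "{u, v} \<in> X" "x \<in> closed_simplex {u, v}" "y \<in> closed_simplex {u, v}"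
  shows "pl_path_length X x y \<bar>x v - y v\<bar>"
proof -
  have "y \<in> M" using assms in_M by blast
  then show ?thesis
    using pl_path_length.segment[OF assms pl_path_length.const] by simp
qed

lemma pl_sym: "pl_path_length X x y L \<Longrightarrow> pl_path_length X y x L"
proof (induction rule: pl_path_length.induct)
  case (const x)
  then show ?case by (rule pl_path_length.const)
next
  case (segment u v x y z L)
  have "pl_path_length X y x \<bar>y v - x v\<bar>" using pl_single segment by blast
  then show ?case using pl_append[OF segment.IH] by (metis add.commute abs_minus_commute)
qed

lemma pair_coord:
  assumes "x \<in> closed_simplex {u, v}" "y \<in> closed_simplex {u, v}"
  shows "\<bar>x w - y w\<bar> \<le> \<bar>x v - y v\<bar>"
proof -
  consider "w = v" | "w = u" "u \<noteq> v" | "w \<noteq> u" "w \<noteq> v" by blast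
  then show ?thesis
    using assms unfolding closed_simplex_pair by cases (auto split: if_splits)
qed

lemma pl_coord: "pl_path_length X x y L \<Longrightarrow> \<bar>x w - y w\<bar> \<le> L"
proof (induction rule: pl_path_length.induct)
  case (segment u v x y z L)
  then show ?case using pair_coord[of x u v y w] by linarith
qed simp

lemma pl_to_vertex:
  assumes "x \<in> M" "x a > 0"
  shows "a \<in> vertices X" "pl_path_length X x (vertex_point a) (1 - x a)"
proof -
  obtain u where u: "{u, a} \<in> X" "x \<in> closed_simplex {u, a}" using M_edge assms by blast
  then show "a \<in> vertices X" using edge_vertices by blast
  have "x a \<le> 1" using u unfolding closed_simplex_pair by (auto split: if_splits)
  then show "pl_path_length X x (vertex_point a) (1 - x a)"
    using pl_single[OF u vertex_point_closed_simplex[of "{u, a}" a]] by (simp add: vertex_point_def)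
qed

lemma pl_vertices:
  assumes "a \<in> vertices X" "b \<in> vertices X"
  shows "pl_path_length X (vertex_point a) (vertex_point b) (D a b)"
  using assms(1)
proof (induction "D a b" arbitrary: a)
  case 0
  then show ?case using D_0 assms vertex_point_M pl_path_length.const by (metis of_nat_0)
next
  case (Suc n)
  then obtain w where w: "{a, w} \<in> X" "a \<noteq> w" "D w b = n" using D_Suc assms by metis
  then have "pl_path_length X (vertex_point w) (vertex_point b) n"
    using Suc.hyps(1)[of w] edge_vertices by blast
  moreover have "pl_path_length X (vertex_point a) (vertex_point w) \<bar>vertex_point a w - vertex_point w w\<bar>"
    by (rule pl_single[OF w(1)]) (auto intro: vertex_point_closed_simplex)
  moreover have "\<bar>vertex_point a w - vertex_point w w\<bar> = (1 :: real)" using w(2) by (simp add: vertex_point_def)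
  moreover have "real (D a b) = 1 + real n" using Suc.hyps(2) by simp
  ultimately show ?case using pl_append by metis
qed

lemma pl_via_vertices:
  assumes "x \<in> M" "y \<in> M" "x a > 0" "y b > 0"
  shows "pl_path_length X x y ((1 - x a) + D a b + (1 - y b))"
  using pl_append[OF pl_append[OF pl_to_vertex(2)[OF assms(1,3)] pl_vertices] pl_sym[OF pl_to_vertex(2)[OF assms(2,4)]]]
    pl_to_vertex(1) assms by blast

text \<open>This moves the cost of a route through a vertex back across one segment. If
  \<open>a\<close> has no weight in \<open>x\<close>, then \<open>x\<close> is the opposite end
  \<open>c\<close> of the edge, and the segment is at least as long as \<open>y a\<close>, which
  pays for the extra edge.\<close>

lemma edge_transfer:
  assumes e: "{u, v} \<in> X" "x \<in> closed_simplex {u, v}" "y \<in> closed_simplex {u, v}" and a: "y a > 0"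
  shows "\<exists>c. x c > 0 \<and> (\<forall>b\<in>vertices X. (1 - x c) + D c b \<le> \<bar>x v - y v\<bar> + (1 - y a) + D a b)"
proof (cases "x a > 0")
  case True
  then show ?thesis using pair_coord[OF e(2,3), of a] by (intro exI[of _ a]) auto
next
  case False
  have a_uv: "a = u \<or> a = v" using e a unfolding closed_simplex_pair by force
  define c where "c = (if a = u then v else u)"
  have xc: "x c = 1" "x a = 0" "{c, a} = {u, v}"
    using a_uv False e unfolding closed_simplex_pair c_def by (auto split: if_splits)
  then have "{c, a} \<in> X" using e by simp
  then have D: "D c b \<le> 1 + D a b" if "b \<in> vertices X" for b
    using D_triangle[of c a b] D_edge edge_vertices that by fastforce
  have "\<bar>x v - y v\<bar> \<ge> y a" using pair_coord[OF e(2,3), of a] xc a by simp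
  then show ?thesis using xc D by (intro exI[of _ c]) fastforce
qed

text \<open>Every path is at least as long as a direct segment in one edge or as a route through
  vertices \<open>a\<close>, \<open>b\<close> of the edges of its ends. This leaves finitely many
  candidates for the shortest length, even at vertices of infinite degree.\<close>

lemma pl_lower:
  assumes "pl_path_length X x z L"
  shows "(\<exists>u v. {u, v} \<in> X \<and> x \<in> closed_simplex {u, v} \<and> z \<in> closed_simplex {u, v} \<and> \<bar>x v - z v\<bar> \<le> L) \<or>
    (\<exists>a b. x a > 0 \<and> z b > 0 \<and> (1 - x a) + D a b + (1 - z b) \<le> L)"
  using assms
proof (induction rule: pl_path_length.induct)
  case (const x)
  then show ?case using in_M by force
next
  case (segment u v x y z L)
  have M: "y \<in> M" "z \<in> M" using segment pl_M by blast+
  show ?case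
    using segment.IH
  proof (elim disjE exE conjE)
    fix u' v' assume e: "{u', v'} \<in> X" "y \<in> closed_simplex {u', v'}" "z \<in> closed_simplex {u', v'}" "\<bar>y v' - z v'\<bar> \<le> L"
    \<comment> \<open>An edge is left only through a vertex. If \<open>y\<close> is a vertex, both
      pieces are measured from it and the bound passes to the second alternative; otherwise the new
      segment lies in the same edge.\<close>
    show ?thesis
    proof (cases "\<exists>a. y a = 1")
      case True
      then obtain a where a: "y a = 1" by blast
      obtain c where c: "x c > 0" "\<forall>b\<in>vertices X. (1 - x c) + D c b \<le> \<bar>x v - y v\<bar> + (1 - y a) + D a b"
        using edge_transfer[OF segment(1-3), of a] a by auto
      obtain d where d: "z d > 0" "\<forall>b\<in>vertices X. (1 - z d) + D d b \<le> \<bar>z v' - y v'\<bar> + (1 - y a) + D a b"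
        using edge_transfer[OF e(1,3,2), of a] a by auto
      have "a \<in> vertices X" "d \<in> vertices X" using pl_to_vertex M a d by auto
      then have "(1 - x c) + D c d \<le> \<bar>x v - y v\<bar> + D a d" "(1 - z d) + D d a \<le> \<bar>y v' - z v'\<bar>"
        using c(2)[rule_format, of d] d(2)[rule_format, of a] a D_refl by auto
      then have "(1 - x c) + D c d + (1 - z d) \<le> \<bar>x v - y v\<bar> + L"
        using D_sym[of a d] e \<open>a \<in> _\<close> \<open>d \<in> _\<close> by simp
      then show ?thesis using c d by blast
    next
      case False
      then have "u \<noteq> v" "0 < y u" "0 < y v"
        using segment(3) unfolding closed_simplex_pair by (auto simp: less_le split: if_splits)
      then have "{u, v} = {u', v'}"
        using e(2) unfolding closed_simplex_pair by (metis insert_commute less_irrefl)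
      then have z: "z \<in> closed_simplex {u, v}" and "y \<in> closed_simplex {v', u'}" "z \<in> closed_simplex {v', u'}"
        and vv: "v = v' \<or> v = u'"
        using e by (auto simp: insert_commute doubleton_eq_iff)
      then have "\<bar>y v - z v\<bar> \<le> \<bar>y v' - z v'\<bar>" using pair_coord[OF e(2,3)] by blast
      then have "\<bar>x v - z v\<bar> \<le> \<bar>x v - y v\<bar> + L" using e by linarith
      then show ?thesis using z segment by blast
    qed
  next
    fix a b assume ab: "y a > 0" "z b > 0" "(1 - y a) + D a b + (1 - z b) \<le> L"
    then have "b \<in> vertices X" using pl_to_vertex M by blast
    moreover obtain c where c: "x c > 0" "\<forall>b\<in>vertices X. (1 - x c) + D c b \<le> \<bar>x v - y v\<bar> + (1 - y a) + D a b"
      using edge_transfer[OF segment(1-3)] ab by blast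
    ultimately have "(1 - x c) + D c b + (1 - z b) \<le> \<bar>x v - y v\<bar> + L"
      using ab by fastforce
    then show ?thesis using c ab by blast
  qed
qed

lemma pl_exists:
  assumes "x \<in> M" "y \<in> M"
  shows "\<exists>L. pl_path_length X x y L"
  using M_positive pl_via_vertices assms by metis

section \<open>Shortest paths exist and are geodesics\<close>

lemma path_dist_le: "pl_path_length X x y L \<Longrightarrow> path_dist X x y \<le> L"
  unfolding path_dist_def using pl_M(3) by (auto intro!: cInf_lower bdd_belowI)

lemma finite_support: "x \<in> M \<Longrightarrow> finite {a. x a \<noteq> 0}"
  unfolding in_M closed_simplex_pair by (elim exE conjE, rule finite_subset[of _ "{_, _}"]) auto

text \<open>Points have finite support, so by \<open>pl_lower\<close> every length is bounded below
  by a realised one from a finite set; the infimum is a minimum.\<close>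

lemma path_dist_attained:
  assumes "x \<in> M" "y \<in> M"
  shows "pl_path_length X x y (path_dist X x y)"
proof -
  define S where "S = {L. pl_path_length X x y L}"
  define A where "A = {a. x a \<noteq> 0}"
  define B where "B = {a. y a \<noteq> 0}"
  \<comment> \<open>The inserted 0 accounts for a coordinate \<open>v\<close> at which both points
    vanish.\<close>
  define F where "F = insert 0 ((\<lambda>a. \<bar>x a - y a\<bar>) ` (A \<union> B)) \<union> (\<lambda>(a, b). (1 - x a) + D a b + (1 - y b)) ` (A \<times> B)"
  have "finite F" unfolding F_def A_def B_def using finite_support assms by blast
  have dom: "\<exists>f\<in>F \<inter> S. f \<le> L" if "L \<in> S" for L
    using pl_lower[OF that[unfolded S_def mem_Collect_eq]]
  proof (elim disjE exE conjE)
    fix u v assume e: "{u, v} \<in> X" "x \<in> closed_simplex {u, v}" "y \<in> closed_simplex {u, v}" "\<bar>x v - y v\<bar> \<le> L"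
    have "\<bar>x v - y v\<bar> \<in> F" unfolding F_def A_def B_def by auto
    then show ?thesis using pl_single e unfolding S_def by blast
  next
    fix a b assume ab: "x a > 0" "y b > 0" "(1 - x a) + D a b + (1 - y b) \<le> L"
    then have "(1 - x a) + D a b + (1 - y b) \<in> F \<inter> S"
      using pl_via_vertices[OF assms ab(1,2)] unfolding F_def A_def B_def S_def by force
    then show ?thesis using ab by blast
  qed
  have "S \<noteq> {}" using pl_exists assms unfolding S_def by blast
  then have ne: "F \<inter> S \<noteq> {}" "finite (F \<inter> S)" using dom \<open>finite F\<close> by auto
  have "Inf S = Min (F \<inter> S)"
  proof (rule cInf_eq_minimum)
    show "Min (F \<inter> S) \<in> S" using Min_in[OF ne(2,1)] by blast
    show "Min (F \<inter> S) \<le> L" if "L \<in> S" for L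
      using dom[OF that] Min_le[OF ne(2)] by force
  qed
  moreover have "Min (F \<inter> S) \<in> S" using Min_in[OF ne(2,1)] by blast
  moreover have "path_dist X x y = Inf S"
    unfolding path_dist_def S_def using pl_exists[OF assms] by simp
  ultimately show ?thesis unfolding S_def by simp
qed

lemma Metric_space_path_dist: "Metric_space M (path_dist X)"
proof
  show "0 \<le> path_dist X x y" for x y
    unfolding path_dist_def using pl_M(3) by (auto intro: cInf_greatest)
  show "path_dist X x y = path_dist X y x" for x y
    unfolding path_dist_def using pl_sym by (metis (no_types, lifting) Collect_cong)
  show "path_dist X x y = 0 \<longleftrightarrow> x = y" if "x \<in> M" "y \<in> M" for x y
  proof
    assume 0: "path_dist X x y = 0"
    have "\<bar>x w - y w\<bar> \<le> 0" for w
      using pl_coord[OF path_dist_attained[OF that]] 0 by simp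
    then show "x = y" by auto
  next
    assume "x = y"
    then show "path_dist X x y = 0"
      using path_dist_le[OF pl_path_length.const] that pl_M(3) path_dist_attained by (metis antisym)
  qed
  show "path_dist X x z \<le> path_dist X x y + path_dist X y z" if "x \<in> M" "y \<in> M" "z \<in> M" for x y z
    using path_dist_le pl_append path_dist_attained that by metis
qed

lemma edge_geodesic:
  assumes e: "{u, v} \<in> X" "x \<in> closed_simplex {u, v}" "y \<in> closed_simplex {u, v}"
    and d: "path_dist X x y = \<bar>x v - y v\<bar>"
  shows "\<exists>S. geodesic_segment M (path_dist X) x y S"
proof -
  interpret Metric_space M "path_dist X" by (rule Metric_space_path_dist)
  have M: "x \<in> M" "y \<in> M" using e in_M by blast+
  define l where "l = \<bar>x v - y v\<bar>"
  define c where "c t = (\<lambda>w. x w + (t / l) * (y w - x w))" for t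
  show ?thesis
  proof (cases "l = 0")
    case True
    then have "x = y" using d M unfolding l_def by simp
    then have "geodesic_segment M (path_dist X) x y {x}"
      unfolding geodesic_segment_def using M by (intro exI[of _ 0] conjI exI[of _ "\<lambda>_. x"]) auto
    then show ?thesis by blast
  next
    case False
    then have l: "l > 0" unfolding l_def by simp
    have c: "c t \<in> closed_simplex {u, v}" if "t \<in> {0..l}" for t
    proof -
      have t: "0 \<le> t / l" "t / l \<le> 1" using that l by auto
      have nn: "0 \<le> x w + (t / l) * (y w - x w)" if "0 \<le> x w" "0 \<le> y w" for w
      proof -
        have "x w + (t / l) * (y w - x w) = (1 - t / l) * x w + (t / l) * y w" by (simp add: algebra_simps)
        moreover have "0 \<le> (1 - t / l) * x w" "0 \<le> (t / l) * y w"
          by (rule mult_nonneg_nonneg, use t that in linarith, use t that in linarith)+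
        ultimately show ?thesis by linarith
      qed
      have "x u + t / l * (y u - x u) + (x v + t / l * (y v - x v)) = (x u + x v) + t / l * ((y u + y v) - (x u + x v))"
        by (simp add: algebra_simps)
      then show ?thesis using e(2,3) nn unfolding c_def closed_simplex_pair by (auto split: if_splits)
    qed
    have "geodesic_segment M (path_dist X) (c 0) (c l) (c ` {0..l})"
    proof (rule geodesic_segmentI)
      show "0 \<le> l" using l by simp
      show "c t \<in> M" if "t \<in> {0..l}" for t using c[OF that] e in_M by blast
      show "path_dist X (c 0) (c l) = l" using d l unfolding c_def l_def by simp
      fix s t assume st: "0 \<le> s" "s \<le> t" "t \<le> l"
      have "path_dist X (c s) (c t) \<le> \<bar>c s v - c t v\<bar>"
        using path_dist_le pl_single[OF e(1) c c] st by simp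
      also have "c s v - c t v = (s - t) / l * (y v - x v)"
        unfolding c_def by (simp add: algebra_simps diff_divide_distrib)
      also have "\<bar>\<dots>\<bar> = (t - s) / l * l"
        unfolding l_def using st l by (simp add: abs_mult abs_minus_commute l_def)
      finally show "path_dist X (c s) (c t) \<le> t - s" using l by simp
    qed
    moreover have "c 0 = x" "c l = y" unfolding c_def using l by auto
    ultimately show ?thesis by auto
  qed
qed

text \<open>By the triangle inequality the initial segment and the rest of a shortest path are both
  shortest, so geodesics can be glued inductively.\<close>

lemma minimal_pl_geodesic:
  assumes "pl_path_length X x y L" "path_dist X x y = L"
  shows "\<exists>S. geodesic_segment M (path_dist X) x y S"
  using assms
proof (induction rule: pl_path_length.induct)
  case (const x)
  then have "geodesic_segment M (path_dist X) x x {x}"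
    unfolding geodesic_segment_def by (intro exI[of _ 0] conjI exI[of _ "\<lambda>_. x"]) auto
  then show ?case by blast
next
  case (segment u v x y z L)
  interpret Metric_space M "path_dist X" by (rule Metric_space_path_dist)
  have M: "x \<in> M" "y \<in> M" "z \<in> M" using segment pl_M in_M by blast+
  have "path_dist X x y \<le> \<bar>x v - y v\<bar>" "path_dist X y z \<le> L"
    using path_dist_le pl_single segment by blast+
  then have eq: "path_dist X x y = \<bar>x v - y v\<bar>" "path_dist X y z = L"
    using triangle[OF M] segment.prems by linarith+
  obtain S where S: "geodesic_segment M (path_dist X) x y S"
    using edge_geodesic[OF segment(1-3) eq(1)] by blast
  obtain T where T: "geodesic_segment M (path_dist X) y z T" using segment.IH eq by blast
  show ?case using geodesic_segment_Un[OF S T] eq segment.prems by simp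
qed

lemma geodesic_path_dist: "geodesic_metric_space M (path_dist X)"
  unfolding geodesic_metric_space_def
  using Metric_space_path_dist minimal_pl_geodesic path_dist_attained by blast

lemma path_dist_vertices:
  assumes "a \<in> vertices X" "b \<in> vertices X"
  shows "path_dist X (vertex_point a) (vertex_point b) = D a b"
proof (rule antisym)
  show "path_dist X (vertex_point a) (vertex_point b) \<le> D a b"
    using path_dist_le pl_vertices assms by blast
  have "pl_path_length X (vertex_point a) (vertex_point b) (path_dist X (vertex_point a) (vertex_point b))"
    using path_dist_attained vertex_point_M assms by blast
  from pl_lower[OF this] show "D a b \<le> path_dist X (vertex_point a) (vertex_point b)"
  proof (elim disjE exE conjE)
    fix u v assume e: "{u, v} \<in> X" "vertex_point a \<in> closed_simplex {u, v}" "vertex_point b \<in> closed_simplex {u, v}"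
      "\<bar>vertex_point a v - vertex_point b v\<bar> \<le> path_dist X (vertex_point a) (vertex_point b)"
    have "a = u \<or> a = v" "b = u \<or> b = v"
      using e(2,3) unfolding closed_simplex_pair vertex_point_def by (metis zero_neq_one)+
    then have "a = b \<or> {a, b} = {u, v} \<and> \<bar>vertex_point a v - vertex_point b v\<bar> = (1 :: real)"
      unfolding vertex_point_def by auto
    then show ?thesis using e D_refl D_edge[of a b] by (auto simp: vertex_point_def)
  next
    fix c d assume "vertex_point a c > 0" "vertex_point b d > 0"
      "(1 - vertex_point a c) + D c d + (1 - vertex_point b d) \<le> path_dist X (vertex_point a) (vertex_point b)"
    then show ?thesis unfolding vertex_point_def by (simp split: if_splits)
  qed
qed

lemma near_vertex:
  assumes "x \<in> M"
  shows "\<exists>a\<in>vertices X. path_dist X x (vertex_point a) \<le> 1"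
proof -
  obtain a where a: "x a > 0" using M_positive assms by blast
  then have "path_dist X x (vertex_point a) \<le> 1 - x a"
    using pl_to_vertex path_dist_le assms by blast
  then show ?thesis using a pl_to_vertex(1)[OF assms a] by (intro bexI[of _ a]) auto
qed

lemma Gromov_hyperbolic_path_dist:
  assumes fp: "\<And>w x y z. \<lbrakk>w \<in> vertices X; x \<in> vertices X; y \<in> vertices X; z \<in> vertices X\<rbrakk> \<Longrightarrow>
    D x z + D y w \<le> max (D x y + D z w) (D y z + D x w) + k"
  shows "Gromov_hyperbolic M (path_dist X)"
proof -
  interpret Metric_space M "path_dist X" by (rule Metric_space_path_dist)
  obtain \<pi> where \<pi>: "\<And>x. x \<in> M \<Longrightarrow> \<pi> x \<in> vertices X \<and> path_dist X x (vertex_point (\<pi> x)) \<le> 1"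
    using near_vertex by metis
  have close: "\<bar>path_dist X x y - D (\<pi> x) (\<pi> y)\<bar> \<le> 2" if "x \<in> M" "y \<in> M" for x y
  proof -
    define x' y' where "x' = vertex_point (\<pi> x)" and "y' = vertex_point (\<pi> y)"
    have M': "x' \<in> M" "y' \<in> M" unfolding x'_def y'_def using \<pi> vertex_point_M that by blast+
    have "path_dist X x x' \<le> 1" "path_dist X y y' \<le> 1" "path_dist X x' y' = D (\<pi> x) (\<pi> y)"
      unfolding x'_def y'_def using \<pi> path_dist_vertices that by blast+
    then show ?thesis
      using triangle[of x x' y] triangle[of x' y' y] triangle[of x' x y'] triangle[of x y y'] that M'
        commute[of x x'] commute[of y y'] by linarith
  qed
  \<comment> \<open>Each inequality involves four distances, each with an error of at most 2, which
    gives 8.\<close>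
  have "four_point_hyperbolic M (path_dist X) (real k + 8)"
    unfolding four_point_hyperbolic_def
  proof (intro ballI)
    fix w x y z assume m: "w \<in> M" "x \<in> M" "y \<in> M" "z \<in> M"
    let ?d = "path_dist X"
    have "D (\<pi> x) (\<pi> z) + D (\<pi> y) (\<pi> w) \<le>
        max (D (\<pi> x) (\<pi> y) + D (\<pi> z) (\<pi> w)) (D (\<pi> y) (\<pi> z) + D (\<pi> x) (\<pi> w)) + k"
      using fp \<pi> m by blast
    then have "D (\<pi> x) (\<pi> z) + D (\<pi> y) (\<pi> w) \<le> D (\<pi> x) (\<pi> y) + D (\<pi> z) (\<pi> w) + k \<or>
      D (\<pi> x) (\<pi> z) + D (\<pi> y) (\<pi> w) \<le> D (\<pi> y) (\<pi> z) + D (\<pi> x) (\<pi> w) + k" by linarith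
    then have "?d x z + ?d y w \<le> (?d x y + ?d z w) + (real k + 8) \<or> ?d x z + ?d y w \<le> (?d y z + ?d x w) + (real k + 8)"
      using close[OF m(2,4)] close[OF m(3,1)] close[OF m(2,3)] close[OF m(4,1)] close[OF m(3,4)] close[OF m(2,1)]
      by linarith
    then show "?d x z + ?d y w \<le> max (?d x y + ?d z w) (?d y z + ?d x w) + (real k + 8)"
      by (auto simp: max_def)
  qed
  then show ?thesis
    using four_point_imp_Gromov_hyperbolic geodesic_path_dist by simp
qed

end

definition edge_rel :: "'a set set \<Rightarrow> 'a \<Rightarrow> 'a \<Rightarrow> bool" where
  "edge_rel X x y \<longleftrightarrow> x \<noteq> y \<and> {x, y} \<in> X"

definition triangle_rel :: "'a set set \<Rightarrow> 'a \<Rightarrow> 'a \<Rightarrow> 'a \<Rightarrow> bool" where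
  "triangle_rel X x y z \<longleftrightarrow> x \<noteq> y \<and> y \<noteq> z \<and> x \<noteq> z \<and> {x, y, z} \<in> X"

section \<open>Lifting along a covering\<close>

locale complex_covering =
  fixes X :: "'a set set" and Y :: "'b set" and R :: "'b \<Rightarrow> 'b \<Rightarrow> bool" and f :: "'b \<Rightarrow> 'a"
  assumes X: "abstract_simplicial_complex X"
    and cov: "covering (edge_rel X) (triangle_rel X) Y R f"
begin

lemma R_D:
  assumes "R y y'"
  shows "y \<in> Y" "y' \<in> Y" "R y' y" "{f y, f y'} \<in> X" "f y \<noteq> f y'"
  using assms cov unfolding covering_def edge_rel_def by metis+

lemma R_ex1: "y \<in> Y \<Longrightarrow> z \<noteq> f y \<Longrightarrow> {f y, z} \<in> X \<Longrightarrow> \<exists>!y'. R y y' \<and> f y' = z"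
  using cov unfolding covering_def edge_rel_def by metis

lemma R_triangle: "R y a \<Longrightarrow> R y b \<Longrightarrow> f a \<noteq> f b \<Longrightarrow> {f y, f a, f b} \<in> X \<Longrightarrow> R a b"
  using cov R_D(5) unfolding covering_def triangle_rel_def by metis

text \<open>Constant steps are allowed because consecutive labels of a simplicial approximation may
  coincide.\<close>

definition transport :: "'b \<Rightarrow> 'a \<Rightarrow> 'b" where
  "transport y z = (if z = f y then y else (THE y'. R y y' \<and> f y' = z))"

lemma transport_self [simp]: "transport y (f y) = y"
  unfolding transport_def by simp

lemma transport_eq:
  assumes "R y y'"
  shows "transport y (f y') = y'"
proof -
  have "\<exists>!y''. R y y'' \<and> f y'' = f y'" using R_ex1 R_D[OF assms] by metis
  then show ?thesis unfolding transport_def using assms R_D(5)[OF assms] by (simp add: the1_equality)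
qed

lemma transport_R:
  assumes "y \<in> Y" "z \<noteq> f y" "{f y, z} \<in> X"
  shows "R y (transport y z)" "f (transport y z) = z"
  using theI'[OF R_ex1[OF assms]] assms unfolding transport_def by simp_all

lemma transport_f:
  assumes "y \<in> Y" "{f y, z} \<in> X"
  shows "transport y z \<in> Y" "f (transport y z) = z"
  using transport_R[OF assms(1) _ assms(2)] R_D(2) assms by (cases "z = f y"; auto)+

lemma subset_simplex: "\<sigma> \<in> X \<Longrightarrow> \<tau> \<subseteq> \<sigma> \<Longrightarrow> \<tau> \<noteq> {} \<Longrightarrow> \<tau> \<in> X"
  using X unfolding abstract_simplicial_complex_def by blast

text \<open>Inside a simplex transport does not depend on the route; the nondegenerate case is the
  lifting of triangles.\<close>

lemma transport_transport:
  assumes y: "y \<in> Y" and s: "{f y, a, b} \<in> X"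
  shows "transport (transport y a) b = transport y b"
proof (cases "a = f y \<or> b = a")
  case True
  then show ?thesis
    using transport_f(2)[OF y subset_simplex[OF s, of "{f y, a}"]] by (metis insert_not_empty subset_insertI2 insert_mono empty_subsetI transport_self)
next
  case False
  have ya: "R y (transport y a)" "f (transport y a) = a"
    using transport_R[OF y _ subset_simplex[OF s], of a] False by auto
  show ?thesis
  proof (cases "b = f y")
    case True
    then show ?thesis using transport_eq[OF R_D(3)[OF ya(1)]] by simp
  next
    case b: False
    have yb: "R y (transport y b)" "f (transport y b) = b"
      using transport_R[OF y _ subset_simplex[OF s], of b] b by auto
    have "R (transport y a) (transport y b)"
      using R_triangle[OF ya(1) yb(1)] ya(2) yb(2) False s by metis
    then show ?thesis using transport_eq yb by metis
  qed
qed

primrec lift :: "(nat \<Rightarrow> 'a) \<Rightarrow> 'b \<Rightarrow> nat \<Rightarrow> 'b" where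
  "lift w y 0 = y"
| "lift w y (Suc i) = transport (lift w y i) (w (Suc i))"

text \<open>The corners of each square lie in one simplex, so right-then-up and up-then-right both
  equal transport along the diagonal.\<close>

lemma lift_row:
  assumes s: "s \<in> Y" "f s = w 0" "w' 0 = w 0"
    and sq: "\<And>i. i < N \<Longrightarrow> {w i, w (Suc i), w' i, w' (Suc i)} \<in> X"
  shows "i \<le> N \<Longrightarrow> lift w s i \<in> Y \<and> f (lift w s i) = w i \<and> lift w' s i = transport (lift w s i) (w' i)"
proof (induction i)
  case 0
  then show ?case using s transport_self[of s] by simp
next
  case (Suc i)
  let ?y = "lift w s i"
  have y: "?y \<in> Y" "f ?y = w i" "lift w' s i = transport ?y (w' i)" using Suc by auto
  note sub = subset_simplex[OF sq[of i]]
  have "{f ?y, w (Suc i)} \<in> X" using Suc.prems y(2) by (intro sub) auto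
  then have a: "lift w s (Suc i) \<in> Y" "f (lift w s (Suc i)) = w (Suc i)"
    using transport_f y by auto
  have "lift w' s (Suc i) = transport (transport ?y (w' i)) (w' (Suc i))" using y by simp
  also have "\<dots> = transport ?y (w' (Suc i))"
    using Suc.prems y by (intro transport_transport sub) auto
  also have "\<dots> = transport (transport ?y (w (Suc i))) (w' (Suc i))"
    using Suc.prems y by (intro transport_transport[symmetric] sub) auto
  finally show ?case using a by simp
qed

lemma lift_grid:
  assumes s: "s \<in> Y" and left: "\<And>j. j \<le> N \<Longrightarrow> w j 0 = f s" and right: "\<And>j. j \<le> N \<Longrightarrow> w j N = f s"
    and top: "\<And>i. i \<le> N \<Longrightarrow> w N i = f s"
    and sq: "\<And>i j. i < N \<Longrightarrow> j < N \<Longrightarrow> {w j i, w j (Suc i), w (Suc j) i, w (Suc j) (Suc i)} \<in> X"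
  shows "lift (w 0) s N = s"
proof -
  have "lift (w 0) s N = lift (w j) s N" if "j \<le> N" for j
    using that
  proof (induction j)
    case (Suc j)
    have "lift (w j) s N \<in> Y \<and> f (lift (w j) s N) = w j N \<and> lift (w (Suc j)) s N = transport (lift (w j) s N) (w (Suc j) N)"
      using lift_row[of s "w j" "w (Suc j)" N N] s left sq Suc.prems by simp
    moreover have "w j N = w (Suc j) N" using right[of j] right[of "Suc j"] Suc.prems by simp
    ultimately have "lift (w (Suc j)) s N = lift (w j) s N" by (metis transport_self)
    then show ?case using Suc by simp
  qed simp
  moreover have "lift (w N) s i = s" if "i \<le> N" for i
    using that by (induction i) (auto simp: top)
  from this[of N] calculation[of N] show ?thesis by simp
qed

text \<open>The labels may jump back and forth between the ends of an edge; inside the edge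
  transport depends only on the last label.\<close>

lemma lift_refined_path:
  assumes ys: "\<And>k. k < n \<Longrightarrow> R (ys k) (ys (Suc k))" and m: "0 < m"
    and w: "\<And>k. k \<le> n \<Longrightarrow> w (k * m) = f (ys k)"
      "\<And>k r. k < n \<Longrightarrow> r \<le> m \<Longrightarrow> w (k * m + r) \<in> {f (ys k), f (ys (Suc k))}"
  shows "k \<le> n \<Longrightarrow> lift w (ys 0) (k * m) = ys k"
proof (induction k)
  case (Suc k)
  have R: "R (ys k) (ys (Suc k))" using ys Suc by simp
  have "lift w (ys 0) (k * m + r) = transport (ys k) (w (k * m + r))" if "r \<le> m" for r
    using that
  proof (induction r)
    case 0
    then show ?case using Suc w(1)[of k] by simp
  next
    case (Suc r)
    have "{w (k * m + r), w (k * m + Suc r)} \<subseteq> {f (ys k), f (ys (Suc k))}"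
      using w(2)[of k r] w(2)[of k "Suc r"] \<open>Suc k \<le> n\<close> Suc.prems by auto
    then have "{f (ys k), w (k * m + r), w (k * m + Suc r)} \<in> X"
      by (intro subset_simplex[OF R_D(4)[OF R]]) auto
    then show ?case
      using Suc transport_transport[OF R_D(1)[OF R]] by simp
  qed
  from this[of m] have "lift w (ys 0) (Suc k * m) = transport (ys k) (w (Suc k * m))"
    by (simp add: add.commute)
  then show ?case using w(1)[OF Suc.prems] transport_eq[OF R] by simp
qed simp

end

section \<open>Simplicial approximation of loops and homotopies\<close>

lemma polyhedron_points_positive:
  assumes "x \<in> polyhedron_points X"
  shows "\<exists>v. x v > 0"
proof (rule ccontr)
  assume n: "\<nexists>v. x v > 0"
  obtain \<sigma> where "x \<in> closed_simplex \<sigma>" using assms unfolding polyhedron_points_def by blast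
  then have "sum x \<sigma> = 1" unfolding closed_simplex_def by blast
  moreover have "sum x \<sigma> \<le> 0" using n by (intro sum_nonpos) (auto simp: not_less)
  ultimately show False by simp
qed

text \<open>Used for open stars: vertices whose stars share the point \<open>x\<close> all belong to
  any simplex carrying \<open>x\<close>.\<close>

lemma carrier_simplex:
  assumes "abstract_simplicial_complex X" "x \<in> polyhedron_points X" "\<And>v. v \<in> S \<Longrightarrow> x v > 0" "S \<noteq> {}"
  shows "S \<in> X"
proof -
  obtain \<sigma> where s: "\<sigma> \<in> X" "x \<in> closed_simplex \<sigma>" using assms unfolding polyhedron_points_def by blast
  have "S \<subseteq> \<sigma>" using s assms(3) unfolding closed_simplex_def by fastforce
  then show ?thesis using s assms unfolding abstract_simplicial_complex_def by blast
qed

lemma openin_star: "openin (polyhedron X) {x \<in> polyhedron_points X. x v > 0}"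
  unfolding openin_polyhedron CW_open_def
proof (intro conjI ballI)
  fix \<sigma> assume "\<sigma> \<in> X"
  then have "{x \<in> polyhedron_points X. x v > 0} \<inter> closed_simplex \<sigma> = closed_simplex \<sigma> \<inter> {x. 0 < x v}"
    unfolding polyhedron_points_def by blast
  moreover have "open {x :: 'a \<Rightarrow> real. 0 < x v}"
    by (intro open_Collect_less continuous_on_const continuous_on_product_coordinates)
  ultimately show "openin (top_of_set (closed_simplex \<sigma>)) ({x \<in> polyhedron_points X. x v > 0} \<inter> closed_simplex \<sigma>)"
    by (metis openin_open_Int)
qed blast

lemma continuous_map_into_polyhedron:
  assumes "\<sigma> \<in> X" "continuous_map Z (top_of_set (closed_simplex \<sigma>)) g"
  shows "continuous_map Z (polyhedron X) g"
proof -
  have "continuous_map (top_of_set (closed_simplex \<sigma>)) (polyhedron X) id"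
    unfolding continuous_map_def topspace_polyhedron openin_polyhedron
  proof (intro conjI allI impI)
    show "id \<in> topspace (top_of_set (closed_simplex \<sigma>)) \<rightarrow> polyhedron_points X"
      using assms unfolding polyhedron_points_def by auto
    fix U assume "CW_open X U"
    then have "openin (top_of_set (closed_simplex \<sigma>)) (U \<inter> closed_simplex \<sigma>)"
      using assms unfolding CW_open_def by blast
    then show "openin (top_of_set (closed_simplex \<sigma>)) {x \<in> topspace (top_of_set (closed_simplex \<sigma>)). id x \<in> U}"
      by (simp add: Collect_conj_eq Int_commute)
  qed
  from continuous_map_compose[OF assms(2) this] show ?thesis by simp
qed

lemma polygonal_path:
  fixes c :: "nat \<Rightarrow> 'a"
  assumes X: "abstract_simplicial_complex X" and n: "0 < n" and c: "\<And>k. k < n \<Longrightarrow> {c k, c (Suc k)} \<in> X"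
  obtains p where "pathin (polyhedron X) p"
    "\<And>k. k \<le> n \<Longrightarrow> p (real k / real n) = vertex_point (c k)"
    "\<And>k t. k < n \<Longrightarrow> real k \<le> real n * t \<Longrightarrow> real n * t \<le> real (Suc k) \<Longrightarrow> p t \<in> closed_simplex {c k, c (Suc k)}"
proof -
  define e where "e k t = (\<lambda>v. (1 - (n * t - k)) * vertex_point (c k) v + (n * t - k) * vertex_point (c (Suc k)) v)"
    for k :: nat and t :: real
  define I where "I k = {t :: real. real k \<le> n * t \<and> n * t \<le> real (Suc k)}" for k :: nat
  have ecs: "e k t \<in> closed_simplex {c k, c (Suc k)}" if "t \<in> I k" for k t
    using that unfolding I_def e_def closed_simplex_pair vertex_point_def by auto
  have I01: "I k \<subseteq> {0..1}" if "k < n" for k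
  proof
    fix t :: real assume "t \<in> I k"
    then have t: "real k \<le> n * t" "n * t \<le> real (Suc k)" unfolding I_def by auto
    moreover have "real (Suc k) \<le> real n" using that by (simp only: of_nat_le_iff Suc_le_eq)
    ultimately have "0 \<le> real n * t" "real n * t \<le> real n * 1" by linarith+
    then show "t \<in> {0..1}" using n by (simp add: zero_le_mult_iff mult_le_cancel_left)
  qed
  have cover: "\<exists>k<n. t \<in> I k" if "t \<in> {0..1}" for t :: real
  proof (cases "t = 1")
    case True
    then show ?thesis using n unfolding I_def by (intro exI[of _ "n - 1"]) auto
  next
    case False
    then have "0 \<le> n * t" "n * t < n" using that n by auto
    then have "nat \<lfloor>n * t\<rfloor> < n" "real (nat \<lfloor>n * t\<rfloor>) \<le> n * t" "n * t \<le> real (Suc (nat \<lfloor>n * t\<rfloor>))"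
      by linarith+
    then show ?thesis unfolding I_def by blast
  qed
  have agree: "e i t = e j t" if "t \<in> I i" "t \<in> I j" "i < j" for i j and t :: real
  proof -
    have "j = Suc i" "n * t = j" using that unfolding I_def by auto
    then show ?thesis unfolding e_def by simp
  qed
  obtain p where p: "continuous_map (top_of_set {0..1}) (polyhedron X) p"
    "\<And>t k. k \<in> {..<n} \<Longrightarrow> t \<in> topspace (top_of_set {0..1}) \<inter> I k \<Longrightarrow> p t = e k t"
  proof (rule pasting_lemma_exists_closed[of "{..<n}" "top_of_set {0..1::real}" I "polyhedron X" e])
    show "topspace (top_of_set {0..1}) \<subseteq> \<Union> (I ` {..<n})" by (simp add: subset_iff, use cover in force)
    show "closedin (top_of_set {0..1}) (I k)" if "k \<in> {..<n}" for k
    proof (rule closed_subset)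
      show "I k \<subseteq> {0..1}" using I01 that by blast
      show "closed (I k)" unfolding I_def
        by (intro closed_Collect_conj closed_Collect_le continuous_intros)
    qed
    show "continuous_map (subtopology (top_of_set {0..1}) (I k)) (polyhedron X) (e k)" if "k \<in> {..<n}" for k
    proof (rule continuous_map_into_polyhedron)
      show "{c k, c (Suc k)} \<in> X" using c that by blast
      have "continuous_on ({0..1} \<inter> I k) (e k)"
        unfolding e_def by (intro continuous_on_coordinatewise_then_product continuous_intros)
      then show "continuous_map (subtopology (top_of_set {0..1}) (I k)) (top_of_set (closed_simplex {c k, c (Suc k)})) (e k)"
        unfolding subtopology_subtopology using ecs by (auto simp: continuous_map_in_subtopology)
    qed
    show "e i t = e j t" if "i \<in> {..<n}" "j \<in> {..<n}" "t \<in> topspace (top_of_set {0..1}) \<inter> I i \<inter> I j" for i j t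
    proof -
      have "t \<in> I i" "t \<in> I j" using that by blast+
      then show ?thesis using agree[of t i j] agree[of t j i] by (metis linorder_neqE)
    qed
  qed auto
  have pe: "p t = e k t" if "k < n" "t \<in> I k" for k t using I01[OF that(1)] that by (intro p(2)) auto
  show ?thesis
  proof
    show "pathin (polyhedron X) p" unfolding pathin_def using p(1) .
    show "p (real k / real n) = vertex_point (c k)" if "k \<le> n" for k
    proof (cases "k < n")
      case True
      then show ?thesis using pe[of k "k / n"] n by (simp add: I_def e_def)
    next
      case False
      then have "k = Suc (n - 1)" "n - 1 < n" using that n by auto
      then show ?thesis using pe[of "n - 1" "k / n"] n by (simp add: I_def e_def of_nat_diff)
    qed
    show "p t \<in> closed_simplex {c k, c (Suc k)}" if "k < n" "real k \<le> real n * t" "real n * t \<le> real (Suc k)" for k t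
      using pe[of k t] ecs[of t k] that unfolding I_def by auto
  qed
qed

text \<open>Here \<epsilon> is a Lebesgue number of the cover of the square by preimages of open
  stars, and \<open>\<phi> z\<close> names a star containing the image of the \<epsilon>-ball around
  \<open>z\<close>.\<close>

lemma simplicial_grid:
  fixes h :: "real \<times> real \<Rightarrow> 'a \<Rightarrow> real"
  assumes h: "continuous_map (prod_topology (top_of_set {0..1}) (top_of_set {0..1})) (polyhedron X) h"
  obtains \<epsilon> \<phi> where "0 < \<epsilon>"
    "\<And>z z'. z \<in> {0..1} \<times> {0..1} \<Longrightarrow> z' \<in> {0..1} \<times> {0..1} \<Longrightarrow> dist z z' < \<epsilon> \<Longrightarrow> h z' (\<phi> z) > 0"
proof -
  let ?Q = "{0..1} \<times> {0..1} :: (real \<times> real) set"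
  have top: "prod_topology (top_of_set {0..1}) (top_of_set {0..1}) = top_of_set ?Q"
    by (rule prod_topology_subtopology_eu)
  have h': "continuous_map (top_of_set ?Q) (polyhedron X) h" using h top by simp
  define \<G> where "\<G> = {G. open G \<and> (\<exists>v. \<forall>z\<in>G \<inter> ?Q. h z v > 0)}"
  have "?Q \<subseteq> \<Union>\<G>"
  proof
    fix z assume z: "z \<in> ?Q"
    then have hz: "h z \<in> polyhedron_points X" 
      using h' unfolding continuous_map_def topspace_polyhedron by auto
    then obtain v where v: "h z v > 0" using polyhedron_points_positive by blast
    have "openin (top_of_set ?Q) {z \<in> ?Q. h z \<in> {x \<in> polyhedron_points X. x v > 0}}"
      using openin_continuous_map_preimage[OF h' openin_star[of X v]] by simp
    then obtain G where "open G" "{z \<in> ?Q. h z \<in> {x \<in> polyhedron_points X. x v > 0}} = ?Q \<inter> G"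
      unfolding openin_open by blast
    then show "z \<in> \<Union>\<G>" unfolding \<G>_def using z hz v by blast
  qed
  moreover have "compact ?Q" by (intro compact_Times compact_Icc)
  ultimately obtain \<epsilon> where e: "0 < \<epsilon>" "\<And>z. z \<in> ?Q \<Longrightarrow> \<exists>G\<in>\<G>. ball z \<epsilon> \<subseteq> G"
    using Heine_Borel_lemma[of ?Q \<G>] unfolding \<G>_def by blast
  have "\<exists>v. \<forall>z'\<in>?Q. dist z z' < \<epsilon> \<longrightarrow> h z' v > 0" if "z \<in> ?Q" for z
    using e(2)[OF that] unfolding \<G>_def by (auto simp: subset_iff)
  then obtain \<phi> where "\<And>z z'. z \<in> ?Q \<Longrightarrow> z' \<in> ?Q \<Longrightarrow> dist z z' < \<epsilon> \<Longrightarrow> h z' (\<phi> z) > 0"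
    by metis
  then show ?thesis using that e(1) by blast
qed

theorem simply_connected_monodromy:
  assumes X: "abstract_simplicial_complex X" and sc: "simply_connected_space (polyhedron X)"
    and cov: "covering (edge_rel X) (triangle_rel X) Y R f"
    and path: "R\<^sup>*\<^sup>* s t" and eq: "f s = f t"
  shows "s = t"
proof -
  interpret complex_covering X Y R f using X cov by (rule complex_covering.intro)
  obtain n where "(R ^^ n) s t" using path rtranclp_imp_relpowp by metis
  then obtain ys where ys: "ys 0 = s" "ys n = t" "\<And>k. k < n \<Longrightarrow> R (ys k) (ys (Suc k))"
    unfolding relpowp_fun_conv by blast
  show ?thesis
  proof (cases "n = 0")
    case True
    then show ?thesis using ys by simp
  next
    case False
    then have n: "0 < n" by simp
    define v0 where "v0 = f s"
    have sY: "s \<in> Y" using ys R_D(1) n by metis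
    have edge: "{f (ys k), f (ys (Suc k))} \<in> X" if "k < n" for k using ys(3)[OF that] R_D(4) by blast
    obtain p where p: "pathin (polyhedron X) p"
      "\<And>k. k \<le> n \<Longrightarrow> p (real k / real n) = vertex_point (f (ys k))"
      "\<And>k t. k < n \<Longrightarrow> real k \<le> real n * t \<Longrightarrow> real n * t \<le> real (Suc k) \<Longrightarrow> p t \<in> closed_simplex {f (ys k), f (ys (Suc k))}"
      using polygonal_path[OF X n, of "\<lambda>k. f (ys k)"] edge by blast
    have p01: "p 0 = vertex_point v0" "p 1 = vertex_point v0"
      using p(2)[of 0] p(2)[of n] n ys eq unfolding v0_def by auto
    then have "homotopic_with (\<lambda>h. h 0 = p 0 \<and> h 1 = p 0) (top_of_set {0..1}) (polyhedron X) p (\<lambda>_. p 0)"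
      using conjunct2[OF sc[unfolded simply_connected_space_def], rule_format, of p] p(1) by simp
    then obtain h :: "real \<times> real \<Rightarrow> 'a \<Rightarrow> real" where h: "continuous_map (prod_topology (top_of_set {0..1}) (top_of_set {0..1})) (polyhedron X) h"
      "\<And>t. h (0, t) = p t" "\<And>t. h (1, t) = p 0" "\<And>u. u \<in> {0..1} \<Longrightarrow> h (u, 0) = p 0 \<and> h (u, 1) = p 0"
      unfolding homotopic_with_def by auto
    obtain \<epsilon> \<phi> where e: "0 < \<epsilon>"
      "\<And>z z'. z \<in> {0..1} \<times> {0..1} \<Longrightarrow> z' \<in> {0..1} \<times> {0..1} \<Longrightarrow> dist z z' < \<epsilon> \<Longrightarrow> h z' (\<phi> z) > 0"
      using simplicial_grid[OF h(1)] by blast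
    \<comment> \<open>As \<open>N\<close> is a multiple of \<open>n\<close>, the vertices of the
      polygon sit at grid points. Neighbouring grid points, also diagonal ones, are at most 2/N
      apart.\<close>
    obtain m :: nat where m: "2 / \<epsilon> < m" using reals_Archimedean2 by blast
    then have m0: "0 < m" using e by (metis divide_pos_pos less_trans of_nat_0_less_iff zero_less_numeral)
    define N where "N = n * m"
    have N: "0 < N" "real N = real n * real m" using n m0 unfolding N_def by auto
    have "real m \<le> real N" using n mult_right_mono[of 1 "real n" "real m"] unfolding N(2) by simp
    then have "2 / \<epsilon> < N" using m by linarith
    then have Ne: "2 / N < \<epsilon>" using e N by (simp add: field_simps)
    define g where "g j i = (real j / N, real i / N)" for j i :: nat
    define w where "w j i = \<phi> (g j i)" for j i
    have gQ: "g j i \<in> {0..1} \<times> {0..1}" if "j \<le> N" "i \<le> N" for j i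
      using that N unfolding g_def by simp
    have near: "h (g j i) (w j' i') > 0"
      if "j \<le> N" "i \<le> N" "j' \<le> N" "i' \<le> N" "\<bar>real j - real j'\<bar> \<le> 1" "\<bar>real i - real i'\<bar> \<le> 1" for j i j' i'
    proof -
      have "dist (g j' i') (g j i) \<le> dist (real j' / N) (real j / N) + dist (real i' / N) (real i / N)"
        unfolding g_def dist_Pair_Pair by (rule sqrt_sum_squares_le_sum) auto
      also have "\<dots> = \<bar>real j' - real j\<bar> / N + \<bar>real i' - real i\<bar> / N"
        unfolding dist_real_def by (simp flip: diff_divide_distrib)
      also have "\<dots> \<le> 1 / N + 1 / N"
        using that by (intro add_mono divide_right_mono) auto
      also have "\<dots> < \<epsilon>" using Ne by simp
      finally show ?thesis unfolding w_def using e gQ that by blast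
    qed
    \<comment> \<open>At the vertex itself only \<open>v0\<close> has a positive coordinate, so the
      label is forced; three sides of the grid thus become constant.\<close>
    have base: "w j i = v0" if "j \<le> N" "i \<le> N" "h (g j i) = vertex_point v0" for j i
      using near[OF that(1,2) that(1,2)] that(3) unfolding vertex_point_def by (simp split: if_splits)
    have "lift (w 0) s N = s"
    proof (rule lift_grid[OF sY])
      show "w j 0 = f s" if "j \<le> N" for j
        using base[of j 0] h(4)[of "j / N"] that N p01 unfolding g_def v0_def by simp
      show "w j N = f s" if "j \<le> N" for j
        using base[of j N] h(4)[of "j / N"] that N p01 unfolding g_def v0_def by simp
      show "w N i = f s" if "i \<le> N" for i
        using base[of N i] h(3) that N(1) p01 unfolding g_def v0_def by simp
      \<comment> \<open>All four labels have a positive coordinate at the single point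
        \<open>h (g j i)\<close>.\<close>
      show "{w j i, w j (Suc i), w (Suc j) i, w (Suc j) (Suc i)} \<in> X" if "i < N" "j < N" for i j
      proof (rule carrier_simplex[OF X])
        show "h (g j i) \<in> polyhedron_points X"
          using h(1) gQ[of j i] that unfolding continuous_map_def topspace_polyhedron by auto
      qed (use near[of j i] that in auto)
    qed
    moreover have "lift (w 0) (ys 0) (n * m) = ys n"
    proof (rule lift_refined_path[of n ys m, OF ys(3) m0])
      have h0: "h (g 0 i) = p (i / N)" for i using h(2) unfolding g_def by simp
      show "w 0 (k * m) = f (ys k)" if "k \<le> n" for k
      proof -
        have "k * m \<le> N" using that unfolding N_def by simp
        moreover have "real (k * m) / N = real k / n" using m0 N by simp
        ultimately show ?thesis
          using near[of 0 "k * m" 0 "k * m"] h0[of "k * m"] p(2)[OF that] unfolding vertex_point_def by (simp split: if_splits)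
      qed
      show "w 0 (k * m + r) \<in> {f (ys k), f (ys (Suc k))}" if "k < n" "r \<le> m" for k r
      proof -
        have "k * m + r \<le> Suc k * m" using that by simp
        also have "\<dots> \<le> N" unfolding N_def using that by (intro mult_right_mono) auto
        finally have le: "k * m + r \<le> N" .
        have "n * (real (k * m + r) / N) = real k + r / m" using m0 n N by (simp add: field_simps)
        moreover have "0 \<le> real r / m" "real r / m \<le> 1" using that m0 by auto
        ultimately have "p (real (k * m + r) / N) \<in> closed_simplex {f (ys k), f (ys (Suc k))}"
          using p(3)[OF that(1), of "real (k * m + r) / N"] by simp
        moreover have "p (real (k * m + r) / N) (w 0 (k * m + r)) > 0"
          using near[of 0 "k * m + r" 0 "k * m + r"] le h0 by simp
        ultimately show ?thesis unfolding closed_simplex_pair by force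
      qed
    qed auto
    ultimately show ?thesis using ys unfolding N_def by simp
  qed
qed

text \<open>The open stars of the vertices reachable from \<open>x\<close> and those of the others
  form two disjoint open sets covering the polyhedron.\<close>

lemma connected_edge_rel:
  assumes X: "abstract_simplicial_complex X" and con: "connected_space (polyhedron X)"
    and xy: "x \<in> vertices X" "y \<in> vertices X"
  shows "(edge_rel X)\<^sup>*\<^sup>* x y"
proof (rule ccontr)
  assume n: "\<not> (edge_rel X)\<^sup>*\<^sup>* x y"
  define C where "C = {v. (edge_rel X)\<^sup>*\<^sup>* x v}"
  define U where "U S = (\<Union>v\<in>S. {p \<in> polyhedron_points X. p v > 0})" for S
  have "openin (polyhedron X) (U S)" for S
    unfolding U_def by (rule openin_Union) (auto intro: openin_star)
  moreover have "topspace (polyhedron X) \<subseteq> U C \<union> U (- C)"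
    unfolding topspace_polyhedron U_def using polyhedron_points_positive by fastforce
  moreover have "U C \<inter> U (- C) = {}"
  proof -
    have False if p: "p \<in> polyhedron_points X" "p u > 0" "p v > 0" "u \<in> C" "v \<notin> C" for p u v
    proof -
      have "{u, v} \<in> X" using carrier_simplex[OF X p(1), of "{u, v}"] p by auto
      then have "edge_rel X u v" using p unfolding edge_rel_def by auto
      then show False using p unfolding C_def by (auto intro: rtranclp.rtrancl_into_rtrancl)
    qed
    then show ?thesis unfolding U_def by blast
  qed
  moreover have "vertex_point v \<in> U S" if "v \<in> S" "v \<in> vertices X" for v S
  proof -
    have "vertex_point v \<in> polyhedron_points X"
      using that(2) vertex_point_closed_simplex[of "{v}" v] unfolding polyhedron_points_def vertices_def by blast
    then show ?thesis unfolding U_def using that(1) by (force simp: vertex_point_def)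
  qed
  moreover have "x \<in> C" "y \<in> - C" using n unfolding C_def by auto
  ultimately show False
    using con xy unfolding connected_space_def by (metis emptyE)
qed

section \<open>Combinatorial cycles\<close>

lemma continuous_map_from_polyhedron:
  fixes g :: "('a \<Rightarrow> real) \<Rightarrow> 'b :: topological_space"
  assumes S: "\<And>x. x \<in> polyhedron_points X \<Longrightarrow> g x \<in> S"
    and cont: "\<And>\<sigma>. \<sigma> \<in> X \<Longrightarrow> continuous_on (closed_simplex \<sigma>) g"
  shows "continuous_map (polyhedron X) (top_of_set S) g"
  unfolding continuous_map_in_subtopology
proof (intro conjI)
  show "continuous_map (polyhedron X) euclidean g"
    unfolding continuous_map_def topspace_polyhedron openin_polyhedron
  proof (intro conjI allI impI)
    fix U :: "'b set" assume "openin euclidean U"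
    then have U: "open U" by simp
    show "CW_open X {x \<in> polyhedron_points X. g x \<in> U}"
      unfolding CW_open_def
    proof (intro conjI ballI)
      fix \<sigma> assume s: "\<sigma> \<in> X"
      then have "{x \<in> polyhedron_points X. g x \<in> U} \<inter> closed_simplex \<sigma> = closed_simplex \<sigma> \<inter> g -` U"
        unfolding polyhedron_points_def by blast
      then show "openin (top_of_set (closed_simplex \<sigma>)) ({x \<in> polyhedron_points X. g x \<in> U} \<inter> closed_simplex \<sigma>)"
        using continuous_openin_preimage_gen[OF cont[OF s] U] by simp
    qed blast
  qed simp
  show "g \<in> topspace (polyhedron X) \<rightarrow> S"
    using S unfolding topspace_polyhedron by blast
qed

lemma compact_closed_simplex_pair:
  fixes u v :: 'a
  shows "compact (closed_simplex {u, v})"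
proof -
  define e where "e t = (\<lambda>w. (1 - t) * vertex_point u w + t * vertex_point v w)" for t :: real
  have "closed_simplex {u, v} = e ` {0..1}"
  proof (intro equalityI subsetI)
    fix x assume x: "x \<in> closed_simplex {u, v}"
    then have "x = e (x v)"
      unfolding e_def closed_simplex_pair vertex_point_def by (auto split: if_splits)
    moreover have "x v \<in> {0..1}" using x unfolding closed_simplex_pair by (auto split: if_splits)
    ultimately show "x \<in> e ` {0..1}" by blast
  next
    fix x assume "x \<in> e ` {0..1}"
    then show "x \<in> closed_simplex {u, v}"
      unfolding e_def closed_simplex_pair vertex_point_def by auto
  qed
  moreover have "continuous_on {0..1} e"
    unfolding e_def by (intro continuous_on_coordinatewise_then_product continuous_intros)
  ultimately show ?thesis using compact_continuous_image[OF _ compact_Icc] by metis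
qed

lemma cis_inj_on_period:
  assumes "0 \<le> a" "a < 2 * pi" "0 \<le> b" "b < 2 * pi" "cis a = cis b"
  shows "a = b"
proof -
  have "Arg2pi (cis t) = t" if "0 \<le> t" "t < 2 * pi" for t
    using that by (intro Arg2pi_unique[of 1]) (auto simp: cis_conv_exp)
  then show ?thesis using assms by metis
qed

text \<open>Since \<open>cycle\<close> asks for a homeomorphism with the circle, largeness applies
  to a closed vertex sequence only after one has been constructed for it.\<close>

locale combinatorial_cycle =
  fixes n :: nat and c :: "nat \<Rightarrow> 'a"
  assumes n: "3 \<le> n" and inj: "inj_on c {..<n}"
begin

definition nxt :: "nat \<Rightarrow> 'a" where
  "nxt i = c (Suc i mod n)"

definition C :: "'a set set" where
  "C = (\<lambda>i. {c i}) ` {..<n} \<union> (\<lambda>i. {c i, nxt i}) ` {..<n}"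

lemma c_eq: "i < n \<Longrightarrow> j < n \<Longrightarrow> c i = c j \<longleftrightarrow> i = j"
  using inj by (auto simp: inj_on_def)

lemma mod_less: "Suc i mod n < n"
  using n by simp

lemma c_nxt: "i < n \<Longrightarrow> c i \<noteq> nxt i"
  unfolding nxt_def using c_eq[OF _ mod_less[of i], of i] n by (auto simp: mod_Suc split: if_splits)

text \<open>Equal edges at different indices would force \<open>i + 2\<close> and \<open>i\<close>
  to agree modulo \<open>n\<close>, which \<open>3 \<le> n\<close> excludes.\<close>

lemma edge_inj: "inj_on (\<lambda>i. {c i, nxt i}) {..<n}"
proof (rule inj_onI)
  fix i j assume ij: "i \<in> {..<n}" "j \<in> {..<n}" "{c i, nxt i} = {c j, nxt j}"
  then consider "c i = c j" | "c i = nxt j" "nxt i = c j" by (auto simp: doubleton_eq_iff)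
  then show "i = j"
  proof cases
    case 1
    then show ?thesis using ij c_eq by simp
  next
    case 2
    then have "i = Suc j mod n" "Suc i mod n = j"
      using ij c_eq mod_less unfolding nxt_def by (metis lessThan_iff)+
    then show ?thesis using n ij by (auto simp: mod_Suc split: if_splits)
  qed
qed

lemma edges_C: "edges C = (\<lambda>i. {c i, nxt i}) ` {..<n}"
  unfolding edges_def C_def using c_nxt by (auto simp: card_insert_if)

lemma cycle_length_C: "cycle_length C = n"
  unfolding cycle_length_def edges_C using card_image[OF edge_inj] by simp

lemma vertices_C: "vertices C = c ` {..<n}"
  unfolding vertices_def C_def using c_nxt by (auto simp: doubleton_eq_iff)

lemma abstract_C: "abstract_simplicial_complex C"
  unfolding abstract_simplicial_complex_def
proof (intro conjI ballI allI impI)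
  fix \<sigma> \<tau> assume s: "\<sigma> \<in> C" and t: "\<tau> \<subseteq> \<sigma> \<and> \<tau> \<noteq> {}"
  have v: "{c i} \<in> C" "{nxt i} \<in> C" if "i < n" for i
    using that mod_less[of i] unfolding C_def nxt_def by blast+
  obtain i where "i < n" "\<sigma> = {c i} \<or> \<sigma> = {c i, nxt i}" using s unfolding C_def by blast
  moreover from this have "\<tau> = \<sigma> \<or> \<tau> = {c i} \<or> \<tau> = {nxt i}" using t by blast
  ultimately show "\<tau> \<in> C" using s v by blast
qed (auto simp: C_def)

lemma points_C: "polyhedron_points C = (\<Union>i<n. closed_simplex {c i, nxt i})"
proof -
  have "closed_simplex {c i} \<subseteq> closed_simplex {c i, nxt i}" if "i < n" for i
    using c_nxt[OF that] closed_simplex_pair[of _ "c i" "c i"] by (auto simp: closed_simplex_pair)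
  then show ?thesis unfolding polyhedron_points_def C_def by blast
qed

text \<open>
  The vertex \<open>c i\<close> has angle \<open>i\<close>, except that \<open>c 0\<close> has angle \<open>n\<close> when approached along the last edge.
\<close>

definition angle :: "('a \<Rightarrow> real) \<Rightarrow> real" where
  "angle x = (\<Sum>i<n. real i * x (c i)) + (if x (c (n - 1)) > 0 then real n * x (c 0) else 0)"

definition wrap :: "('a \<Rightarrow> real) \<Rightarrow> complex" where
  "wrap x = cis (2 * pi / n * angle x)"

lemma wrap_edge:
  assumes i: "i < n" and x: "x \<in> closed_simplex {c i, nxt i}"
  shows "wrap x = cis (2 * pi / n * (real i + x (nxt i)))"
proof -
  define j where "j = Suc i mod n"
  have j: "j < n" "nxt i = c j" "i \<noteq> j"
    using n i unfolding j_def nxt_def by (auto simp: mod_Suc)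
  have xs: "0 \<le> x (c i)" "0 \<le> x (c j)" "x (c i) + x (c j) = 1" "\<And>w. w \<noteq> c i \<Longrightarrow> w \<noteq> c j \<Longrightarrow> x w = 0"
    using x c_nxt[OF i] unfolding closed_simplex_pair j(2) by auto
  have "(\<Sum>k<n. real k * x (c k)) = (\<Sum>k\<in>{i, j}. real k * x (c k))"
    using i j xs(4) c_eq by (intro sum.mono_neutral_right) auto
  then have sum: "(\<Sum>k<n. real k * x (c k)) = real i * x (c i) + real j * x (c j)" using j by simp
  show ?thesis
  proof (cases "Suc i = n")
    case False
    then have ji: "j = Suc i" using i unfolding j_def by simp
    have "x (c (n - 1)) > 0 \<Longrightarrow> x (c 0) = 0"
    proof -
      assume "x (c (n - 1)) > 0"
      then have "n - 1 = j" using xs(4)[of "c (n - 1)"] c_eq i j False n by force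
      then show "x (c 0) = 0" using xs(4)[of "c 0"] c_eq[of 0 i] c_eq[of 0 j] i j n ji by simp
    qed
    then have "angle x = real i * x (c i) + real j * x (c j)" unfolding angle_def sum by auto
    also have "\<dots> = real i * (x (c i) + x (c j)) + x (c j)" unfolding ji by (simp add: algebra_simps)
    finally show ?thesis unfolding wrap_def j(2) xs(3) by simp
  next
    case True
    then have ji: "j = 0" "i = n - 1" unfolding j_def by auto
    show ?thesis
    proof (cases "x (c i) > 0")
      case True
      then have "angle x = real i * x (c i) + real n * x (c j)" unfolding angle_def sum ji by simp
      also have "real n = real i + 1" using \<open>Suc i = n\<close> by simp
      finally have "angle x = real i * (x (c i) + x (c j)) + x (c j)" by (simp add: algebra_simps)
      then show ?thesis unfolding wrap_def j(2) xs(3) by simp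
    next
      \<comment> \<open>At the vertex \<open>c 0\<close> itself the angle is 0 rather than
        \<open>n\<close>; both give the same point of the circle.\<close>
      case False
      then have "x (c i) = 0" "x (c j) = 1" using xs by auto
      then have "angle x = 0" unfolding angle_def sum ji by simp
      moreover have "2 * pi / n * (real i + x (c j)) = 2 * pi"
        proof -
          have "real i + x (c j) = real n" using \<open>x (c j) = 1\<close> \<open>Suc i = n\<close> by linarith
          then show ?thesis using n by simp
        qed
      ultimately show ?thesis unfolding wrap_def j(2) by simp
    qed
  qed
qed

text \<open>\<open>angle\<close> jumps at \<open>c 0\<close>, but on each closed edge
  \<open>wrap\<close> agrees with the continuous expression of \<open>wrap_edge\<close>.\<close>

lemma wrap_continuous: "continuous_map (polyhedron C) (top_of_set (sphere 0 1)) wrap"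
proof (rule continuous_map_from_polyhedron)
  show "wrap x \<in> sphere 0 1" for x unfolding wrap_def by simp
  fix \<sigma> assume "\<sigma> \<in> C"
  then obtain i where i: "i < n" "closed_simplex \<sigma> \<subseteq> closed_simplex {c i, nxt i}"
  proof -
    assume a: "\<And>i. i < n \<Longrightarrow> closed_simplex \<sigma> \<subseteq> closed_simplex {c i, nxt i} \<Longrightarrow> thesis"
    obtain i where i: "i < n" "\<sigma> = {c i} \<or> \<sigma> = {c i, nxt i}" using \<open>\<sigma> \<in> C\<close> unfolding C_def by blast
    have "closed_simplex {c i} \<subseteq> closed_simplex {c i, nxt i}"
      using c_nxt[OF i(1)] closed_simplex_pair[of _ "c i" "c i"] by (auto simp: closed_simplex_pair)
    then show thesis using a i by blast
  qed
  have "continuous_on (closed_simplex {c i, nxt i}) (\<lambda>x. cis (2 * pi / n * (real i + x (nxt i))))"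
    by (intro continuous_intros continuous_on_subset[OF continuous_on_product_coordinates]) auto
  then have "continuous_on (closed_simplex {c i, nxt i}) wrap"
    using wrap_edge[OF i(1)] by (metis (no_types, lifting) continuous_on_cong)
  then show "continuous_on (closed_simplex \<sigma>) wrap" using continuous_on_subset i by blast
qed

lemma compact_polyhedron_C: "compact_space (polyhedron C)"
proof -
  have "compactin (polyhedron C) (closed_simplex {c i, nxt i})" if "i < n" for i
  proof -
    have "{c i, nxt i} \<in> C" using that unfolding C_def by blast
    then have "continuous_map (top_of_set (closed_simplex {c i, nxt i})) (polyhedron C) id"
      by (rule continuous_map_into_polyhedron) simp
    moreover have "compactin (top_of_set (closed_simplex {c i, nxt i})) (closed_simplex {c i, nxt i})"
      unfolding compactin_subtopology compactin_euclidean_iff using compact_closed_simplex_pair[of "c i" "nxt i"] by simp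
    ultimately show ?thesis using image_compactin by fastforce
  qed
  then have "compactin (polyhedron C) (\<Union>((\<lambda>i. closed_simplex {c i, nxt i}) ` {..<n}))"
    by (intro compactin_Union) auto
  then show ?thesis unfolding compact_space_def topspace_polyhedron points_C .
qed

text \<open>The edges without their far ends cover the cycle, so each point gets an angle in the
  half-open period from 0 to \<open>n\<close>.\<close>

lemma normal_position:
  assumes "x \<in> polyhedron_points C"
  shows "\<exists>i<n. x \<in> closed_simplex {c i, nxt i} \<and> x (nxt i) < 1"
proof -
  obtain i where i: "i < n" "x \<in> closed_simplex {c i, nxt i}" using assms points_C by blast
  show ?thesis
  proof (cases "x (nxt i) < 1")
    case False
    define j where "j = Suc i mod n"
    have j: "j < n" "nxt i = c j" unfolding j_def nxt_def using n by auto
    have "x (c j) = 1" "\<And>w. w \<noteq> c j \<Longrightarrow> x w = 0"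
      using i False c_nxt[OF i(1)] unfolding closed_simplex_pair j(2) by (auto, smt (verit))
    then have "x \<in> closed_simplex {c j, nxt j}" "x (nxt j) < 1"
      using c_nxt[OF j(1)] unfolding closed_simplex_pair by auto
    then show ?thesis using j by blast
  qed (use i in blast)
qed

lemma wrap_inj: "inj_on wrap (polyhedron_points C)"
proof (rule inj_onI)
  fix x y assume xy: "x \<in> polyhedron_points C" "y \<in> polyhedron_points C" "wrap x = wrap y"
  obtain i where i: "i < n" "x \<in> closed_simplex {c i, nxt i}" "x (nxt i) < 1"
    using normal_position xy by blast
  obtain j where j: "j < n" "y \<in> closed_simplex {c j, nxt j}" "y (nxt j) < 1"
    using normal_position xy by blast
  have nn: "0 \<le> x (nxt i)" "0 \<le> y (nxt j)" using i j unfolding closed_simplex_pair by auto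
  have "2 * pi / n * (real i + x (nxt i)) = 2 * pi / n * (real j + y (nxt j))"
  proof (rule cis_inj_on_period)
    show "cis (2 * pi / n * (real i + x (nxt i))) = cis (2 * pi / n * (real j + y (nxt j)))"
      using wrap_edge i j xy by metis
    have "real i + x (nxt i) < n" "real j + y (nxt j) < n" using i j by linarith+
    moreover have "2 * pi / n * t < 2 * pi" if "t < n" for t :: real
      using mult_strict_left_mono[OF that, of "2 * pi / n"] n by simp
    ultimately show "2 * pi / n * (real i + x (nxt i)) < 2 * pi" "2 * pi / n * (real j + y (nxt j)) < 2 * pi"
      by blast+
  qed (use nn in auto)
  then have eq: "real i + x (nxt i) = real j + y (nxt j)" using n by simp
  have "i = j" using eq nn i j by linarith
  then have "x (nxt i) = y (nxt i)" using eq by simp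
  then have "\<bar>x w - y w\<bar> \<le> 0" for w
    using i j \<open>i = j\<close> c_nxt[OF i(1)] unfolding closed_simplex_pair by (cases "w = c i \<or> w = nxt i") auto
  then show "x = y" by auto
qed

lemma wrap_surj: "wrap ` polyhedron_points C = sphere 0 1"
proof (intro equalityI subsetI)
  fix z :: complex assume z: "z \<in> sphere 0 1"
  define a where "a = Arg2pi z * n / (2 * pi)"
  have a: "0 \<le> a" "a < n"
    using Arg2pi_ge_0[of z] Arg2pi_lt_2pi[of z] n unfolding a_def by (auto simp: field_simps)
  define i where "i = nat \<lfloor>a\<rfloor>"
  define s where "s = a - i"
  have i: "i < n" "0 \<le> s" "s \<le> 1" using a unfolding i_def s_def by linarith+
  define x where "x = (\<lambda>w. (1 - s) * vertex_point (c i) w + s * vertex_point (nxt i) w)"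
  have x: "x \<in> closed_simplex {c i, nxt i}" "x (nxt i) = s"
    using i c_nxt[OF i(1)] unfolding x_def closed_simplex_pair vertex_point_def by auto
  have "2 * pi / n * (real i + x (nxt i)) = Arg2pi z"
    using n unfolding x(2) s_def a_def by simp
  then have "wrap x = cis (Arg2pi z)" using wrap_edge[OF i(1) x(1)] by simp
  also have "\<dots> = z" using Arg2pi_eq[of z] z by (simp add: cis_conv_exp)
  finally show "z \<in> wrap ` polyhedron_points C" using x i points_C by blast
qed (auto simp: wrap_def)

lemma polyhedron_C_circle: "polyhedron C homeomorphic_space top_of_set (sphere (0::complex) 1)"
proof -
  have "homeomorphic_map (polyhedron C) (top_of_set (sphere 0 1)) wrap"
    using wrap_continuous compact_polyhedron_C wrap_surj wrap_inj
    by (intro continuous_imp_homeomorphic_map) (auto simp: topspace_polyhedron Hausdorff_space_subtopology)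
  then show ?thesis unfolding homeomorphic_space using homeomorphic_map_imp_homeomorphic_space by blast
qed

end

lemma large_cycle_diagonal:
  fixes c :: "nat \<Rightarrow> 'a"
  assumes L: "large k L" "abstract_simplicial_complex L" and nk: "4 \<le> n" "n < k"
    and inj: "inj_on c {..<n}" and edge: "\<And>i. i < n \<Longrightarrow> {c i, c (Suc i mod n)} \<in> L"
  shows "\<exists>x\<in>c ` {..<n}. \<exists>y\<in>c ` {..<n}. x \<noteq> y \<and> {x, y} \<in> L \<and> (\<forall>i<n. {x, y} \<noteq> {c i, c (Suc i mod n)})"
proof -
  interpret combinatorial_cycle n c using nk inj by unfold_locales auto
  note sub = L(2)[unfolded abstract_simplicial_complex_def, THEN conjunct2, rule_format]
  have "{c i} \<in> L" if "i < n" for i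
    using sub[OF edge[OF that], of "{c i}"] by blast
  then have "subcomplex C L"
    unfolding subcomplex_def using abstract_C edge by (auto simp: C_def nxt_def)
  then have "cycle L C" unfolding cycle_def using polyhedron_C_circle by blast
  then have "has_diagonal L C" using L(1) nk cycle_length_C unfolding large_def by simp
  then obtain u v where uv: "u \<in> c ` {..<n}" "v \<in> c ` {..<n}" "u \<noteq> v" "{u, v} \<notin> C" "{u, v} \<in> L"
    unfolding has_diagonal_def vertices_C by blast
  then have "\<forall>i<n. {u, v} \<noteq> {c i, c (Suc i mod n)}" unfolding C_def nxt_def by blast
  then show ?thesis using uv by blast
qed

lemma abstract_link:
  assumes "abstract_simplicial_complex X"
  shows "abstract_simplicial_complex (link X v)"
  unfolding abstract_simplicial_complex_def
proof (intro conjI ballI allI impI)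
  fix \<sigma> \<tau> assume s: "\<sigma> \<in> link X v" and t: "\<tau> \<subseteq> \<sigma> \<and> \<tau> \<noteq> {}"
  have sub: "\<And>\<sigma> \<tau>. \<sigma> \<in> X \<Longrightarrow> \<tau> \<subseteq> \<sigma> \<Longrightarrow> \<tau> \<noteq> {} \<Longrightarrow> \<tau> \<in> X"
    using assms unfolding abstract_simplicial_complex_def by blast
  have "\<tau> \<in> X" "insert v \<tau> \<in> X" "v \<notin> \<tau>"
    using s t sub[of \<sigma> \<tau>] sub[of "insert v \<sigma>" "insert v \<tau>"] unfolding link_def by auto
  then show "\<tau> \<in> link X v" unfolding link_def by blast
qed (use assms in \<open>auto simp: link_def abstract_simplicial_complex_def\<close>)

section \<open>The combinatorics of systolic complexes\<close>

lemma triangle_rel_link: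
  assumes "abstract_simplicial_complex X" "x \<noteq> y"
  shows "triangle_rel X v x y \<longleftrightarrow> {x, y} \<in> link X v"
  using assms unfolding triangle_rel_def link_def abstract_simplicial_complex_def by auto

lemma link_diagonal:
  assumes X: "abstract_simplicial_complex X" and L: "locally_large k X"
    and vs: "distinct vs" "4 \<le> length vs" "length vs < k"
    and T: "\<And>i. i < length vs \<Longrightarrow> triangle_rel X v (vs ! i) (vs ! (Suc i mod length vs))"
  shows "\<exists>x\<in>set vs. \<exists>y\<in>set vs. triangle_rel X v x y \<and>
    (\<forall>i<length vs. {x, y} \<noteq> {vs ! i, vs ! (Suc i mod length vs)})"
proof -
  have "{v} \<in> X"
    using T[of 0] vs X unfolding triangle_rel_def abstract_simplicial_complex_def by fastforce
  then have "large k (link X v)" using L unfolding locally_large_def vertices_def by blast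
  moreover have "{vs ! i, vs ! (Suc i mod length vs)} \<in> link X v" if "i < length vs" for i
  proof -
    have "vs ! i \<noteq> vs ! (Suc i mod length vs)" using T[OF that] unfolding triangle_rel_def by blast
    then show ?thesis using T[OF that] triangle_rel_link[OF X] by blast
  qed
  ultimately have "\<exists>x\<in>(!) vs ` {..<length vs}. \<exists>y\<in>(!) vs ` {..<length vs}. x \<noteq> y \<and> {x, y} \<in> link X v \<and>
      (\<forall>i<length vs. {x, y} \<noteq> {vs ! i, vs ! (Suc i mod length vs)})"
    using vs by (intro large_cycle_diagonal[where k = k] abstract_link[OF X]) (auto simp: inj_on_nth)
  moreover have "(!) vs ` {..<length vs} = set vs" by (auto simp: set_conv_nth)
  ultimately show ?thesis using triangle_rel_link[OF X] by metis
qed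

text \<open>\<open>K4\<close> is flagness of the link of \<open>v\<close>; \<open>C4\<close>,
  \<open>C5\<close> and \<open>C6\<close> are its cycles of length 4, 5 and 6, the lengths below 7,
  with every pair of vertices that is not a side listed as a diagonal.\<close>

lemma triangle_complex_systolic:
  assumes X: "abstract_simplicial_complex X" and L: "locally_large 7 X"
  shows "triangle_complex (vertices X) (edge_rel X) (triangle_rel X)"
proof
  note sub = X[unfolded abstract_simplicial_complex_def, THEN conjunct2, rule_format]
  fix x y z v a b c d e g
  show "x \<in> vertices X" if "edge_rel X x y"
    using that sub[of "{x, y}" "{x}"] unfolding edge_rel_def vertices_def by auto
  show "edge_rel X y x" if "edge_rel X x y"
    using that unfolding edge_rel_def by (auto simp: insert_commute)
  show "\<not> edge_rel X x x" unfolding edge_rel_def by simp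
  show "triangle_rel X y x z" "triangle_rel X y z x" "edge_rel X x y" if "triangle_rel X x y z"
    using that sub[of "{x, y, z}" "{x, y}"] unfolding triangle_rel_def edge_rel_def by (auto simp: insert_commute)
  show "triangle_rel X a b c" if "triangle_rel X v a b" "triangle_rel X v b c" "triangle_rel X v a c"
  proof -
    have ne: "a \<noteq> b" "b \<noteq> c" "a \<noteq> c" using that unfolding triangle_rel_def by auto
    have l: "{a, b} \<in> link X v" "{b, c} \<in> link X v" "{a, c} \<in> link X v"
      using that ne triangle_rel_link[OF X] by blast+
    have "{v} \<in> X" using that(1) sub[of "{v, a, b}" "{v}"] unfolding triangle_rel_def by auto
    then have "flag_complex (link X v)" using L unfolding locally_large_def large_def vertices_def by blast
    moreover have "{a, b, c} \<subseteq> vertices (link X v)"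
      using l abstract_link[OF X, of v, unfolded abstract_simplicial_complex_def, THEN conjunct2, rule_format]
      unfolding vertices_def by blast
    moreover have "\<forall>u\<in>{a, b, c}. \<forall>w\<in>{a, b, c}. u \<noteq> w \<longrightarrow> {u, w} \<in> link X v"
      using l by (auto simp: insert_commute)
    moreover have "finite {a, b, c}" "{a, b, c} \<noteq> {}" by auto
    ultimately have "{a, b, c} \<in> link X v" unfolding flag_complex_def by metis
    then show ?thesis using ne unfolding triangle_rel_def link_def by auto
  qed
  have comm: "triangle_rel X v x y \<longleftrightarrow> triangle_rel X v y x" for v x y
    unfolding triangle_rel_def by (auto simp: insert_commute)
  show "triangle_rel X v a c \<or> triangle_rel X v b d"
    if T: "triangle_rel X v a b" "triangle_rel X v b c" "triangle_rel X v c d" "triangle_rel X v d a"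
      and "a \<noteq> c" "b \<noteq> d"
  proof -
    have ne: "distinct [a, b, c, d]" using that unfolding triangle_rel_def by auto
    have "\<exists>x\<in>set [a, b, c, d]. \<exists>y\<in>set [a, b, c, d]. triangle_rel X v x y \<and>
        (\<forall>i<length [a, b, c, d]. {x, y} \<noteq> {[a, b, c, d] ! i, [a, b, c, d] ! (Suc i mod length [a, b, c, d])})"
      using ne T by (intro link_diagonal[OF X L]) (auto simp: less_Suc_eq)
    then obtain x y where xy: "x \<in> set [a, b, c, d]" "y \<in> set [a, b, c, d]" and h: "triangle_rel X v x y"
        "\<forall>i<length [a, b, c, d]. {x, y} \<noteq> {[a, b, c, d] ! i, [a, b, c, d] ! (Suc i mod length [a, b, c, d])}"
      by blast
    have "x \<noteq> y" using h(1) unfolding triangle_rel_def by blast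
    moreover have "{x, y} \<noteq> {a, b}" "{x, y} \<noteq> {b, c}" "{x, y} \<noteq> {c, d}" "{x, y} \<noteq> {d, a}"
      using h(2)[rule_format, of 0] h(2)[rule_format, of 1] h(2)[rule_format, of 2] h(2)[rule_format, of 3] by auto
    ultimately show ?thesis using xy h(1)
      by (simp only: list.set insert_iff empty_iff simp_thms) (elim disjE; simp add: comm insert_commute)
  qed
  show "triangle_rel X v a c \<or> triangle_rel X v a d \<or> triangle_rel X v b d \<or> triangle_rel X v b e \<or> triangle_rel X v c e"
    if T: "triangle_rel X v a b" "triangle_rel X v b c" "triangle_rel X v c d" "triangle_rel X v d e" "triangle_rel X v e a"
      and ne: "distinct [a, b, c, d, e]"
  proof -
    have "\<exists>x\<in>set [a, b, c, d, e]. \<exists>y\<in>set [a, b, c, d, e]. triangle_rel X v x y \<and>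
        (\<forall>i<length [a, b, c, d, e]. {x, y} \<noteq> {[a, b, c, d, e] ! i, [a, b, c, d, e] ! (Suc i mod length [a, b, c, d, e])})"
      using ne T by (intro link_diagonal[OF X L]) (auto simp: less_Suc_eq)
    then obtain x y where xy: "x \<in> set [a, b, c, d, e]" "y \<in> set [a, b, c, d, e]" and h: "triangle_rel X v x y"
        "\<forall>i<length [a, b, c, d, e]. {x, y} \<noteq> {[a, b, c, d, e] ! i, [a, b, c, d, e] ! (Suc i mod length [a, b, c, d, e])}"
      by blast
    have "x \<noteq> y" using h(1) unfolding triangle_rel_def by blast
    moreover have "{x, y} \<noteq> {a, b}" "{x, y} \<noteq> {b, c}" "{x, y} \<noteq> {c, d}" "{x, y} \<noteq> {d, e}" "{x, y} \<noteq> {e, a}"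
      using h(2)[rule_format, of 0] h(2)[rule_format, of 1] h(2)[rule_format, of 2] h(2)[rule_format, of 3] h(2)[rule_format, of 4] by auto
    ultimately show ?thesis using xy h(1)
      by (simp only: list.set insert_iff empty_iff simp_thms) (elim disjE; simp add: comm insert_commute)
  qed
  show "triangle_rel X v a c \<or> triangle_rel X v a d \<or> triangle_rel X v a e \<or> triangle_rel X v b d \<or> triangle_rel X v b e \<or>
      triangle_rel X v b g \<or> triangle_rel X v c e \<or> triangle_rel X v c g \<or> triangle_rel X v d g"
    if T: "triangle_rel X v a b" "triangle_rel X v b c" "triangle_rel X v c d" "triangle_rel X v d e" "triangle_rel X v e g"
      "triangle_rel X v g a" and ne: "distinct [a, b, c, d, e, g]"
  proof -
    have "\<exists>x\<in>set [a, b, c, d, e, g]. \<exists>y\<in>set [a, b, c, d, e, g]. triangle_rel X v x y \<and>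
        (\<forall>i<length [a, b, c, d, e, g]. {x, y} \<noteq> {[a, b, c, d, e, g] ! i, [a, b, c, d, e, g] ! (Suc i mod length [a, b, c, d, e, g])})"
      using ne T by (intro link_diagonal[OF X L]) (auto simp: less_Suc_eq)
    then obtain x y where xy: "x \<in> set [a, b, c, d, e, g]" "y \<in> set [a, b, c, d, e, g]" and h: "triangle_rel X v x y"
        "\<forall>i<length [a, b, c, d, e, g]. {x, y} \<noteq> {[a, b, c, d, e, g] ! i, [a, b, c, d, e, g] ! (Suc i mod length [a, b, c, d, e, g])}"
      by blast
    have "x \<noteq> y" using h(1) unfolding triangle_rel_def by blast
    moreover have "{x, y} \<noteq> {a, b}" "{x, y} \<noteq> {b, c}" "{x, y} \<noteq> {c, d}" "{x, y} \<noteq> {d, e}" "{x, y} \<noteq> {e, g}" "{x, y} \<noteq> {g, a}"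
      using h(2)[rule_format, of 0] h(2)[rule_format, of 1] h(2)[rule_format, of 2] h(2)[rule_format, of 3] h(2)[rule_format, of 4] h(2)[rule_format, of 5] by auto
    ultimately show ?thesis using xy h(1)
      by (simp only: list.set insert_iff empty_iff simp_thms) (elim disjE; simp add: comm insert_commute)
  qed
qed

theorem theorem3p5:
  fixes X :: "'a set set"
  assumes "abstract_simplicial_complex X"
    and "systolic 7 X"
  shows "Gromov_hyperbolic (polyhedron_points (skeleton 1 X)) (path_dist X)"
proof -
  have L: "locally_large 7 X" and con: "connected_space (polyhedron X)" and sc: "simply_connected_space (polyhedron X)"
    using assms(2) unfolding systolic_def by auto
  interpret triangle_complex "vertices X" "edge_rel X" "triangle_rel X"
    using triangle_complex_systolic[OF assms(1) L] .
  interpret simply_connected_triangle_complex "vertices X" "edge_rel X" "triangle_rel X"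
  proof
    show "(edge_rel X)\<^sup>*\<^sup>* x y" if "x \<in> vertices X" "y \<in> vertices X" for x y
      using connected_edge_rel[OF assms(1) con that] .
    show "s = t" if "covering (edge_rel X) (triangle_rel X) Y R f" "R\<^sup>*\<^sup>* s t" "f s = f t"
      for Y and R :: "'a list \<Rightarrow> 'a list \<Rightarrow> bool" and f s t
      using simply_connected_monodromy[OF assms(1) sc that] .
  qed
  interpret metric_graph X graph_dist
  proof
    show "graph_dist u v \<le> 1" if "{u, v} \<in> X" for u v
    proof (cases "u = v")
      case False
      then have "edge_rel X u v" using that unfolding edge_rel_def by blast
      then show ?thesis using graph_dist_edge by simp
    qed simp
    show "\<exists>w. {u, w} \<in> X \<and> u \<noteq> w \<and> graph_dist w v = n" if uv: "u \<in> vertices X" "v \<in> vertices X" "graph_dist u v = Suc n" for u v n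
    proof -
      \<comment> \<open>\<open>lower_vertex\<close> descends towards its base point, so the base is
        \<open>v\<close> and the descent starts at \<open>u\<close>.\<close>
      obtain w where w: "edge_rel X u w" "graph_dist v w = n" using lower_vertex[of v u n] graph_dist_sym uv by metis
      then have "w \<in> vertices X" using E_V E_sym by blast
      then have "graph_dist w v = n" using graph_dist_sym w uv by metis
      then show ?thesis using w(1) unfolding edge_rel_def by blast
    qed
  qed (use assms(1) graph_dist_sym graph_dist_triangle graph_dist_eq_0 in auto)
  show ?thesis using Gromov_hyperbolic_path_dist four_point by blast
qed

end
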